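(* Let $\mathcal D=\{a_1,a_2,a_3\}\subset\mathbb{CP}^1$ be three distinct points and let $\chi:\pi_1(\mathbb{CP}^1\setminus\mathcal D)\to GL(2,\mathbb C)$ be a diagonal representation, i.e. one for which the monodromy matrices $G_1,G_2,G_3$ can be simultaneously reduced to the form $G_i=\mathrm{diag}(\alpha_i,\beta_i)$, $i=1,2,3$. Then $\chi$ can be realized by the monodromy of a Riemann equation with singular points $\mathcal D$ if and only if at least one of the matrices $G_1,G_2,G_3$ is scalar.
   Context: A Riemann equation with singular points $\mathcal D=\{a_1,a_2,a_3\}$ is a second order linear differential equation $y''+b_1(z)y'+b_2(z)y=0$ on the Riemann sphere whose coefficients are holomorphic outside $\mathcal D$ (with every point of $\mathbb{CP}^1\setminus\mathcal D$, including $\infty$ in the local coordinate $1/z$ if $\infty\notin\mathcal D$, being an ordinary point) and which is Fuchsian at each $a_i$: in a local coordinate $t$ centred at $a_i$, the coefficient of the $(2-j)$-th derivative has a pole of order at most $j$, $j=1,2$. Monodromy: continuing a basis (row) $Y$ of the two-dimensional solution space near a base point along a loop $\gamma$ in $\mathbb{CP}^1\setminus\mathcal D$ gives another basis $Y^*$ with $Y=Y^*G_\gamma$, $G_\gamma\in GL(2,\mathbb C)$. The matrix depends only on the homotopy class of $\gamma$, and $[\gamma]\mapsto G_\gamma$ is the monodromy representation, defined up to simultaneous conjugation (choice of basis). An equation realizes $\chi$ if $\chi$ is its monodromy representation in some basis of solutions. The group $\pi_1(\mathbb{CP}^1\setminus\mathcal D)$ is generated by loops around $a_1,a_2,a_3$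 whose product is trivial; $G_i$ denotes the matrix corresponding to the loop around $a_i$. *)

theory Defs
  imports "HOL-Complex_Analysis.Complex_Analysis" "HOL-Algebra.Generated_Groups"
begin

section \<open>The Riemann sphere\<close>

datatype cp1 = Fin complex | Infty

text \<open>The inverse of the standard local coordinate \<open>t\<close> centred at a point:
  \<open>t = z - c\<close> at a finite point \<open>c\<close>, and \<open>t = 1 / z\<close> at infinity.\<close>

fun chart :: "cp1 \<Rightarrow> complex \<Rightarrow> cp1" where
  "chart (Fin c) t = Fin (c + t)"
| "chart Infty t = (if t = 0 then Infty else Fin (1 / t))"

text \<open>The topology glued from the coordinates \<open>z\<close> and \<open>1 / z\<close>.\<close>

instantiation cp1 :: topological_space
begin

definition open_cp1 :: "cp1 set \<Rightarrow> bool" where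
  "open_cp1 U \<longleftrightarrow> open (Fin -` U) \<and> open (chart Infty -` U)"

instance
  by standard (auto simp: open_cp1_def vimage_Union)

end

section \<open>The fundamental group\<close>

definition is_loop :: "'a::topological_space set \<Rightarrow> 'a \<Rightarrow> (real \<Rightarrow> 'a) \<Rightarrow> bool" where
  "is_loop S x g \<longleftrightarrow> path g \<and> path_image g \<subseteq> S \<and> pathstart g = x \<and> pathfinish g = x"

definition path_class :: "'a::topological_space set \<Rightarrow> (real \<Rightarrow> 'a) \<Rightarrow> (real \<Rightarrow> 'a) set" where
  "path_class S g = {h. homotopic_paths S g h}"

text \<open>In the product \<open>A \<otimes> B\<close> the loop in \<open>A\<close> is traversed first.\<close>

definition fundamental_group ::
  "'a::topological_space set \<Rightarrow> 'a \<Rightarrow> (real \<Rightarrow> 'a) set monoid" where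
  "fundamental_group S x =
     \<lparr>carrier = {path_class S g | g. is_loop S x g},
      mult = (\<lambda>A B. {k. \<exists>g\<in>A. \<exists>h\<in>B. homotopic_paths S (g +++ h) k}),
      one = path_class S (\<lambda>_. x)\<rparr>"

lemma homotopic_paths_const_left:
  assumes "is_loop S x p"
  shows "homotopic_paths S ((\<lambda>_. x) +++ p) p"
proof (rule homotopic_paths_sym, rule homotopic_paths_reparametrize)
  show "path p" "path_image p \<subseteq> S"
    using assms by (auto simp: is_loop_def)
  show "continuous_on {0..1} (\<lambda>t::real. max 0 (2 * t - 1))"
    by (intro continuous_intros)
  show "((\<lambda>_. x) +++ p) t = p (max 0 (2 * t - 1))" if "t \<in> {0..1}" for t
  proof -
    have "t = 1/2" if "1 \<le> 2 * t" "t \<le> 1/2"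
      using that by simp
    then show ?thesis
      using assms by (fastforce simp: joinpaths_def is_loop_def pathstart_def max_def)
  qed
qed auto

lemma homotopic_paths_reversepath_left:
  assumes "is_loop S x p"
  shows "homotopic_paths S (reversepath p +++ p) (\<lambda>_. x)"
proof -
  let ?m = "\<lambda>u::real. max (1 - 2 * u) (2 * u - 1)"
  let ?k = "\<lambda>y::real \<times> real. max (fst y) (?m (snd y))"
  have p: "continuous_on {0..1} p" "p ` {0..1} \<subseteq> S" "p 0 = x" "p 1 = x"
    using assms by (auto simp: is_loop_def path_def path_image_def pathstart_def pathfinish_def)
  have k: "?k ` ({0..1} \<times> {0..1}) \<subseteq> {0..1}"
    by auto
  have "continuous_on ({0..1} \<times> {0..1}) (p \<circ> ?k)"
    by (rule continuous_on_compose)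
       (intro continuous_intros, rule continuous_on_subset[OF p(1) k])
  moreover have "p \<circ> ?k \<in> ({0..1} \<times> {0..1}) \<rightarrow> S"
    using p(2) k by fastforce
  moreover have "(p \<circ> ?k) (0, u) = (reversepath p +++ p) u" if "u \<in> {0..1}" for u
  proof (cases "u \<le> 1/2")
    case True
    then have "?k (0, u) = 1 - 2 * u" by auto
    then show ?thesis using True by (simp only: o_def) (simp add: joinpaths_def reversepath_def)
  next
    case False
    then have "?k (0, u) = 2 * u - 1" by auto
    then show ?thesis using False by (simp only: o_def) (simp add: joinpaths_def)
  qed
  moreover have "(p \<circ> ?k) (1, u) = x" if "u \<in> {0..1}" for u
  proof -
    have "?k (1, u) = 1" using that by auto
    then show ?thesis using p by (simp only: o_def)
  qed
  ultimately show ?thesis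
    unfolding homotopic_paths
    by (intro exI[of _ "p \<circ> ?k"])
       (use p in \<open>auto simp: pathstart_def pathfinish_def joinpaths_def reversepath_def max_def\<close>)
qed

lemma mult_path_class:
  assumes "is_loop S x g" "is_loop S x h"
  shows "path_class S g \<otimes>\<^bsub>fundamental_group S x\<^esub> path_class S h = path_class S (g +++ h)"
proof -
  have "homotopic_paths S (g +++ h) k"
    if "homotopic_paths S g g'" "homotopic_paths S h h'" "homotopic_paths S (g' +++ h') k" for g' h' k
    using homotopic_paths_join[OF that(1,2)] that(3) assms
    by (auto simp: is_loop_def intro: homotopic_paths_trans)
  moreover have "homotopic_paths S g g" "homotopic_paths S h h"
    using assms by (auto simp: is_loop_def)
  ultimately show ?thesis
    unfolding fundamental_group_def path_class_def by (auto simp del: homotopic_paths_refl)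
qed

lemma path_class_eqI: "homotopic_paths S g h \<Longrightarrow> path_class S g = path_class S h"
  unfolding path_class_def by (auto intro: homotopic_paths_trans homotopic_paths_sym)

lemma is_loop_join: "is_loop S x g \<Longrightarrow> is_loop S x h \<Longrightarrow> is_loop S x (g +++ h)"
  by (auto simp: is_loop_def path_image_join)

lemma is_loop_reversepath: "is_loop S x g \<Longrightarrow> is_loop S x (reversepath g)"
  by (auto simp: is_loop_def)

lemma is_loop_const: "x \<in> S \<Longrightarrow> is_loop S x (\<lambda>_. x)"
  by (auto simp: is_loop_def path_def path_image_def pathstart_def pathfinish_def)

lemma carrier_fundamental_group:
  "carrier (fundamental_group S x) = {path_class S g | g. is_loop S x g}"
  by (simp add: fundamental_group_def)

lemma one_fundamental_group: "\<one>\<^bsub>fundamental_group S x\<^esub> = path_class S (\<lambda>_. x)"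
  by (simp add: fundamental_group_def)

lemma group_fundamental_group:
  assumes "x \<in> S"
  shows "group (fundamental_group S x)"
proof (rule groupI)
  let ?P = "fundamental_group S x"
  note simps = carrier_fundamental_group one_fundamental_group
  show "A \<otimes>\<^bsub>?P\<^esub> B \<in> carrier ?P" if "A \<in> carrier ?P" "B \<in> carrier ?P" for A B
    using that by (auto simp: simps mult_path_class intro: is_loop_join)
  show "\<one>\<^bsub>?P\<^esub> \<in> carrier ?P"
    using is_loop_const[OF assms] by (auto simp: simps)
  show "A \<otimes>\<^bsub>?P\<^esub> B \<otimes>\<^bsub>?P\<^esub> C = A \<otimes>\<^bsub>?P\<^esub> (B \<otimes>\<^bsub>?P\<^esub> C)"
    if abc: "A \<in> carrier ?P" "B \<in> carrier ?P" "C \<in> carrier ?P" for A B C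
  proof -
    obtain f g h where "A = path_class S f" "B = path_class S g" "C = path_class S h"
      and l: "is_loop S x f" "is_loop S x g" "is_loop S x h"
      using abc by (auto simp: simps)
    moreover have "homotopic_paths S (f +++ (g +++ h)) ((f +++ g) +++ h)"
      using l by (intro homotopic_paths_assoc) (auto simp: is_loop_def)
    ultimately show ?thesis
      by (simp add: mult_path_class is_loop_join path_class_eqI)
  qed
  show "\<one>\<^bsub>?P\<^esub> \<otimes>\<^bsub>?P\<^esub> A = A" if "A \<in> carrier ?P" for A
    using that is_loop_const[OF assms] path_class_eqI[OF homotopic_paths_const_left]
    by (fastforce simp: simps mult_path_class)
  show "\<exists>B\<in>carrier ?P. B \<otimes>\<^bsub>?P\<^esub> A = \<one>\<^bsub>?P\<^esub>" if A: "A \<in> carrier ?P" for A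
  proof -
    obtain g where g: "A = path_class S g" "is_loop S x g"
      using A by (auto simp: simps)
    then have "path_class S (reversepath g) \<otimes>\<^bsub>?P\<^esub> A = \<one>\<^bsub>?P\<^esub>"
      by (simp add: simps mult_path_class is_loop_reversepath path_class_eqI
          homotopic_paths_reversepath_left)
    then show ?thesis
      using g by (auto simp: simps intro: is_loop_reversepath)
  qed
qed

definition GL2 :: "(complex^2^2) monoid" where
  "GL2 = \<lparr>carrier = {A. invertible A}, mult = (**), one = mat 1\<rparr>"

lemma group_GL2: "group GL2"
proof (rule groupI)
  show "\<exists>B\<in>carrier GL2. B \<otimes>\<^bsub>GL2\<^esub> A = \<one>\<^bsub>GL2\<^esub>" if "A \<in> carrier GL2" for A
    using that unfolding GL2_def invertible_def by auto
  show "\<one>\<^bsub>GL2\<^esub> \<in> carrier GL2"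
    unfolding GL2_def invertible_def by (auto intro: exI[of _ "mat 1"])
qed (auto simp: GL2_def invertible_mult matrix_mul_assoc)

section \<open>Generators of the fundamental group of the punctured sphere\<close>

text \<open>A loop around \<open>p\<close>: up to homotopy it runs from the base point \<open>x\<close> along a path \<open>d\<close> to a
  point near \<open>p\<close>, once along a small circle that is positively oriented in the local coordinate at
  \<open>p\<close>, and back along \<open>d\<close>.\<close>

definition loop_around :: "cp1 set \<Rightarrow> cp1 \<Rightarrow> cp1 \<Rightarrow> (real \<Rightarrow> cp1) \<Rightarrow> bool" where
  "loop_around D x p g \<longleftrightarrow>
     (\<exists>d r. 0 < r \<and> chart p ` (cball 0 r - {0}) \<inter> D = {} \<and>
        path d \<and> path_image d \<subseteq> - D \<and> pathstart d = x \<and> pathfinish d = chart p (of_real r) \<and>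
        homotopic_paths (- D) g (d +++ (chart p \<circ> circlepath 0 r) +++ reversepath d))"

definition standard_loops :: "(3 \<Rightarrow> cp1) \<Rightarrow> cp1 \<Rightarrow> (3 \<Rightarrow> real \<Rightarrow> cp1) \<Rightarrow> bool" where
  "standard_loops a x \<gamma> \<longleftrightarrow>
     (let S = - range a; P = fundamental_group S x; c = (\<lambda>i. path_class S (\<gamma> i)) in
        (\<forall>i. loop_around (range a) x (a i) (\<gamma> i)) \<and>
        c 1 \<otimes>\<^bsub>P\<^esub> c 2 \<otimes>\<^bsub>P\<^esub> c 3 = \<one>\<^bsub>P\<^esub> \<and>
        generate P (range c) = carrier P)"

section \<open>Riemann equations\<close>

text \<open>The coefficients of the equation \<open>y'' + b1 y' + b2 y = 0\<close> rewritten in the local coordinate at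
  a point. At infinity \<open>dy/dz = - t\<^sup>2 dy/dt\<close> and
  \<open>d\<^sup>2y/dz\<^sup>2 = t\<^sup>4 d\<^sup>2y/dt\<^sup>2 + 2 t\<^sup>3 dy/dt\<close> where \<open>t = 1 / z\<close>.\<close>

fun coeff1 :: "(complex \<Rightarrow> complex) \<Rightarrow> cp1 \<Rightarrow> complex \<Rightarrow> complex" where
  "coeff1 b1 (Fin c) t = b1 (c + t)"
| "coeff1 b1 Infty t = 2 / t - b1 (1 / t) / t ^ 2"

fun coeff2 :: "(complex \<Rightarrow> complex) \<Rightarrow> cp1 \<Rightarrow> complex \<Rightarrow> complex" where
  "coeff2 b2 (Fin c) t = b2 (c + t)"
| "coeff2 b2 Infty t = b2 (1 / t) / t ^ 4"

text \<open>For \<open>k = 0\<close> this says that \<open>f\<close> extends holomorphically to the origin.\<close>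

definition pole_order_at_most :: "nat \<Rightarrow> (complex \<Rightarrow> complex) \<Rightarrow> bool" where
  "pole_order_at_most k f \<longleftrightarrow>
     (\<exists>g. g analytic_on {0} \<and> (\<forall>\<^sub>F t in at 0. f t = g t / t ^ k))"

definition riemann_equation ::
  "cp1 set \<Rightarrow> (complex \<Rightarrow> complex) \<Rightarrow> (complex \<Rightarrow> complex) \<Rightarrow> bool" where
  "riemann_equation D b1 b2 \<longleftrightarrow>
     b1 holomorphic_on {z. Fin z \<notin> D} \<and> b2 holomorphic_on {z. Fin z \<notin> D} \<and>
     (Infty \<notin> D \<longrightarrow> pole_order_at_most 0 (coeff1 b1 Infty) \<and> pole_order_at_most 0 (coeff2 b2 Infty)) \<and>
     (\<forall>p\<in>D. pole_order_at_most 1 (coeff1 b1 p) \<and> pole_order_at_most 2 (coeff2 b2 p))"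

section \<open>Monodromy\<close>

definition analytic_at_cp1 :: "(cp1 \<Rightarrow> complex) \<Rightarrow> cp1 \<Rightarrow> bool" where
  "analytic_at_cp1 f p \<longleftrightarrow> (f \<circ> chart p) analytic_on {0}"

text \<open>Here \<open>p\<close> is meant to be an ordinary point. The centre \<open>t = 0\<close> is left out because
  at infinity the value of a coefficient there is not the one of its holomorphic extension;
  the equation at \<open>t = 0\<close> follows by continuity.\<close>

definition solution_near ::
  "(complex \<Rightarrow> complex) \<Rightarrow> (complex \<Rightarrow> complex) \<Rightarrow> cp1 \<Rightarrow> (cp1 \<Rightarrow> complex) \<Rightarrow> bool" where
  "solution_near b1 b2 p y \<longleftrightarrow>
     analytic_at_cp1 y p \<and>
     (let u = y \<circ> chart p in
        \<forall>\<^sub>F t in at 0. deriv (deriv u) t + coeff1 b1 p t * deriv u t + coeff2 b2 p t * u t = 0)"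

text \<open>Bases of the space of germs of solutions at \<open>p\<close>, as row vectors of functions.\<close>

definition solution_basis ::
  "(complex \<Rightarrow> complex) \<Rightarrow> (complex \<Rightarrow> complex) \<Rightarrow> cp1 \<Rightarrow> (cp1 \<Rightarrow> complex^2) \<Rightarrow> bool" where
  "solution_basis b1 b2 p Y \<longleftrightarrow>
     (\<forall>j. solution_near b1 b2 p (\<lambda>q. Y q $ j)) \<and>
     (\<forall>c :: complex^2. (\<forall>\<^sub>F q in nhds p. (\<Sum>j\<in>UNIV. c $ j * Y q $ j) = 0) \<longrightarrow> c = 0) \<and>
     (\<forall>y. solution_near b1 b2 p y \<longrightarrow>
        (\<exists>c :: complex^2. \<forall>\<^sub>F q in nhds p. y q = (\<Sum>j\<in>UNIV. c $ j * Y q $ j)))"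

text \<open>Analytic continuation along \<open>\<gamma>\<close>: a family \<open>F\<close> of germs at the points \<open>\<gamma> s\<close> that is
  locally induced by a single function.\<close>

definition continuation_along ::
  "(real \<Rightarrow> cp1) \<Rightarrow> (cp1 \<Rightarrow> complex^2) \<Rightarrow> (cp1 \<Rightarrow> complex^2) \<Rightarrow> bool" where
  "continuation_along \<gamma> Y Y' \<longleftrightarrow>
     (\<exists>F :: real \<Rightarrow> cp1 \<Rightarrow> complex^2.
        (\<forall>s\<in>{0..1}. (\<forall>j. analytic_at_cp1 (\<lambda>q. F s q $ j) (\<gamma> s)) \<and>
           (\<forall>\<^sub>F u in at s within {0..1}. \<forall>\<^sub>F q in nhds (\<gamma> u). F u q = F s q)) \<and>
        (\<forall>\<^sub>F q in nhds (\<gamma> 0). F 0 q = Y q) \<and>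
        (\<forall>\<^sub>F q in nhds (\<gamma> 1). F 1 q = Y' q))"

definition realizes ::
  "cp1 set \<Rightarrow> cp1 \<Rightarrow> (complex \<Rightarrow> complex) \<Rightarrow> (complex \<Rightarrow> complex) \<Rightarrow>
   ((real \<Rightarrow> cp1) set \<Rightarrow> complex^2^2) \<Rightarrow> bool" where
  "realizes D x b1 b2 \<rho> \<longleftrightarrow>
     (\<exists>Y. solution_basis b1 b2 x Y \<and>
        (\<forall>\<gamma>. is_loop (- D) x \<gamma> \<longrightarrow>
           (\<exists>Y'. continuation_along \<gamma> Y Y' \<and>
              (\<forall>\<^sub>F q in nhds x. Y q = Y' q v* \<rho> (path_class (- D) \<gamma>)))))"

definition diag2 :: "complex \<Rightarrow> complex \<Rightarrow> complex^2^2" where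
  "diag2 \<alpha> \<beta> = vector [vector [\<alpha>, 0], vector [0, \<beta>]]"

definition scalar_matrix :: "complex^2^2 \<Rightarrow> bool" where
  "scalar_matrix A \<longleftrightarrow> (\<exists>c. A = mat c)"

end

theory Submission
  imports Defs
begin

text \<open>
  Suppose that an equation has diagonal monodromy in a basis of solutions \<open>y1, y2\<close> with Wronskian
  \<open>W\<close>. Then \<open>A = y1 y2 / W\<close> is single valued, and \<open>A d/dz\<close> is a holomorphic vector field on the
  sphere minus the singular points, because \<open>W\<close> has no zeros there. Together with \<open>(y1 y2)' / W\<close> and
  \<open>y1' y2' / W\<close> it solves a Fuchsian linear system, so it has moderate growth and is meromorphic at
  the singular points. Since \<open>(log (y2 / y1))' = 1 / A\<close>, at a singular point where the field does not
  vanish \<open>1 / A\<close> is holomorphic, and \<open>y2 / y1\<close> is single valued near that point: the local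
  monodromy is scalar. A holomorphic vector field on the sphere with three zeros vanishes identically,
  hence some local monodromy is scalar.

  Conversely, if the monodromy at the third point is scalar, powers of ratios of linear forms
  \<open>y1 = (e1 / e3) powr l * (e2 / e3) powr m\<close> and \<open>y2 = y1 * (e1 / e2) powr \<nu>\<close> with \<open>\<nu> \<noteq> 0\<close> are solutions of a
  Riemann equation, and their monodromy is computed by winding numbers.
\<close>

text \<open>A diagonal matrix with entries \<open>a\<close>, \<open>b\<close> multiplies both
  \<open>y1 y2\<close> and \<open>W\<close> by \<open>a b\<close>, hence \<open>A\<close> is single
  valued; it is a vector field because \<open>W\<close> picks up the derivative of the coordinate.
  Its coefficient is a polynomial of degree at most 2, so three zeros are one too many, and
  \<open>B^2 - 4 A C = 1\<close> forbids \<open>A = 0\<close>. Meromorphy at a Fuchsian point comes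
  from a Gronwall estimate instead of a local normal form. Since solutions are multivalued, the work
  is done with germs. Continuations along loops are supplied by the monodromy hypothesis, and an
  open path is closed up by its reverse, so no existence theorem for differential equations enters.
  In the converse the exponents of each solution add up to zero, which makes it a function of ratios
  and not of the homogeneous coordinates. At the third point \<open>y2 / y1\<close> is holomorphic
  and nonzero, so the monodromy there is scalar. If the whole representation is scalar, the natural
  choice \<open>\<nu> = 0\<close> would make the solutions dependent, and \<open>\<nu> = 1\<close>
  replaces it.\<close>

no_notation fps_nth (infixl "$" 75)

section \<open>Charts and germs on the sphere\<close>


lemma open_inverse_vimage:
  assumes "open (T::complex set)"
  shows "open {t. t \<noteq> 0 \<and> 1 / t \<in> T}"
proof -
  have "open ((\<lambda>t. 1 / t) -` T \<inter> (- {0}))"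
    using assms by (intro continuous_on_open_vimage[THEN iffD1, rule_format]) (auto intro!: continuous_intros)
  then show ?thesis by (simp add: vimage_def Int_def conj_commute)
qed

lemma open_chart_vimage: "open U \<Longrightarrow> open (chart p -` U)"
proof (cases p)
  case (Fin c)
  assume "open U"
  then have "open (Fin -` U)" by (simp add: open_cp1_def)
  then have "open ((+) c -` (Fin -` U))"
    by (rule open_vimage) (intro continuous_intros)
  then show ?thesis using Fin by (simp add: vimage_def)
qed (simp add: open_cp1_def)

lemma open_Fin_vimage: "open U \<Longrightarrow> open (Fin -` U)"
  by (simp add: open_cp1_def)

lemma inj_chart: "inj (chart p)"
  by (cases p) (auto simp: inj_def split: if_splits)

lemma chart_0 [simp]: "chart p 0 = p"
  by (cases p) auto

lemma open_chart_image:
  assumes "open S" shows "open (chart p ` S)"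
proof (cases p)
  case (Fin c)
  have "Fin -` (chart p ` S) = (+) c ` S" using Fin by auto
  moreover have "chart Infty -` (chart p ` S) = {t. t \<noteq> 0 \<and> 1 / t \<in> (+) c ` S}"
    using Fin by (auto split: if_splits simp: image_iff)
  ultimately show ?thesis
    unfolding open_cp1_def using open_inverse_vimage open_translation[OF assms] by simp
next
  case Infty
  have "Fin -` (chart p ` S) = {t. t \<noteq> 0 \<and> 1 / t \<in> S}"
  proof (intro equalityI subsetI)
    fix z assume "z \<in> {t. t \<noteq> 0 \<and> 1 / t \<in> S}"
    then show "z \<in> Fin -` (chart p ` S)" using Infty by (auto intro!: image_eqI[of _ _ "1/z"])
  qed (use Infty in \<open>auto split: if_splits\<close>)
  moreover have "chart Infty -` (chart p ` S) = S"
    using Infty by (simp only: inj_vimage_image_eq[OF inj_chart])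
  ultimately show ?thesis
    unfolding open_cp1_def using open_inverse_vimage[OF assms] assms by simp
qed

lemma continuous_on_chart: "continuous_on A (chart p)"
  by (rule continuous_on_subset[of UNIV])
    (auto simp: continuous_on_open_vimage open_chart_vimage)

lemma continuous_on_Fin: "continuous_on A Fin"
  by (rule continuous_on_subset[of UNIV])
    (auto simp: continuous_on_open_vimage open_Fin_vimage)

text \<open>Charts are continuous and open, so a germ on the sphere is the same as a germ in any
  chart through the point. Local statements pass to the plane through this equivalence.\<close>

lemma eventually_nhds_chart:
  "(\<forall>\<^sub>F q in nhds (chart p t). Q q) \<longleftrightarrow> (\<forall>\<^sub>F s in nhds t. Q (chart p s))"
proof
  assume "\<forall>\<^sub>F q in nhds (chart p t). Q q"
  then obtain V where "open V" "chart p t \<in> V" "\<forall>q\<in>V. Q q"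
    unfolding eventually_nhds by auto
  then show "\<forall>\<^sub>F s in nhds t. Q (chart p s)"
    unfolding eventually_nhds by (intro exI[of _ "chart p -` V"]) (auto simp: open_chart_vimage)
next
  assume "\<forall>\<^sub>F s in nhds t. Q (chart p s)"
  then obtain V where "open V" "t \<in> V" "\<forall>s\<in>V. Q (chart p s)"
    unfolding eventually_nhds by auto
  then show "\<forall>\<^sub>F q in nhds (chart p t). Q q"
    unfolding eventually_nhds by (intro exI[of _ "chart p ` V"]) (auto simp: open_chart_image)
qed

lemma eventually_nhds_cp1:
  "(\<forall>\<^sub>F q in nhds p. Q q) \<longleftrightarrow> (\<forall>\<^sub>F s in nhds 0. Q (chart p s))"
  using eventually_nhds_chart[of Q p 0] by simp

lemma eventually_nhds_Fin:
  "(\<forall>\<^sub>F q in nhds (Fin z). Q q) \<longleftrightarrow> (\<forall>\<^sub>F w in nhds z. Q (Fin w))"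
  using eventually_nhds_chart[of Q "Fin 0" z] by simp

text \<open>\<open>analytic_at_cp1\<close> uses the chart centred at the point itself. This frees
  the choice of chart, because the transition maps, such as \<open>1 / s - 1 / t\<close>, are
  holomorphic where they are used. One disc around \<open>p\<close> then serves all nearby
  points.\<close>

lemma analytic_at_chart:
  "analytic_at_cp1 f (chart p t) \<longleftrightarrow> (f \<circ> chart p) analytic_on {t}"
proof -
  have transfer: "(f \<circ> chart p') analytic_on {t'}"
    if "(f \<circ> chart p) analytic_on {h t'}" "h analytic_on {t'}"
       "\<forall>\<^sub>F s in nhds t'. chart p' s = chart p (h s)" for p' t' p h
  proof -
    have comp: "((f \<circ> chart p) \<circ> h) analytic_on {t'}"
      by (rule analytic_on_compose) (use that in simp_all)
    have "\<forall>\<^sub>F s in nhds t'. ((f \<circ> chart p) \<circ> h) s = (f \<circ> chart p') s"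
      using that(3) by eventually_elim simp
    from analytic_at_cong[OF this refl] comp show ?thesis by (rule iffD1)
  qed
  show ?thesis
  proof (cases p)
    case (Fin c)
    show ?thesis unfolding analytic_at_cp1_def
    proof
      assume "(f \<circ> chart (chart p t)) analytic_on {0}"
      then show "(f \<circ> chart p) analytic_on {t}"
        using Fin by - (rule transfer[of "chart p t" "\<lambda>s. s - t"], auto intro!: analytic_intros)
    next
      assume "(f \<circ> chart p) analytic_on {t}"
      then show "(f \<circ> chart (chart p t)) analytic_on {0}"
        using Fin by - (rule transfer[of p "\<lambda>s. s + t"], auto intro!: analytic_intros simp: algebra_simps)
    qed
  next
    case Infty
    show ?thesis
    proof (cases "t = 0")
      case True
      then show ?thesis by (simp add: analytic_at_cp1_def)
    next
      case False
      have ev1: "\<forall>\<^sub>F s in nhds t. s \<noteq> 0"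
        using False by (metis t1_space_nhds)
      have ev2: "\<forall>\<^sub>F s in nhds 0. 1 / t + s \<noteq> 0"
      proof -
        have "\<forall>\<^sub>F s in nhds 0. s \<noteq> - (1 / t)"
          using False by (intro t1_space_nhds) simp
        then show ?thesis by eventually_elim (auto simp: add_eq_0_iff)
      qed
      show ?thesis unfolding analytic_at_cp1_def
      proof
        assume "(f \<circ> chart (chart p t)) analytic_on {0}"
        then show "(f \<circ> chart p) analytic_on {t}"
          using Infty False ev1
          by - (rule transfer[of "chart p t" "\<lambda>s. 1 / s - 1 / t"], auto intro!: analytic_intros elim!: eventually_mono)
      next
        assume "(f \<circ> chart p) analytic_on {t}"
        then show "(f \<circ> chart (chart p t)) analytic_on {0}"
          using Infty False ev2
          by - (rule transfer[of p "\<lambda>s. 1 / (1 / t + s)"], auto intro!: analytic_intros elim!: eventually_mono)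
      qed
    qed
  qed
qed

lemma analytic_at_Fin: "analytic_at_cp1 f (Fin z) \<longleftrightarrow> (\<lambda>w. f (Fin w)) analytic_on {z}"
  using analytic_at_chart[of f "Fin 0" z] by (simp add: o_def)

lemma analytic_at_cp1_cong:
  assumes "\<forall>\<^sub>F q in nhds p. f q = g q"
  shows "analytic_at_cp1 f p = analytic_at_cp1 g p"
  unfolding analytic_at_cp1_def using assms
  by (intro analytic_at_cong) (auto simp: eventually_nhds_cp1)

lemma analytic_at_cp1_ball:
  assumes "analytic_at_cp1 f p"
  obtains e where "e > 0" "(f \<circ> chart p) holomorphic_on ball 0 e"
  using assms unfolding analytic_at_cp1_def analytic_at_ball by blast

lemma eventually_analytic_at_cp1:
  assumes "analytic_at_cp1 f p"
  shows "\<forall>\<^sub>F q in nhds p. analytic_at_cp1 f q"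
proof -
  obtain e where e: "e > 0" "(f \<circ> chart p) holomorphic_on ball 0 e"
    using analytic_at_cp1_ball[OF assms] .
  have "\<forall>\<^sub>F s in nhds 0. s \<in> ball (0::complex) e"
    using e by (intro eventually_nhds_in_open) auto
  then show ?thesis
    unfolding eventually_nhds_cp1 analytic_at_chart
    using e(2) by (auto elim!: eventually_mono simp: analytic_on_open[symmetric] intro: analytic_on_subset)
qed

lemma identity_theorem_chart:
  assumes "(f \<circ> chart p) holomorphic_on ball 0 e" "t \<in> ball 0 e"
    and "\<forall>\<^sub>F q in nhds (chart p t). f q = 0" and "s \<in> ball 0 e"
  shows "f (chart p s) = 0"
proof -
  have "\<forall>\<^sub>F s in nhds t. f (chart p s) = 0"
    using assms(3) by (simp add: eventually_nhds_chart)
  then obtain V where V: "open V" "t \<in> V" "\<forall>s\<in>V. f (chart p s) = 0"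
    unfolding eventually_nhds by auto
  have "(f \<circ> chart p) s = 0"
  proof (rule analytic_continuation_open[of "V \<inter> ball 0 e" "ball 0 e" "f \<circ> chart p" "\<lambda>_. 0"])
    show "V \<inter> ball 0 e \<noteq> {}" using V assms(2) by auto
  qed (use V assms in auto)
  then show ?thesis by simp
qed

text \<open>A disc is connected, so by the identity theorem a germ that vanishes at one of its
  points vanishes at all of them.\<close>

lemma vanishing_iff_chart:
  assumes e: "e > 0" "(f \<circ> chart p) holomorphic_on ball 0 e" and t: "t \<in> ball 0 e"
  shows "(\<forall>\<^sub>F r in nhds (chart p t). f r = 0) = (\<forall>\<^sub>F r in nhds p. f r = 0)"
proof
  show "\<forall>\<^sub>F r in nhds p. f r = 0" if "\<forall>\<^sub>F r in nhds (chart p t). f r = 0"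
    unfolding eventually_nhds_cp1
    by (rule eventually_mono[OF eventually_nhds_in_open[of "ball 0 e"]])
      (use e t identity_theorem_chart[OF e(2) t that] in auto)
  show "\<forall>\<^sub>F r in nhds (chart p t). f r = 0" if "\<forall>\<^sub>F r in nhds p. f r = 0"
  proof -
    have "\<forall>s\<in>ball 0 e. f (chart p s) = 0"
      using identity_theorem_chart[OF e(2), of 0] that e by simp
    then show ?thesis
      unfolding eventually_nhds_chart
      using t by (intro eventually_mono[OF eventually_nhds_in_open[of "ball 0 e"]]) auto
  qed
qed

lemma eventually_chart_ball:
  assumes "e > 0" "\<And>t. t \<in> ball 0 e \<Longrightarrow> Q (chart p t)"
  shows "\<forall>\<^sub>F q in nhds p. Q q"
  unfolding eventually_nhds_cp1
  by (rule eventually_mono[OF eventually_nhds_in_open[of "ball 0 e"]]) (use assms in auto)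

text \<open>In this form vanishing is a locally constant property of the point, as
  \<open>germ_family_invariant\<close> requires.\<close>

lemma eventually_vanishing_iff:
  assumes "analytic_at_cp1 f p"
  shows "\<forall>\<^sub>F q in nhds p. (\<forall>\<^sub>F r in nhds q. f r = 0) = (\<forall>\<^sub>F r in nhds p. f r = 0)"
proof -
  obtain e where e: "e > 0" "(f \<circ> chart p) holomorphic_on ball 0 e"
    using analytic_at_cp1_ball[OF assms] .
  show ?thesis
    by (rule eventually_chart_ball[OF e(1)]) (rule vanishing_iff_chart[OF e])
qed

section \<open>Families of germs along a path\<close>

text \<open>The coherence condition of \<open>continuation_along\<close> without its end conditions;
  the intermediate germs \<open>F s\<close> are needed when paths are cut, reversed or
  joined.\<close>

definition germ_family :: "(real \<Rightarrow> cp1) \<Rightarrow> (real \<Rightarrow> cp1 \<Rightarrow> complex^2) \<Rightarrow> bool" where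
  "germ_family \<gamma> F \<longleftrightarrow>
     (\<forall>s\<in>{0..1}. (\<forall>j. analytic_at_cp1 (\<lambda>q. F s q $ j) (\<gamma> s)) \<and>
        (\<forall>\<^sub>F u in at s within {0..1}. \<forall>\<^sub>F q in nhds (\<gamma> u). F u q = F s q))"

lemma continuation_along_iff:
  "continuation_along \<gamma> Y Y' \<longleftrightarrow>
     (\<exists>F. germ_family \<gamma> F \<and> (\<forall>\<^sub>F q in nhds (\<gamma> 0). F 0 q = Y q) \<and> (\<forall>\<^sub>F q in nhds (\<gamma> 1). F 1 q = Y' q))"
  unfolding continuation_along_def germ_family_def by simp

lemma eventually_path_at:
  assumes "path \<gamma>" "s \<in> {0..1}" "\<forall>\<^sub>F q in nhds (\<gamma> s). Q q"
  shows "\<forall>\<^sub>F u in at s within {0..1}. Q (\<gamma> u)"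
proof -
  have "(\<gamma> \<longlongrightarrow> \<gamma> s) (at s within {0..1})"
    using assms by (simp add: path_def continuous_on_def)
  then show ?thesis using assms(3) by (simp add: filterlim_iff)
qed

text \<open>Principle of permanence: the interval is connected, and the property is locally constant
  along it. Below it is applied to vanishing, to the equation, to independence and to a functional
  relation between the components.\<close>

lemma germ_family_invariant:
  assumes F: "germ_family \<gamma> F" and \<gamma>: "path \<gamma>"
    and loc: "\<And>s (f :: cp1 \<Rightarrow> complex^2). s \<in> {0..1} \<Longrightarrow> (\<And>j. analytic_at_cp1 (\<lambda>q. f q $ j) (\<gamma> s)) \<Longrightarrow>
                \<forall>\<^sub>F q in nhds (\<gamma> s). P q f = P (\<gamma> s) f"
    and cong: "\<And>p f g. \<forall>\<^sub>F q in nhds p. f q = g q \<Longrightarrow> P p f = P p g"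
  shows "P (\<gamma> 0) (F 0) = P (\<gamma> 1) (F 1)"
proof (rule connected_local_const[of "{0..1::real}" 0 1 "\<lambda>s. P (\<gamma> s) (F s)"])
  show "\<forall>s\<in>{0..1}. \<forall>\<^sub>F u in at s within {0..1}. P (\<gamma> s) (F s) = P (\<gamma> u) (F u)"
  proof
    fix s :: real assume s: "s \<in> {0..1}"
    have "\<forall>\<^sub>F u in at s within {0..1}. P (\<gamma> u) (F s) = P (\<gamma> s) (F s)"
      by (rule eventually_path_at[OF \<gamma> s]) (use loc[OF s] F s in \<open>auto simp: germ_family_def\<close>)
    moreover have "\<forall>\<^sub>F u in at s within {0..1}. \<forall>\<^sub>F q in nhds (\<gamma> u). F u q = F s q"
      using F s by (auto simp: germ_family_def)
    ultimately show "\<forall>\<^sub>F u in at s within {0..1}. P (\<gamma> s) (F s) = P (\<gamma> u) (F u)"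
    proof eventually_elim
      case (elim u)
      then show ?case using cong[OF elim(2)] by simp
    qed
  qed
qed auto

text \<open>Used with affine \<open>\<phi>\<close> to restrict a continuation to one half of a
  joined path or to run it backwards.\<close>

lemma germ_family_compose:
  assumes F: "germ_family \<gamma> F" and \<phi>: "continuous_on {0..1} \<phi>" "\<phi> ` {0..1} \<subseteq> {0..1}"
    and \<delta>: "\<And>s. s \<in> {0..1} \<Longrightarrow> \<delta> s = \<gamma> (\<phi> s)"
  shows "germ_family \<delta> (F \<circ> \<phi>)"
  unfolding germ_family_def
proof (intro ballI conjI allI)
  fix s :: real assume s: "s \<in> {0..1}"
  then have \<phi>s: "\<phi> s \<in> {0..1}" using \<phi>(2) by blast
  show "analytic_at_cp1 (\<lambda>q. (F \<circ> \<phi>) s q $ j) (\<delta> s)" for j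
    using bspec[OF F[unfolded germ_family_def] \<phi>s] \<delta>[OF s] by simp
  have "\<forall>\<^sub>F u in at (\<phi> s) within {0..1}. \<forall>\<^sub>F q in nhds (\<gamma> u). F u q = F (\<phi> s) q"
    using bspec[OF F[unfolded germ_family_def] \<phi>s] by simp
  then obtain V where V: "open V" "\<phi> s \<in> V"
    "\<And>u. u \<in> V \<Longrightarrow> u \<noteq> \<phi> s \<Longrightarrow> u \<in> {0..1} \<Longrightarrow> \<forall>\<^sub>F q in nhds (\<gamma> u). F u q = F (\<phi> s) q"
    unfolding eventually_at_topological by blast
  have "(\<phi> \<longlongrightarrow> \<phi> s) (at s within {0..1})"
    using \<phi> s by (simp add: continuous_on_def)
  then have "\<forall>\<^sub>F u in at s within {0..1}. \<phi> u \<in> V"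
    using V by (simp add: topological_tendstoD)
  moreover have "\<forall>\<^sub>F u in at s within {0..1}. u \<in> {0..1}"
    by (simp add: eventually_at_filter)
  ultimately show "\<forall>\<^sub>F u in at s within {0..1}. \<forall>\<^sub>F q in nhds (\<delta> u). (F \<circ> \<phi>) u q = (F \<circ> \<phi>) s q"
  proof eventually_elim
    case (elim u)
    then have "\<phi> u \<in> {0..1}" using \<phi>(2) by blast
    \<comment> \<open>The coherence condition says nothing at the parameter \<open>\<phi> s\<close>
      itself, so the case \<open>\<phi> u = \<phi> s\<close> is settled by reflexivity.\<close>
    then show ?case using V(3)[of "\<phi> u"] elim \<delta> by (cases "\<phi> u = \<phi> s") auto
  qed
qed

lemma germ_family_const:
  assumes "\<And>s j. s \<in> {0..1} \<Longrightarrow> analytic_at_cp1 (\<lambda>q. f q $ j) (\<gamma> s)"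
  shows "germ_family \<gamma> (\<lambda>_. f)"
  using assms by (simp add: germ_family_def)

lemma analytic_at_cp1_add:
  "analytic_at_cp1 f p \<Longrightarrow> analytic_at_cp1 g p \<Longrightarrow> analytic_at_cp1 (\<lambda>q. f q + g q) p"
  unfolding analytic_at_cp1_def o_def by (rule analytic_on_add)

lemma analytic_at_cp1_diff:
  "analytic_at_cp1 f p \<Longrightarrow> analytic_at_cp1 g p \<Longrightarrow> analytic_at_cp1 (\<lambda>q. f q - g q) p"
  unfolding analytic_at_cp1_def o_def by (rule analytic_on_diff)

lemma analytic_at_cp1_mult:
  "analytic_at_cp1 f p \<Longrightarrow> analytic_at_cp1 g p \<Longrightarrow> analytic_at_cp1 (\<lambda>q. f q * g q) p"
  unfolding analytic_at_cp1_def o_def by (rule analytic_on_mult)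

lemma analytic_at_cp1_const: "analytic_at_cp1 (\<lambda>q. c) p"
  unfolding analytic_at_cp1_def o_def by simp

lemmas analytic_at_cp1_intros =
  analytic_at_cp1_add analytic_at_cp1_diff analytic_at_cp1_mult analytic_at_cp1_const

lemma vector_matrix_mult_2:
  "((y::complex^2) v* M) $ j = M $ 1 $ j * y $ 1 + M $ 2 $ j * y $ 2"
  by (simp add: vector_matrix_mult_def sum_2)

lemma germ_family_matrix:
  assumes "germ_family \<gamma> F"
  shows "germ_family \<gamma> (\<lambda>s q. F s q v* M)"
  unfolding germ_family_def
proof (intro ballI conjI allI)
  fix s :: real assume s: "s \<in> {0..1}"
  show "analytic_at_cp1 (\<lambda>q. (F s q v* M) $ j) (\<gamma> s)" for j
    unfolding vector_matrix_mult_2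
    using assms s by (intro analytic_at_cp1_intros) (auto simp: germ_family_def)
  have "\<forall>\<^sub>F u in at s within {0..1}. \<forall>\<^sub>F q in nhds (\<gamma> u). F u q = F s q"
    using assms s by (simp add: germ_family_def)
  then show "\<forall>\<^sub>F u in at s within {0..1}. \<forall>\<^sub>F q in nhds (\<gamma> u). F u q v* M = F s q v* M"
    by (elim eventually_mono) auto
qed

text \<open>The difference of two continuations is a continuation, and vanishing of its components
  is permanent.\<close>

lemma germ_family_unique:
  assumes F: "germ_family \<gamma> F" and G: "germ_family \<gamma> G" and \<gamma>: "path \<gamma>"
    and 0: "\<forall>\<^sub>F q in nhds (\<gamma> 0). F 0 q = G 0 q"
  shows "\<forall>\<^sub>F q in nhds (\<gamma> 1). F 1 q = G 1 q"
proof -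
  let ?H = "\<lambda>s q. F s q - G s q"
  let ?P = "\<lambda>p (f :: cp1 \<Rightarrow> complex^2). \<forall>j. \<forall>\<^sub>F q in nhds p. f q $ j = 0"
  have H: "germ_family \<gamma> ?H"
    unfolding germ_family_def
  proof (intro ballI conjI allI)
    fix s :: real assume s: "s \<in> {0..1}"
    show "analytic_at_cp1 (\<lambda>q. ?H s q $ j) (\<gamma> s)" for j
      using F G s by (auto simp: germ_family_def intro: analytic_at_cp1_diff)
    have "\<forall>\<^sub>F u in at s within {0..1}. \<forall>\<^sub>F q in nhds (\<gamma> u). F u q = F s q"
      "\<forall>\<^sub>F u in at s within {0..1}. \<forall>\<^sub>F q in nhds (\<gamma> u). G u q = G s q"
      using F G s by (auto simp: germ_family_def)
    then show "\<forall>\<^sub>F u in at s within {0..1}. \<forall>\<^sub>F q in nhds (\<gamma> u). ?H u q = ?H s q"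
    proof eventually_elim
      case (elim u) then show ?case by eventually_elim simp
    qed
  qed
  have "?P (\<gamma> 0) (?H 0) = ?P (\<gamma> 1) (?H 1)"
  proof (rule germ_family_invariant[OF H \<gamma>])
    fix s :: real and f :: "cp1 \<Rightarrow> complex^2"
    assume "\<And>j. analytic_at_cp1 (\<lambda>q. f q $ j) (\<gamma> s)"
    then have "\<forall>\<^sub>F q in nhds (\<gamma> s). \<forall>j. (\<forall>\<^sub>F r in nhds q. f r $ j = 0) = (\<forall>\<^sub>F r in nhds (\<gamma> s). f r $ j = 0)"
      by (intro eventually_all_finite eventually_vanishing_iff)
    then show "\<forall>\<^sub>F q in nhds (\<gamma> s). ?P q f = ?P (\<gamma> s) f"
      by eventually_elim auto
  next
    fix p and f g :: "cp1 \<Rightarrow> complex^2"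
    assume *: "\<forall>\<^sub>F q in nhds p. f q = g q"
    have "(\<forall>\<^sub>F q in nhds p. f q $ j = 0) = (\<forall>\<^sub>F q in nhds p. g q $ j = 0)" for j
      using * by (intro eventually_cong) (auto elim!: eventually_mono)
    then show "?P p f = ?P p g" by simp
  qed
  moreover have "?P (\<gamma> 0) (?H 0)"
    using 0 by (auto elim!: eventually_mono)
  ultimately have "?P (\<gamma> 1) (?H 1)" by simp
  then have "\<forall>\<^sub>F q in nhds (\<gamma> 1). \<forall>j. ?H 1 q $ j = 0"
    by (intro eventually_all_finite) simp
  then show ?thesis by eventually_elim (simp add: vec_eq_iff)
qed

section \<open>Growth of solutions of linear systems\<close>

text \<open>\<open>|X|^2 exp (2 \<Phi>)\<close> is nondecreasing, since the inner product of
  \<open>X\<close> and \<open>X'\<close> is at least \<open>- k |X|^2\<close>; the squared norm is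
  differentiable also where \<open>X\<close> vanishes. The estimate runs backwards because the
  singular point lies beyond the lower end.\<close>

lemma gronwall_backward:
  fixes X :: "real \<Rightarrow> 'a::real_inner"
  assumes "\<tau> \<le> r"
    and X: "\<And>s. \<tau> \<le> s \<Longrightarrow> s \<le> r \<Longrightarrow> (X has_vector_derivative X' s) (at s)"
    and le: "\<And>s. \<tau> \<le> s \<Longrightarrow> s \<le> r \<Longrightarrow> norm (X' s) \<le> k s * norm (X s)"
    and \<Phi>: "\<And>s. \<tau> \<le> s \<Longrightarrow> s \<le> r \<Longrightarrow> (\<Phi> has_real_derivative k s) (at s)"
  shows "norm (X \<tau>) \<le> exp (\<Phi> r - \<Phi> \<tau>) * norm (X r)"
proof -
  let ?g = "\<lambda>s. (X s \<bullet> X s) * exp (2 * \<Phi> s)"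
  have "?g \<tau> \<le> ?g r"
  proof (rule DERIV_nonneg_imp_nondecreasing[OF \<open>\<tau> \<le> r\<close>])
    fix s assume s: "\<tau> \<le> s" "s \<le> r"
    have "((\<lambda>s. X s \<bullet> X s) has_vector_derivative (X s \<bullet> X' s + X' s \<bullet> X s)) (at s)"
      by (rule bounded_bilinear.has_vector_derivative[OF bounded_bilinear_inner X[OF s] X[OF s]])
    then have "((\<lambda>s. X s \<bullet> X s) has_real_derivative 2 * (X s \<bullet> X' s)) (at s)"
      by (simp add: has_real_derivative_iff_has_vector_derivative inner_commute)
    then have "(?g has_real_derivative
        2 * (X s \<bullet> X' s) * exp (2 * \<Phi> s) + exp (2 * \<Phi> s) * (2 * k s) * (X s \<bullet> X s)) (at s)"
      by (rule DERIV_mult) (auto intro!: derivative_eq_intros \<Phi>[OF s])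
    moreover have "- (X s \<bullet> X' s) \<le> k s * (X s \<bullet> X s)"
    proof -
      have "- (X s \<bullet> X' s) \<le> norm (X s) * norm (X' s)"
        using Cauchy_Schwarz_ineq2[of "X s" "X' s"] by linarith
      also have "\<dots> \<le> norm (X s) * (k s * norm (X s))"
        by (intro mult_left_mono le s) auto
      finally show ?thesis by (simp add: dot_square_norm power2_eq_square mult_ac)
    qed
    then have "0 \<le> 2 * exp (2 * \<Phi> s) * ((X s \<bullet> X' s) + k s * (X s \<bullet> X s))"
      by (intro mult_nonneg_nonneg) auto
    then have "0 \<le> 2 * (X s \<bullet> X' s) * exp (2 * \<Phi> s) + exp (2 * \<Phi> s) * (2 * k s) * (X s \<bullet> X s)"
      by (simp add: algebra_simps)
    ultimately show "\<exists>y. (?g has_real_derivative y) (at s) \<and> 0 \<le> y" by blast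
  qed
  then have "(norm (X \<tau>) * exp (\<Phi> \<tau>))\<^sup>2 \<le> (norm (X r) * exp (\<Phi> r))\<^sup>2"
    by (simp add: dot_square_norm power_mult_distrib exp_double)
  then have "norm (X \<tau>) * exp (\<Phi> \<tau>) \<le> norm (X r) * exp (\<Phi> r)"
    by (rule power2_le_imp_le) simp
  then show ?thesis by (simp add: exp_diff field_simps)
qed

text \<open>Gronwall is applied inwards along each ray; compactness of the circle of radius
  \<open>r\<close> makes the initial bound \<open>M\<close> uniform in the direction.\<close>

lemma radial_growth_bound:
  fixes f1 f2 f3 d1 d2 d3 :: "complex \<Rightarrow> complex"
  assumes "r > 0"
    and f1: "\<And>t. t \<noteq> 0 \<Longrightarrow> norm t \<le> r \<Longrightarrow> (f1 has_field_derivative d1 t) (at t)"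
    and f2: "\<And>t. t \<noteq> 0 \<Longrightarrow> norm t \<le> r \<Longrightarrow> (f2 has_field_derivative d2 t) (at t)"
    and f3: "\<And>t. t \<noteq> 0 \<Longrightarrow> norm t \<le> r \<Longrightarrow> (f3 has_field_derivative d3 t) (at t)"
    and le: "\<And>t. t \<noteq> 0 \<Longrightarrow> norm t \<le> r \<Longrightarrow>
       norm (d1 t) + norm (d2 t) + norm (d3 t) \<le> k (norm t) * norm (f1 t, f2 t, f3 t)"
    and \<Phi>: "\<And>s. 0 < s \<Longrightarrow> s \<le> r \<Longrightarrow> (\<Phi> has_real_derivative k s) (at s)"
  obtains M where "\<And>t. t \<noteq> 0 \<Longrightarrow> norm t \<le> r \<Longrightarrow> norm (f1 t) \<le> M * exp (\<Phi> r - \<Phi> (norm t))"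
proof -
  let ?X = "\<lambda>t. (f1 t, f2 t, f3 t)"
  have "continuous_on (sphere 0 r) ?X"
  proof (intro continuous_on_Pair continuous_at_imp_continuous_on ballI)
    fix t :: complex assume "t \<in> sphere 0 r"
    then have "t \<noteq> 0" "norm t \<le> r" using \<open>r > 0\<close> by auto
    then show "isCont f1 t" "isCont f2 t" "isCont f3 t"
      using f1 f2 f3 DERIV_isCont by blast+
  qed
  then have "bounded (?X ` sphere 0 r)"
    by (intro compact_imp_bounded compact_continuous_image) auto
  then obtain M where M: "\<And>t. t \<in> sphere 0 r \<Longrightarrow> norm (?X t) \<le> M"
    unfolding bounded_iff by blast
  show ?thesis
  proof (rule that[of M])
    fix t :: complex assume t: "t \<noteq> 0" "norm t \<le> r"
    define w where "w = sgn t"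
    have w: "norm w = 1" "of_real (norm t) * w = t"
      using t unfolding w_def by (simp add: norm_sgn, simp add: sgn_eq)
    have "norm (?X (of_real (norm t) * w)) \<le> exp (\<Phi> r - \<Phi> (norm t)) * norm (?X (of_real r * w))"
    proof (rule gronwall_backward[where k = k and X' = "\<lambda>s. (w * d1 (of_real s * w), w * d2 (of_real s * w), w * d3 (of_real s * w))"])
      fix s assume s: "norm t \<le> s" "s \<le> r"
      then have s0: "s > 0" using t by (meson zero_less_norm_iff less_le_trans)
      let ?u = "of_real s * w"
      have u: "norm ?u = s" "?u \<noteq> 0" using s0 w by (auto simp: norm_mult)
      have chain: "((\<lambda>s. f (of_real s * w)) has_vector_derivative w * d ?u) (at s)"
        if "(f has_field_derivative d ?u) (at ?u)" for f d
      proof -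
        have "((\<lambda>s. of_real s * w) has_vector_derivative w) (at s)"
          by (auto intro!: derivative_eq_intros)
        from field_vector_diff_chain_at[OF this that] show ?thesis by (simp add: o_def)
      qed
      show "((\<lambda>s. ?X (of_real s * w)) has_vector_derivative
         (w * d1 ?u, w * d2 ?u, w * d3 ?u)) (at s)"
        using f1 f2 f3 u s by (intro has_vector_derivative_Pair chain) auto
      have "norm (w * d1 ?u, w * d2 ?u, w * d3 ?u) \<le> norm (d1 ?u) + (norm (d2 ?u) + norm (d3 ?u))"
        by (rule order_trans[OF norm_Pair_le] add_mono order_trans[OF _ add_left_mono])+
          (auto simp: norm_mult w intro: order_trans[OF norm_Pair_le])
      also have "\<dots> \<le> k s * norm (?X ?u)"
        using le[of ?u] u s by simp
      finally show "norm (w * d1 ?u, w * d2 ?u, w * d3 ?u) \<le> k s * norm (?X ?u)" .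
      show "(\<Phi> has_real_derivative k s) (at s)" by (rule \<Phi>) (use s s0 in auto)
    qed (use t in auto)
    also have "\<dots> \<le> exp (\<Phi> r - \<Phi> (norm t)) * M"
      using w \<open>r > 0\<close> by (intro mult_left_mono M) (auto simp: norm_mult)
    finally have "norm (?X t) \<le> M * exp (\<Phi> r - \<Phi> (norm t))" unfolding w(2) by (simp add: mult.commute)
    moreover have "norm (f1 t) \<le> norm (?X t)" by (metis norm_fst_le fst_conv)
    ultimately show "norm (f1 t) \<le> M * exp (\<Phi> r - \<Phi> (norm t))" by linarith
  qed
qed

lemma pole_order_bound:
  assumes "pole_order_at_most k f"
  obtains e M where "e > 0" "M \<ge> 0" "\<And>t. t \<noteq> 0 \<Longrightarrow> norm t < e \<Longrightarrow> norm (f t) * norm t ^ k \<le> M"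
proof -
  obtain g where g: "g analytic_on {0}" and ev: "\<forall>\<^sub>F t in at 0. f t = g t / t ^ k"
    using assms unfolding pole_order_at_most_def by blast
  have "isCont g 0" using g by (simp add: analytic_at_imp_isCont)
  then have "\<forall>\<^sub>F t in at 0. dist (g t) (g 0) < 1"
    unfolding isCont_def using tendstoD[of g "g 0" "at 0" 1] by simp
  with ev have "\<forall>\<^sub>F t in at 0. norm (f t) * norm t ^ k \<le> norm (g 0) + 1"
  proof (eventually_elim)
    case (elim t)
    have "norm (f t) * norm t ^ k \<le> norm (g t)"
      using elim by (cases "t = 0") (auto simp: norm_divide norm_power power_0_left)
    moreover have "norm (g t) \<le> norm (g 0) + 1"
      using elim(2) norm_triangle_sub[of "g t" "g 0"] by (simp add: dist_norm)
    ultimately show ?case by linarith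
  qed
  then obtain e where "e > 0" "\<And>t. t \<noteq> 0 \<Longrightarrow> norm t < e \<Longrightarrow> norm (f t) * norm t ^ k \<le> norm (g 0) + 1"
    unfolding eventually_at by auto
  then show ?thesis using that[of e "norm (g 0) + 1"] by auto
qed

section \<open>The symmetric square of a second order equation\<close>

text \<open>For solutions \<open>f, g\<close> with Wronskian \<open>w = f g' - g f'\<close>, the functions \<open>A = f g / w\<close>,
  \<open>B = (f g)' / w\<close> and \<open>C = f' g' / w\<close> satisfy this system.\<close>

definition symmetric_square_system ::
  "complex set \<Rightarrow> (complex \<Rightarrow> complex) \<Rightarrow> (complex \<Rightarrow> complex) \<Rightarrow>
   (complex \<Rightarrow> complex) \<Rightarrow> (complex \<Rightarrow> complex) \<Rightarrow> (complex \<Rightarrow> complex) \<Rightarrow> bool" where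
  "symmetric_square_system S p q A B C \<longleftrightarrow> (\<forall>t\<in>S.
     (A has_field_derivative B t + p t * A t) (at t) \<and>
     (B has_field_derivative 2 * C t - 2 * q t * A t) (at t) \<and>
     (C has_field_derivative - p t * C t - q t * B t) (at t))"

lemma norm_triple_ge:
  fixes a b c :: complex
  shows "norm a \<le> norm (a, b, c)" "norm b \<le> norm (a, b, c)" "norm c \<le> norm (a, b, c)"
proof -
  show "norm a \<le> norm (a, b, c)" by (metis norm_fst_le fst_conv)
  have "norm (b, c) \<le> norm (a, b, c)" by (metis norm_snd_le snd_conv)
  then show "norm b \<le> norm (a, b, c)" "norm c \<le> norm (a, b, c)"
    by (meson order_trans norm_fst_le norm_snd_le fst_conv snd_conv | metis order_trans norm_fst_le norm_snd_le fst_conv snd_conv)+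
qed

text \<open>Bounded coefficients give a constant Gronwall rate. This serves infinity as an ordinary
  point, which the coordinate \<open>z\<close> does not reach.\<close>

lemma symmetric_square_bounded:
  assumes sys: "symmetric_square_system (ball 0 R - {0}) p q A B C" and "R > 0"
    and p: "pole_order_at_most 0 p" and q: "pole_order_at_most 0 q"
  obtains e M where "e > 0" "\<And>t. t \<noteq> 0 \<Longrightarrow> norm t \<le> e \<Longrightarrow> norm (A t) \<le> M"
proof -
  obtain e1 P where P: "e1 > 0" "P \<ge> 0" "\<And>t. t \<noteq> 0 \<Longrightarrow> norm t < e1 \<Longrightarrow> norm (p t) \<le> P"
    using pole_order_bound[OF p] by auto
  obtain e2 Q where Q: "e2 > 0" "Q \<ge> 0" "\<And>t. t \<noteq> 0 \<Longrightarrow> norm t < e2 \<Longrightarrow> norm (q t) \<le> Q"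
    using pole_order_bound[OF q] by auto
  define r where "r = min (R / 2) (min (e1 / 2) (e2 / 2))"
  have r: "r > 0" "r < R" "r < e1" "r < e2"
    using \<open>R > 0\<close> P(1) Q(1) unfolding r_def by auto
  \<comment> \<open>The bounds for the three derivatives are \<open>1 + P\<close>,
    \<open>2 + 2 * Q\<close> and \<open>P + Q\<close> times the norm.\<close>
  define k where "k = 3 + 2 * P + 3 * Q"
  obtain M where M: "\<And>t. t \<noteq> 0 \<Longrightarrow> norm t \<le> r \<Longrightarrow> norm (A t) \<le> M * exp (k * r - k * norm t)"
  proof (rule radial_growth_bound[where k = "\<lambda>_. k" and \<Phi> = "\<lambda>s. k * s" and r = r])
    fix t :: complex assume t: "t \<noteq> 0" "norm t \<le> r"
    then have "t \<in> ball 0 R - {0}" using r by auto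
    then show "(A has_field_derivative B t + p t * A t) (at t)"
      "(B has_field_derivative 2 * C t - 2 * q t * A t) (at t)"
      "(C has_field_derivative - p t * C t - q t * B t) (at t)"
      using sys unfolding symmetric_square_system_def by blast+
    let ?N = "norm (A t, B t, C t)"
    note N = norm_triple_ge[where a = "A t" and b = "B t" and c = "C t"]
    have pq: "norm (p t) \<le> P" "norm (q t) \<le> Q" using P(3) Q(3) t r by auto
    have "norm (p t * A t) \<le> P * ?N" "norm (q t * A t) \<le> Q * ?N"
      "norm (p t * C t) \<le> P * ?N" "norm (q t * B t) \<le> Q * ?N"
      unfolding norm_mult by (intro mult_mono[OF pq(1) N(1)] mult_mono[OF pq(2) N(1)]
          mult_mono[OF pq(1) N(3)] mult_mono[OF pq(2) N(2)]; use P Q in simp)+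
    moreover have "norm (B t + p t * A t) \<le> norm (B t) + norm (p t * A t)"
      by (rule norm_triangle_ineq)
    moreover have "norm (2 * C t - 2 * q t * A t) \<le> 2 * norm (C t) + 2 * norm (q t * A t)"
      using norm_triangle_ineq4[of "2 * C t" "2 * q t * A t"] by (simp add: norm_mult)
    moreover have "norm (- p t * C t - q t * B t) \<le> norm (p t * C t) + norm (q t * B t)"
      using norm_triangle_ineq4[of "- p t * C t" "q t * B t"] by simp
    ultimately show "norm (B t + p t * A t) + norm (2 * C t - 2 * q t * A t) + norm (- p t * C t - q t * B t)
        \<le> k * ?N"
      using N by (simp add: k_def algebra_simps)
  next
    show "((*) k has_real_derivative k) (at s)" for s
      by (auto intro!: derivative_eq_intros)
  qed (use r in auto)
  have M0: "M \<ge> 0"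
  proof -
    have "0 \<le> M * exp (k * r - k * r)"
      using M[of "of_real r"] r(1) norm_ge_zero[of "A (of_real r)"] by (simp del: norm_ge_zero)
    then show ?thesis by simp
  qed
  show ?thesis
  proof (rule that[of r "M * exp (k * r)"])
    fix t :: complex assume t: "t \<noteq> 0" "norm t \<le> r"
    have "k \<ge> 0" using P(2) Q(2) by (simp add: k_def)
    then have "M * exp (k * r - k * norm t) \<le> M * exp (k * r)"
      using M0 by (intro mult_left_mono) auto
    then show "norm (A t) \<le> M * exp (k * r)" using M[OF t] by linarith
  qed (use r in auto)
qed

text \<open>The weights in \<open>A\<close>, \<open>t B\<close>, \<open>t^2 C\<close> turn the
  Fuchsian system into \<open>t X' = M X\<close> with bounded \<open>M\<close>. The rate is
  therefore \<open>n / s\<close> with primitive \<open>n ln s\<close>, and the growth is at most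
  that of \<open>|t|\<close> to the power \<open>- n\<close>.\<close>

lemma symmetric_square_moderate:
  assumes sys: "symmetric_square_system (ball 0 R - {0}) p q A B C" and "R > 0"
    and p: "pole_order_at_most 1 p" and q: "pole_order_at_most 2 q"
  obtains e M n where "e > 0" "\<And>t. t \<noteq> 0 \<Longrightarrow> norm t \<le> e \<Longrightarrow> norm (t ^ n * A t) \<le> M"
proof -
  obtain e1 P where P: "e1 > 0" "P \<ge> 0" "\<And>t. t \<noteq> 0 \<Longrightarrow> norm t < e1 \<Longrightarrow> norm (p t) * norm t \<le> P"
    using pole_order_bound[OF p] by auto
  obtain e2 Q where Q: "e2 > 0" "Q \<ge> 0" "\<And>t. t \<noteq> 0 \<Longrightarrow> norm t < e2 \<Longrightarrow> norm (q t) * (norm t)\<^sup>2 \<le> Q"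
    using pole_order_bound[OF q] by blast
  define r where "r = min (R / 2) (min (e1 / 2) (e2 / 2))"
  have r: "r > 0" "r < R" "r < e1" "r < e2"
    using \<open>R > 0\<close> P(1) Q(1) unfolding r_def by auto
  \<comment> \<open>The derivatives of the weighted functions, multiplied by \<open>t\<close>,
    contribute \<open>1 + P\<close>, \<open>3 + 2 * Q\<close> and \<open>2 + P + Q\<close>; a
    natural number \<open>n\<close> makes the bound an integral power.\<close>
  obtain n :: nat where n: "6 + 2 * P + 3 * Q \<le> real n"
    using real_arch_simple by blast
  obtain M where M: "\<And>t. t \<noteq> 0 \<Longrightarrow> norm t \<le> r \<Longrightarrow> norm (A t) \<le> M * exp (n * ln r - n * ln (norm t))"
  proof (rule radial_growth_bound[where k = "\<lambda>s. n / s" and \<Phi> = "\<lambda>s. n * ln s" and r = r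
        and ?f1.0 = A and ?f2.0 = "\<lambda>t. t * B t" and ?f3.0 = "\<lambda>t. t\<^sup>2 * C t"])
    fix t :: complex assume t: "t \<noteq> 0" "norm t \<le> r"
    then have "t \<in> ball 0 R - {0}" using r by auto
    then have A: "(A has_field_derivative B t + p t * A t) (at t)"
      and B: "(B has_field_derivative 2 * C t - 2 * q t * A t) (at t)"
      and C: "(C has_field_derivative - p t * C t - q t * B t) (at t)"
      using sys unfolding symmetric_square_system_def by blast+
    show "(A has_field_derivative B t + p t * A t) (at t)" by (rule A)
    show "((\<lambda>t. t * B t) has_field_derivative B t + t * (2 * C t - 2 * q t * A t)) (at t)"
      by (rule derivative_eq_intros refl B)+ simp
    show "((\<lambda>t. t\<^sup>2 * C t) has_field_derivative 2 * t * C t + t\<^sup>2 * (- p t * C t - q t * B t)) (at t)"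
      by (rule derivative_eq_intros refl C)+ (simp add: algebra_simps)
    let ?b = "t * B t" and ?c = "t\<^sup>2 * C t"
    let ?N = "norm (A t, ?b, ?c)"
    note N = norm_triple_ge[where a = "A t" and b = ?b and c = ?c]
    have pq: "norm (t * p t) \<le> P" "norm (t\<^sup>2 * q t) \<le> Q"
      using P(3)[of t] Q(3)[of t] t r by (auto simp: norm_mult norm_power mult.commute)
    have 1: "norm (t * p t * A t) \<le> P * ?N" "norm (t\<^sup>2 * q t * A t) \<le> Q * ?N"
      "norm (t * p t * ?c) \<le> P * ?N" "norm (t\<^sup>2 * q t * ?b) \<le> Q * ?N"
      unfolding norm_mult[of _ "A t"] norm_mult[of _ ?c] norm_mult[of _ ?b]
      by (intro mult_mono[OF pq(1) N(1)] mult_mono[OF pq(2) N(1)]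
          mult_mono[OF pq(1) N(3)] mult_mono[OF pq(2) N(2)]; use P Q in simp)+
    have "norm (?b + t * p t * A t) \<le> norm ?b + norm (t * p t * A t)"
      by (rule norm_triangle_ineq)
    moreover have "norm (?b + (2 * ?c - 2 * (t\<^sup>2 * q t * A t))) \<le> norm ?b + (2 * norm ?c + 2 * norm (t\<^sup>2 * q t * A t))"
      using norm_triangle_ineq[of ?b "2 * ?c - 2 * (t\<^sup>2 * q t * A t)"]
        norm_triangle_ineq4[of "2 * ?c" "2 * (t\<^sup>2 * q t * A t)"]
      unfolding norm_mult[of 2] by simp
    moreover have "norm (2 * ?c - (t * p t * ?c + t\<^sup>2 * q t * ?b)) \<le> 2 * norm ?c + (norm (t * p t * ?c) + norm (t\<^sup>2 * q t * ?b))"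
      using norm_triangle_ineq4[of "2 * ?c" "t * p t * ?c + t\<^sup>2 * q t * ?b"]
        norm_triangle_ineq[of "t * p t * ?c" "t\<^sup>2 * q t * ?b"]
      unfolding norm_mult[of 2] by simp
    ultimately have "norm (?b + t * p t * A t) + norm (?b + (2 * ?c - 2 * (t\<^sup>2 * q t * A t)))
        + norm (2 * ?c - (t * p t * ?c + t\<^sup>2 * q t * ?b)) \<le> (6 + 2 * P + 3 * Q) * ?N"
      using N 1 unfolding distrib_right by linarith
    also have "\<dots> \<le> n * ?N" by (intro mult_right_mono n) simp
    also have "?b + t * p t * A t = t * (B t + p t * A t)" by (simp add: algebra_simps)
    also have "?b + (2 * ?c - 2 * (t\<^sup>2 * q t * A t)) = t * (B t + t * (2 * C t - 2 * q t * A t))"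
      by (simp add: algebra_simps power2_eq_square)
    also have "2 * ?c - (t * p t * ?c + t\<^sup>2 * q t * ?b) = t * (2 * t * C t + t\<^sup>2 * (- p t * C t - q t * B t))"
      by (simp add: algebra_simps power2_eq_square)
    finally show "norm (B t + p t * A t) + norm (B t + t * (2 * C t - 2 * q t * A t))
        + norm (2 * t * C t + t\<^sup>2 * (- p t * C t - q t * B t)) \<le> n / norm t * ?N"
      using t unfolding norm_mult[of t] by (simp add: field_simps)
  next
    show "((\<lambda>s. n * ln s) has_real_derivative n / s) (at s)" if "0 < s" for s
      using that by (auto intro!: derivative_eq_intros simp: divide_inverse)
  qed (use r in auto)
  show ?thesis
  proof (rule that[of r n "M * r ^ n"])
    fix t :: complex assume t: "t \<noteq> 0" "norm t \<le> r"
    have "exp (n * ln r - n * ln (norm t)) = (r / norm t) ^ n"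
      using t r by (simp add: exp_diff exp_of_nat_mult power_divide)
    then have "norm (A t) \<le> M * (r / norm t) ^ n" using M[OF t] by simp
    then have "norm t ^ n * norm (A t) \<le> norm t ^ n * (M * (r / norm t) ^ n)"
      by (intro mult_left_mono) auto
    also have "\<dots> = M * r ^ n" using t by (simp add: power_divide)
    finally show "norm (t ^ n * A t) \<le> M * r ^ n" by (simp add: norm_mult norm_power)
  qed (use r in auto)
qed

text \<open>Zeros of \<open>g\<close> at the origin are divided out one by one. If
  \<open>g 0\<close> becomes nonzero, \<open>t ^ n / g t\<close> is a holomorphic reciprocal,
  whether \<open>A\<close> has a pole or a finite nonzero limit; if \<open>n\<close> reaches 0 while
  \<open>g 0 = 0\<close>, then \<open>A\<close> tends to 0.\<close>

lemma meromorphic_zero_or_inverse_holomorphic: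
  assumes "R > 0" "g holomorphic_on ball 0 R"
    and "\<And>t. t \<in> ball 0 R - {0} \<Longrightarrow> A t = g t / t ^ n"
  shows "(A \<longlongrightarrow> 0) (at 0) \<or>
    (\<exists>e>0. \<exists>k. e \<le> R \<and> k holomorphic_on ball 0 e \<and> (\<forall>t\<in>ball 0 e - {0}. A t \<noteq> 0 \<and> k t = 1 / A t))"
    (is "?zero \<or> ?inv")
  using assms(2,3)
proof (induction n arbitrary: g)
  have cont: "isCont g 0" if "g holomorphic_on ball 0 R" for g
    using that \<open>R > 0\<close> by (metis centre_in_ball continuous_on_interior holomorphic_on_imp_continuous_on interior_ball)
  have nonzero: ?inv
    if g: "g holomorphic_on ball 0 R" "\<And>t. t \<in> ball 0 R - {0} \<Longrightarrow> A t = g t / t ^ n" "g 0 \<noteq> 0" for g n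
  proof -
    obtain d where d: "d > 0" "\<And>t. dist 0 t < d \<Longrightarrow> g t \<noteq> 0"
      using continuous_at_avoid[OF cont[OF g(1)] g(3)] by blast
    define e where "e = min d R"
    have "(\<lambda>t. t ^ n / g t) holomorphic_on ball 0 e"
      using d g(1) unfolding e_def by (intro holomorphic_intros) (auto intro: holomorphic_on_subset)
    moreover have "A t \<noteq> 0 \<and> t ^ n / g t = 1 / A t" if "t \<in> ball 0 e - {0}" for t
      using that d(2)[of t] g(2)[of t] unfolding e_def by auto
    ultimately show ?thesis
      using d(1) \<open>R > 0\<close>
      by (intro exI[of _ e] exI[of _ "\<lambda>t. t ^ n / g t"] conjI ballI) (auto simp: e_def)
  qed
  {
    case (0 g)
    show ?case
    proof (cases "g 0 = 0")
      case True
      then have "(g \<longlongrightarrow> 0) (at 0)" using cont[OF 0(1)] by (simp add: isCont_def)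
      moreover have "\<forall>\<^sub>F t in at 0. g t = A t"
        using \<open>R > 0\<close> 0(2) by (auto simp: eventually_at intro!: exI[of _ R])
      ultimately show ?thesis using tendsto_cong by blast
    qed (use nonzero[OF 0] in blast)
  next
    case (Suc n g)
    show ?case
    proof (cases "g 0 = 0")
      case True
      let ?g = "\<lambda>z. if z = 0 then deriv g 0 else (g z - g 0) / (z - 0)"
      show ?thesis
      proof (rule Suc.IH)
        show "?g holomorphic_on ball 0 R"
          using \<open>R > 0\<close> by (intro pole_lemma Suc.prems(1)) simp
        show "A t = ?g t / t ^ n" if "t \<in> ball 0 R - {0}" for t
          using Suc.prems(2)[OF that] that True by (simp add: field_simps)
      qed
    qed (use nonzero[OF Suc.prems] in blast)
  }
qed

text \<open>Riemann's theorem removes the singularity of \<open>t ^ n * A t\<close>.\<close>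

lemma moderate_growth_zero_or_inverse_holomorphic:
  assumes "R > 0" "A holomorphic_on ball 0 R - {0}"
    and "\<And>t. t \<noteq> 0 \<Longrightarrow> norm t \<le> e \<Longrightarrow> norm (t ^ n * A t) \<le> M" "e > 0"
  shows "(A \<longlongrightarrow> 0) (at 0) \<or>
    (\<exists>e>0. \<exists>k. e \<le> R \<and> k holomorphic_on ball 0 e \<and> (\<forall>t\<in>ball 0 e - {0}. A t \<noteq> 0 \<and> k t = 1 / A t))"
proof -
  have "\<exists>g. g holomorphic_on ball 0 R \<and> (\<forall>z\<in>ball 0 R - {0}. g z = z ^ n * A z)"
  proof (subst holomorphic_on_extend_bounded)
    show "\<exists>B. \<forall>\<^sub>F t in at 0. norm (t ^ n * A t) \<le> B"
      using assms(3,4) by (intro exI[of _ M]) (auto simp: eventually_at intro!: exI[of _ e])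
  qed (use assms in \<open>auto intro!: holomorphic_intros\<close>)
  then obtain g where "g holomorphic_on ball 0 R" "\<And>z. z \<in> ball 0 R - {0} \<Longrightarrow> g z = z ^ n * A z"
    by blast
  then show ?thesis
    by (intro meromorphic_zero_or_inverse_holomorphic[of R g A n]) (use assms in auto)
qed

section \<open>Vector fields on the sphere\<close>

text \<open>The coefficient of the vector field \<open>A d/dz\<close> with respect to the coordinate at a point.\<close>

fun field_in_chart :: "(complex \<Rightarrow> complex) \<Rightarrow> cp1 \<Rightarrow> complex \<Rightarrow> complex" where
  "field_in_chart A (Fin c) t = A (c + t)"
| "field_in_chart A Infty t = - t\<^sup>2 * A (1 / t)"

lemma symmetric_square_system_chart:
  assumes "symmetric_square_system {z. Fin z \<notin> D} b1 b2 A B C"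
  shows "\<exists>B' C'. symmetric_square_system {t. t \<noteq> 0 \<and> chart p t \<notin> D}
           (coeff1 b1 p) (coeff2 b2 p) (field_in_chart A p) B' C'"
proof (cases p)
  case (Fin c)
  have shift: "((\<lambda>t. f (c + t)) has_field_derivative d) (at t)"
    if "(f has_field_derivative d) (at (c + t))" for f d t
  proof -
    have "((\<lambda>t. c + t) has_field_derivative 1) (at t)" by (auto intro!: derivative_eq_intros)
    from DERIV_chain2[OF that this] show ?thesis by simp
  qed
  have "field_in_chart A p = (\<lambda>t. A (c + t))" using Fin by (simp add: fun_eq_iff)
  moreover have "symmetric_square_system {t. t \<noteq> 0 \<and> chart p t \<notin> D} (coeff1 b1 p) (coeff2 b2 p)
     (\<lambda>t. A (c + t)) (\<lambda>t. B (c + t)) (\<lambda>t. C (c + t))"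
    using assms Fin by (auto simp: symmetric_square_system_def intro!: shift)
  ultimately show ?thesis by auto
next
  case Infty
  \<comment> \<open>Under \<open>t = 1 / z\<close> first derivatives and the Wronskian are
    multiplied by \<open>- 1 / t\<^sup>2\<close>, so \<open>A\<close>, \<open>B\<close>,
    \<open>C\<close> acquire the factors \<open>- t\<^sup>2\<close>, 1 and
    \<open>- 1 / t\<^sup>2\<close>.\<close>
  have "symmetric_square_system {t. t \<noteq> 0 \<and> chart p t \<notin> D} (coeff1 b1 p) (coeff2 b2 p)
     (\<lambda>t. - t\<^sup>2 * A (1 / t)) (\<lambda>t. B (1 / t)) (\<lambda>t. - C (1 / t) / t\<^sup>2)"
    unfolding symmetric_square_system_def
  proof (intro ballI conjI)
    fix t assume "t \<in> {t. t \<noteq> 0 \<and> chart p t \<notin> D}"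
    then have t: "t \<noteq> 0" "Fin (1 / t) \<notin> D" using Infty by auto
    have chain: "((\<lambda>t. f (1 / t)) has_field_derivative - d / t\<^sup>2) (at t)"
      if "(f has_field_derivative d) (at (1 / t))" for f d
    proof -
      have "((\<lambda>t. 1 / t) has_field_derivative - 1 / t\<^sup>2) (at t)"
        using t by (auto intro!: derivative_eq_intros simp: power2_eq_square)
      from DERIV_chain2[OF that this] show ?thesis by simp
    qed
    have A: "((\<lambda>t. A (1 / t)) has_field_derivative - (B (1 / t) + b1 (1 / t) * A (1 / t)) / t\<^sup>2) (at t)"
      and B: "((\<lambda>t. B (1 / t)) has_field_derivative - (2 * C (1 / t) - 2 * b2 (1 / t) * A (1 / t)) / t\<^sup>2) (at t)"
      and C: "((\<lambda>t. C (1 / t)) has_field_derivative - (- b1 (1 / t) * C (1 / t) - b2 (1 / t) * B (1 / t)) / t\<^sup>2) (at t)"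
      using assms t unfolding symmetric_square_system_def by (blast intro: chain)+
    show "((\<lambda>t. - t\<^sup>2 * A (1 / t)) has_field_derivative
        B (1 / t) + coeff1 b1 p t * (- t\<^sup>2 * A (1 / t))) (at t)"
      using t Infty by (auto intro!: derivative_eq_intros A simp: field_simps power2_eq_square)
    show "((\<lambda>t. B (1 / t)) has_field_derivative
        2 * (- C (1 / t) / t\<^sup>2) - 2 * coeff2 b2 p t * (- t\<^sup>2 * A (1 / t))) (at t)"
      by (rule DERIV_cong[OF B]) (use t Infty in \<open>simp add: field_simps eval_nat_numeral\<close>)
    show "((\<lambda>t. - C (1 / t) / t\<^sup>2) has_field_derivative
        - coeff1 b1 p t * (- C (1 / t) / t\<^sup>2) - coeff2 b2 p t * B (1 / t)) (at t)"
      by (rule DERIV_cong[OF DERIV_divide[OF DERIV_minus[OF C] DERIV_power[OF DERIV_ident]]])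
        (use t Infty in \<open>simp_all add: field_simps eval_nat_numeral\<close>)
  qed
  moreover have "field_in_chart A p = (\<lambda>t. - t\<^sup>2 * A (1 / t))" using Infty by (simp add: fun_eq_iff)
  ultimately show ?thesis by auto
qed

lemma closed_finite_cp1: "finite D \<Longrightarrow> open (- D :: cp1 set)"
proof -
  assume "finite D"
  have "open (- {q})" for q :: cp1
  proof -
    have "Fin -` (- {q}) = (case q of Fin c \<Rightarrow> - {c} | Infty \<Rightarrow> UNIV)"
      by (cases q) auto
    moreover have "chart Infty -` (- {q}) = - {t. chart Infty t = q}" by auto
    moreover have "finite {t. chart Infty t = q}"
      using finite_vimageI[of "{q}" "chart Infty"] inj_chart by (simp add: vimage_def)
    ultimately show ?thesis
      unfolding open_cp1_def
      by (cases q) (auto intro: finite_imp_closed simp: open_Compl simp del: chart.simps)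
  qed
  then have "open (\<Inter>q\<in>D. - {q})" using \<open>finite D\<close> by (intro open_INT) auto
  moreover have "(\<Inter>q\<in>D. - {q}) = - D" by auto
  ultimately show ?thesis by simp
qed

lemma punctured_chart_ball:
  assumes "finite D"
  obtains R where "R > 0" "\<And>t. t \<in> ball 0 R - {0} \<Longrightarrow> chart p t \<notin> D"
proof -
  have "open (- (D - {p}))" using assms by (intro closed_finite_cp1) auto
  then have "open (chart p -` (- (D - {p})))" by (rule open_chart_vimage)
  moreover have "0 \<in> chart p -` (- (D - {p}))" by simp
  ultimately obtain R where R: "R > 0" "ball 0 R \<subseteq> chart p -` (- (D - {p}))"
    using open_contains_ball by meson
  show ?thesis
  proof (rule that[OF R(1)])
    fix t :: complex assume "t \<in> ball 0 R - {0}"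
    moreover from this have "chart p t \<noteq> p" using inj_chart[of p] by (auto dest: injD[of _ t 0])
    ultimately show "chart p t \<notin> D" using R(2) by auto
  qed
qed

lemma symmetric_square_system_imp_holomorphic:
  "symmetric_square_system S p q A B C \<Longrightarrow> A holomorphic_on S"
  unfolding symmetric_square_system_def holomorphic_on_def field_differentiable_def
  by (blast intro: has_field_derivative_at_within)

lemma symmetric_square_system_subset:
  "symmetric_square_system S p q A B C \<Longrightarrow> T \<subseteq> S \<Longrightarrow> symmetric_square_system T p q A B C"
  by (auto simp: symmetric_square_system_def)

text \<open>Dichotomy at a singular point. In the second case \<open>1 / A\<close> extends
  holomorphically over the whole disc, hence has no residue, and its primitive \<open>K\<close> is
  single valued; up to a constant \<open>K\<close> will be a logarithm of
  \<open>y2 / y1\<close>.\<close>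

lemma field_zero_or_primitive:
  assumes "finite D" "riemann_equation D b1 b2" "p \<in> D"
    and sys: "symmetric_square_system {z. Fin z \<notin> D} b1 b2 A B C"
  shows "(field_in_chart A p \<longlongrightarrow> 0) (at 0) \<or>
    (\<exists>e>0. \<exists>K. \<forall>t\<in>ball 0 e - {0}. chart p t \<notin> D \<and> field_in_chart A p t \<noteq> 0 \<and>
       (K has_field_derivative 1 / field_in_chart A p t) (at t))"
proof -
  obtain R where R: "R > 0" "\<And>t. t \<in> ball 0 R - {0} \<Longrightarrow> chart p t \<notin> D"
    using punctured_chart_ball[OF assms(1), of p] by blast
  obtain B' C' where sys': "symmetric_square_system (ball 0 R - {0})
      (coeff1 b1 p) (coeff2 b2 p) (field_in_chart A p) B' C'"
    using symmetric_square_system_chart[OF sys, of p] symmetric_square_system_subset R(2) by blast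
  have "pole_order_at_most 1 (coeff1 b1 p)" "pole_order_at_most 2 (coeff2 b2 p)"
    using assms(2,3) unfolding riemann_equation_def by blast+
  then obtain e M n where "e > 0" "\<And>t. t \<noteq> 0 \<Longrightarrow> norm t \<le> e \<Longrightarrow> norm (t ^ n * field_in_chart A p t) \<le> M"
    using symmetric_square_moderate[OF sys' R(1)] by metis
  from moderate_growth_zero_or_inverse_holomorphic[OF R(1)
      symmetric_square_system_imp_holomorphic[OF sys'] this(2,1)]
  consider "(field_in_chart A p \<longlongrightarrow> 0) (at 0)"
    | e k where "e > 0" "e \<le> R" "k holomorphic_on ball 0 e"
        "\<And>t. t \<in> ball 0 e - {0} \<Longrightarrow> field_in_chart A p t \<noteq> 0 \<and> k t = 1 / field_in_chart A p t"
    by blast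
  then show ?thesis
  proof cases
    case (2 e k)
    obtain K where K: "\<And>t. t \<in> ball 0 e \<Longrightarrow> (K has_field_derivative k t) (at t within ball 0 e)"
      using holomorphic_convex_primitive'[OF convex_ball open_ball 2(3)] by blast
    have "chart p t \<notin> D \<and> field_in_chart A p t \<noteq> 0 \<and>
       (K has_field_derivative 1 / field_in_chart A p t) (at t)" if t: "t \<in> ball 0 e - {0}" for t
    proof -
      have "(K has_field_derivative k t) (at t)"
        using K[of t] t by (metis DiffD1 at_within_open open_ball)
      then show ?thesis using R(2)[of t] 2(2) 2(4)[OF t] t by auto
    qed
    then show ?thesis using 2(1) by blast
  qed blast
qed

text \<open>A holomorphic vector field on the sphere is a polynomial of degree at most 2 times
  \<open>d/dz\<close>. Zeros at finite points are roots and a zero at infinity lowers the degree by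
  one, so three zeros are too many in either case.\<close>

lemma field_vanishing_at_three_points:
  assumes D: "finite D" "card D = 3" and riem: "riemann_equation D b1 b2"
    and sys: "symmetric_square_system {z. Fin z \<notin> D} b1 b2 A B C"
    and zero: "\<And>p. p \<in> D \<Longrightarrow> (field_in_chart A p \<longlongrightarrow> 0) (at 0)"
    and z: "Fin z \<notin> D"
  shows "A z = 0"
proof -
  define Z where "Z = Fin -` D"
  have finZ: "finite Z" unfolding Z_def using D by (intro finite_vimageI) (auto simp: inj_def)
  \<comment> \<open>\<open>A\<close> carries no information at the singular points; the value 0 is
    its limit there, which makes \<open>g\<close> continuous and hence entire.\<close>
  define g where "g = (\<lambda>z. if z \<in> Z then 0 else A z)"
  have holA: "A holomorphic_on - Z"
    using symmetric_square_system_imp_holomorphic[OF sys] unfolding Z_def by (simp add: vimage_def Compl_eq)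
  have hol1: "g holomorphic_on - Z"
    using holA by (rule holomorphic_transform) (simp add: g_def)
  have opn: "open (- Z)" using finZ by (simp add: finite_imp_closed open_Compl)
  have hol: "g holomorphic_on UNIV"
  proof (rule no_isolated_singularity[OF _ _ open_UNIV finZ])
    show "continuous_on UNIV g"
    proof (intro continuous_at_imp_continuous_on ballI)
      fix w :: complex
      show "isCont g w"
      proof (cases "w \<in> Z")
        case False
        then show ?thesis
          using hol1 opn by (metis ComplI continuous_on_eq_continuous_at holomorphic_on_imp_continuous_on)
      next
        case True
        have "field_in_chart A (Fin w) = (\<lambda>t. A (w + t))" by (simp add: fun_eq_iff)
        with True have "((\<lambda>t. A (w + t)) \<longlongrightarrow> 0) (at 0)"
          using zero[of "Fin w"] unfolding Z_def by simp
        then have "(A \<longlongrightarrow> 0) (at w)" by (simp add: LIM_offset_zero_iff)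
        then have "(g \<longlongrightarrow> 0) (at w)"
          by (rule Lim_null_comparison[rotated, OF tendsto_norm_zero]) (auto simp: g_def)
        then show ?thesis using True by (simp add: isCont_def g_def)
      qed
    qed
    show "g holomorphic_on UNIV - Z" using hol1 by (simp add: Compl_eq_Diff_UNIV)
  qed
  \<comment> \<open>Boundedness in the coordinate \<open>1 / z\<close> means quadratic growth of
    \<open>A\<close>, the input of Liouville's theorem. It follows from the limit 0 if infinity is
    singular and from the estimate at ordinary points otherwise.\<close>
  have inf: "\<exists>e M. e > 0 \<and> (\<forall>t. t \<noteq> 0 \<longrightarrow> norm t < e \<longrightarrow> norm (field_in_chart A Infty t) \<le> M)"
  proof (cases "Infty \<in> D")
    case True
    have "\<forall>\<^sub>F t in at 0. dist (field_in_chart A Infty t) 0 < 1"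
      by (rule tendstoD[OF zero[OF True]]) simp
    then show ?thesis unfolding eventually_at by (force intro: less_imp_le)
  next
    case False
    obtain R where R: "R > 0" "\<And>t. t \<in> ball 0 R - {0} \<Longrightarrow> chart Infty t \<notin> D"
      using punctured_chart_ball[OF D(1), of Infty] by blast
    obtain B' C' where sys': "symmetric_square_system (ball 0 R - {0})
        (coeff1 b1 Infty) (coeff2 b2 Infty) (field_in_chart A Infty) B' C'"
      using symmetric_square_system_chart[OF sys, of Infty] symmetric_square_system_subset R(2) by blast
    have "pole_order_at_most 0 (coeff1 b1 Infty)" "pole_order_at_most 0 (coeff2 b2 Infty)"
      using riem False unfolding riemann_equation_def by blast+
    then obtain e M where "e > 0" "\<And>t. t \<noteq> 0 \<Longrightarrow> norm t \<le> e \<Longrightarrow> norm (field_in_chart A Infty t) \<le> M"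
      using symmetric_square_bounded[OF sys' R(1)] by metis
    then show ?thesis by (intro exI[of _ e] exI[of _ M]) auto
  qed
  then obtain e M where e: "e > 0" "\<And>t. t \<noteq> 0 \<Longrightarrow> norm t < e \<Longrightarrow> norm (field_in_chart A Infty t) \<le> M"
    by blast
  have bound: "norm (g w) \<le> M * norm w ^ 2" if w: "2 / e \<le> norm w" for w
  proof -
    have w0: "w \<noteq> 0" using w e(1) by auto
    have "norm (1 / w) < e" using w w0 e(1) by (auto simp: norm_divide field_simps)
    then have "norm (field_in_chart A Infty (1 / w)) \<le> M" using w0 by (intro e(2)) auto
    then have "norm (A w) \<le> M * norm w ^ 2"
      using w0 by (simp add: norm_mult norm_power norm_divide field_simps)
    moreover from this have "0 \<le> M * norm w ^ 2" by (rule order_trans[OF norm_ge_zero])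
    ultimately show ?thesis by (simp add: g_def)
  qed
  define P where "P = [:g 0, deriv g 0, (deriv ^^ 2) g 0 / 2:]"
  have P: "g w = poly P w" for w
    using Liouville_polynomial[OF hol bound, where \<xi> = w] unfolding P_def
    by (simp add: numeral_2_eq_2 algebra_simps)
  have deg: "degree P \<le> 2" unfolding P_def by simp
  \<comment> \<open>In the coordinate \<open>t = 1 / z\<close> the field tends to
    \<open>- coeff P 2\<close> at the origin.\<close>
  have deg1: "degree P \<le> 1" if "Infty \<in> D"
  proof -
    have ev: "\<forall>\<^sub>F t in at 0. field_in_chart A Infty t = - (coeff P 0 * t\<^sup>2 + coeff P 1 * t + coeff P 2)"
    proof -
      obtain R where R: "R > 0" "\<And>t. t \<in> ball 0 R - {0} \<Longrightarrow> chart Infty t \<notin> D"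
        using punctured_chart_ball[OF D(1), of Infty] by blast
      have "field_in_chart A Infty t = - (coeff P 0 * t\<^sup>2 + coeff P 1 * t + coeff P 2)"
        if t: "t \<in> ball 0 R - {0}" for t
      proof -
        have "1 / t \<notin> Z" using R(2)[OF t] t unfolding Z_def by auto
        then have "A (1 / t) = poly P (1 / t)" using P[of "1 / t"] by (simp add: g_def)
        also have "\<dots> = coeff P 0 + coeff P 1 / t + coeff P 2 / t\<^sup>2"
          unfolding P_def by (simp add: numeral_2_eq_2 algebra_simps)
        finally show ?thesis using t by (simp add: field_simps power2_eq_square)
      qed
      then show ?thesis using R(1) by (auto simp: eventually_at intro!: exI[of _ R])
    qed
    have "((\<lambda>t. - (coeff P 0 * t\<^sup>2 + coeff P 1 * t + coeff P 2)) \<longlongrightarrow> - (coeff P 0 * 0\<^sup>2 + coeff P 1 * 0 + coeff P 2)) (at 0)"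
      by (intro tendsto_intros)
    then have "(field_in_chart A Infty \<longlongrightarrow> - coeff P 2) (at 0)"
      using tendsto_cong[OF ev] by (simp del: field_in_chart.simps)
    then have "coeff P 2 = 0"
      using tendsto_unique[OF _ zero[OF that]] by fastforce
    then show ?thesis unfolding P_def by (simp add: numeral_2_eq_2)
  qed
  have "P = 0"
  proof (rule ccontr)
    assume "P \<noteq> 0"
    have "Z \<subseteq> {w. poly P w = 0}" by (auto simp: P[symmetric] g_def)
    then have "card Z \<le> card {w. poly P w = 0}"
      using \<open>P \<noteq> 0\<close> by (intro card_mono poly_roots_finite)
    also have "\<dots> \<le> degree P" using \<open>P \<noteq> 0\<close> by (rule card_poly_roots_bound)
    finally have le: "card Z \<le> degree P" .
    have cZ: "card (Fin ` Z) = card Z" by (intro card_image) (auto simp: inj_on_def)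
    have eq: "Fin ` Z = D - {Infty}"
    proof (intro equalityI subsetI)
      show "q \<in> Fin ` Z" if "q \<in> D - {Infty}" for q
        using that by (cases q) (auto simp: Z_def)
    qed (auto simp: Z_def)
    show False
    proof (cases "Infty \<in> D")
      case True
      then have "card Z = 2" using cZ eq D by simp
      then show False using le deg1[OF True] by simp
    next
      case False
      then have "card Z = 3" using cZ eq D by simp
      then show False using le deg by simp
    qed
  qed
  then show ?thesis using P[of z] z unfolding g_def Z_def by simp
qed

section \<open>Solution germs in the coordinate z\<close>

abbreviation ode_lhs ::
  "(complex \<Rightarrow> complex) \<Rightarrow> (complex \<Rightarrow> complex) \<Rightarrow> (cp1 \<Rightarrow> complex) \<Rightarrow> complex \<Rightarrow> complex" where
  "ode_lhs b1 b2 y w \<equiv> deriv (deriv (\<lambda>w. y (Fin w))) w + b1 w * deriv (\<lambda>w. y (Fin w)) w + b2 w * y (Fin w)"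

text \<open>The centre \<open>p\<close> is left out here, which makes the condition meaningful at infinity, too.\<close>

definition ode_near :: "(complex \<Rightarrow> complex) \<Rightarrow> (complex \<Rightarrow> complex) \<Rightarrow> cp1 \<Rightarrow> (cp1 \<Rightarrow> complex) \<Rightarrow> bool" where
  "ode_near b1 b2 p y \<longleftrightarrow> (\<forall>\<^sub>F q in nhds p. q \<noteq> p \<longrightarrow> (\<forall>w. q = Fin w \<longrightarrow> ode_lhs b1 b2 y w = 0))"

fun finite_coord :: "cp1 \<Rightarrow> complex \<Rightarrow> complex" where
  "finite_coord (Fin c) t = c + t"
| "finite_coord Infty t = 1 / t"

lemma chart_eq_Fin: "t \<noteq> 0 \<Longrightarrow> chart p t = Fin (finite_coord p t)"
  by (cases p) auto

lemma chart_eq_self_iff: "chart p t = p \<longleftrightarrow> t = 0"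
  by (cases p) auto

lemma analytic_finite_coord: "t \<noteq> 0 \<Longrightarrow> finite_coord p analytic_on {t}"
proof (cases p)
  case (Fin c)
  then have "finite_coord p = (\<lambda>t. c + t)" by (simp add: fun_eq_iff)
  then show ?thesis by (simp add: analytic_intros)
next
  case Infty
  then have *: "finite_coord p = (\<lambda>t. 1 / t)" by (simp add: fun_eq_iff)
  show "t \<noteq> 0 \<Longrightarrow> ?thesis" unfolding * by (intro analytic_intros) auto
qed

lemma ode_near_chart:
  "ode_near b1 b2 p y \<longleftrightarrow> (\<forall>\<^sub>F t in at 0. ode_lhs b1 b2 y (finite_coord p t) = 0)"
proof -
  have "(chart p t \<noteq> p \<longrightarrow> (\<forall>w. chart p t = Fin w \<longrightarrow> ode_lhs b1 b2 y w = 0)) \<longleftrightarrow>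
      (t \<noteq> 0 \<longrightarrow> ode_lhs b1 b2 y (finite_coord p t) = 0)" for t
    using chart_eq_self_iff[of p t] chart_eq_Fin[of t p] by (cases "t = 0") auto
  then show ?thesis
    unfolding ode_near_def eventually_nhds_cp1 eventually_at_filter by simp
qed

lemma eventually_analytic_punctured:
  assumes "f analytic_on {0}"
  shows "\<forall>\<^sub>F t in at 0. f analytic_on {t}"
proof -
  obtain e where e: "e > 0" "f holomorphic_on ball 0 e" using assms analytic_at_ball by blast
  then have "f analytic_on ball 0 e" by (simp add: analytic_on_open)
  then have "f analytic_on {t}" if "t \<in> ball 0 e" for t using that by (auto intro: analytic_on_subset)
  then show ?thesis using e(1) by (auto simp: eventually_at intro!: exI[of _ e])
qed

text \<open>Transfers the equation to the coordinate \<open>z\<close> at every point. At infinity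
  the two left-hand sides differ by the factor \<open>t ^ 4\<close>, which is nonzero off the
  centre.\<close>

lemma solution_near_iff:
  "solution_near b1 b2 p y \<longleftrightarrow> analytic_at_cp1 y p \<and> ode_near b1 b2 p y"
proof (cases "analytic_at_cp1 y p")
  case True
  let ?u = "y \<circ> chart p" and ?Y = "\<lambda>w. y (Fin w)"
  have "\<forall>\<^sub>F t in at 0. (deriv (deriv ?u) t + coeff1 b1 p t * deriv ?u t + coeff2 b2 p t * ?u t = 0) =
      (ode_lhs b1 b2 y (finite_coord p t) = 0)"
  proof (cases p)
    case (Fin c)
    have u: "?u = (\<lambda>t. ?Y (c + t))" using Fin by (simp add: fun_eq_iff)
    have shift: "deriv (\<lambda>t. f (c + t)) = (\<lambda>t. deriv f (c + t))" for f :: "complex \<Rightarrow> complex"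
      by (simp add: fun_eq_iff deriv_def DERIV_at_within_shift[of f _ c, where S = UNIV, simplified])
    show ?thesis unfolding u using Fin shift[of ?Y] shift[of "deriv ?Y"] by simp
  next
    case Infty
    have "?u analytic_on {0}" using True by (simp add: analytic_at_cp1_def)
    then have "\<forall>\<^sub>F t in at 0. ?u analytic_on {t}" by (rule eventually_analytic_punctured)
    moreover have "\<forall>\<^sub>F t::complex in at 0. t \<noteq> 0" by (simp add: eventually_at_filter)
    ultimately show ?thesis
    proof eventually_elim
      case (elim t)
      have Y: "?Y analytic_on {1 / t}"
        using elim analytic_at_chart[of y p t] analytic_at_Fin Infty by simp
      obtain d where d: "d > 0" "?Y holomorphic_on ball (1 / t) d"
        using Y analytic_at_ball by blast
      have hY: "(?Y has_field_derivative deriv ?Y w) (at w)" if "w \<in> ball (1 / t) d" for w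
        using d(2) that by (meson holomorphic_derivI open_ball)
      have hY': "(deriv ?Y has_field_derivative deriv (deriv ?Y) w) (at w)" if "w \<in> ball (1 / t) d" for w
        using d(2) that by (meson holomorphic_deriv holomorphic_derivI open_ball)
      have inv: "((\<lambda>t. 1 / t) has_field_derivative - 1 / s\<^sup>2) (at s)" if "s \<noteq> 0" for s :: complex
        using that by (auto intro!: derivative_eq_intros simp: power2_eq_square)
      have "((\<lambda>t. 1 / t) \<longlongrightarrow> 1 / t) (nhds t)"
        using elim by (intro tendsto_intros) (auto simp: tendsto_def filterlim_ident)
      then have "\<forall>\<^sub>F s in nhds t. 1 / s \<in> ball (1 / t) d"
        using d(1) by (intro topological_tendstoD) auto
      moreover have nz: "\<forall>\<^sub>F s in nhds t. s \<noteq> 0" using elim by (intro t1_space_nhds) auto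
      ultimately have near: "\<forall>\<^sub>F s in nhds t. s \<noteq> 0 \<and> 1 / s \<in> ball (1 / t) d"
        by eventually_elim simp
      have u1: "deriv ?u s = - deriv ?Y (1 / s) / s\<^sup>2" if "s \<noteq> 0" "1 / s \<in> ball (1 / t) d" for s
      proof -
        have "((\<lambda>t. ?Y (1 / t)) has_field_derivative deriv ?Y (1 / s) * (- 1 / s\<^sup>2)) (at s)"
          by (rule DERIV_chain2[OF hY[OF that(2)] inv[OF that(1)]])
        then have "deriv (\<lambda>t. ?Y (1 / t)) s = - deriv ?Y (1 / s) / s\<^sup>2"
          by (simp add: DERIV_imp_deriv)
        moreover have "deriv ?u s = deriv (\<lambda>t. ?Y (1 / t)) s"
        proof (rule deriv_cong_ev)
          have "\<forall>\<^sub>F r in nhds s. r \<noteq> 0" using that by (intro t1_space_nhds) auto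
          then show "\<forall>\<^sub>F r in nhds s. ?u r = ?Y (1 / r)"
            by (rule eventually_mono) (use Infty in simp)
        qed simp
        ultimately show ?thesis by simp
      qed
      have t: "1 / t \<in> ball (1 / t) d" using d(1) by simp
      have "deriv (deriv ?u) t = deriv (\<lambda>s. - deriv ?Y (1 / s) / s\<^sup>2) t"
        by (rule deriv_cong_ev) (use near u1 in \<open>auto elim: eventually_mono\<close>)
      also have "\<dots> = deriv (deriv ?Y) (1 / t) / t ^ 4 + 2 * deriv ?Y (1 / t) / t ^ 3"
      proof (rule DERIV_imp_deriv)
        have c: "((\<lambda>s. deriv ?Y (1 / s)) has_field_derivative deriv (deriv ?Y) (1 / t) * (- 1 / t\<^sup>2)) (at t)"
          by (rule DERIV_chain2[OF hY'[OF t] inv[OF elim(2)]])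
        show "((\<lambda>s. - deriv ?Y (1 / s) / s\<^sup>2) has_field_derivative
            deriv (deriv ?Y) (1 / t) / t ^ 4 + 2 * deriv ?Y (1 / t) / t ^ 3) (at t)"
          by (rule DERIV_cong[OF DERIV_divide[OF DERIV_minus[OF c] DERIV_power[OF DERIV_ident]]])
            (use elim in \<open>simp_all add: field_simps eval_nat_numeral\<close>)
      qed
      finally have u2: "deriv (deriv ?u) t = deriv (deriv ?Y) (1 / t) / t ^ 4 + 2 * deriv ?Y (1 / t) / t ^ 3" .
      have "deriv (deriv ?u) t + coeff1 b1 p t * deriv ?u t + coeff2 b2 p t * ?u t =
          ode_lhs b1 b2 y (1 / t) / t ^ 4"
        unfolding u2 u1[OF elim(2) t] using elim Infty by (simp add: field_simps eval_nat_numeral)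
      then show ?case using elim Infty by simp
    qed
  qed
  then have "(\<forall>\<^sub>F t in at 0. deriv (deriv ?u) t + coeff1 b1 p t * deriv ?u t + coeff2 b2 p t * ?u t = 0) =
      (\<forall>\<^sub>F t in at 0. ode_lhs b1 b2 y (finite_coord p t) = 0)"
    by (rule eventually_cong) simp
  then show ?thesis using True unfolding solution_near_def Let_def ode_near_chart by simp
qed (simp add: solution_near_def)

lemma ode_near_cong:
  assumes "\<forall>\<^sub>F q in nhds p. y q = y' q"
  shows "ode_near b1 b2 p y = ode_near b1 b2 p y'"
proof -
  have "\<forall>\<^sub>F q in nhds p. (q \<noteq> p \<longrightarrow> (\<forall>w. q = Fin w \<longrightarrow> ode_lhs b1 b2 y w = 0)) =
      (q \<noteq> p \<longrightarrow> (\<forall>w. q = Fin w \<longrightarrow> ode_lhs b1 b2 y' w = 0))"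
    using eventually_eventually[THEN iffD2, OF assms]
  proof eventually_elim
    case (elim q)
    have "ode_lhs b1 b2 y w = ode_lhs b1 b2 y' w" if "q = Fin w" for w
    proof -
      have ev: "\<forall>\<^sub>F v in nhds w. y (Fin v) = y' (Fin v)"
        using elim that by (simp add: eventually_nhds_Fin)
      then have "\<forall>\<^sub>F v in nhds w. deriv (\<lambda>w. y (Fin w)) v = deriv (\<lambda>w. y' (Fin w)) v"
        using eventually_eventually[THEN iffD2, OF ev] by (elim eventually_mono) (auto intro: deriv_cong_ev)
      then show ?thesis
        using deriv_cong_ev[OF ev refl] deriv_cong_ev[OF _ refl, of "deriv (\<lambda>w. y (Fin w))"] eventually_nhds_x_imp_x[OF ev]
        by simp
    qed
    then show ?case by auto
  qed
  then show ?thesis unfolding ode_near_def by (rule eventually_cong) simp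
qed

lemma analytic_ode_lhs:
  assumes "(\<lambda>w. y (Fin w)) analytic_on {w}" "b1 analytic_on {w}" "b2 analytic_on {w}"
  shows "ode_lhs b1 b2 y analytic_on {w}"
  using assms by (intro analytic_intros) (auto intro: analytic_deriv)

lemma open_finite_part: "finite D \<Longrightarrow> open {w. Fin w \<notin> D}"
  using open_Fin_vimage[OF closed_finite_cp1] by (simp add: vimage_def)

text \<open>The left-hand side is holomorphic on a punctured disc, which is connected, so the
  identity theorem applies. The disc stays punctured because \<open>p\<close> may be infinity, where
  \<open>z\<close> is no coordinate.\<close>

lemma ode_near_locally_constant:
  assumes D: "finite D" "p \<notin> D" and b: "b1 holomorphic_on {w. Fin w \<notin> D}" "b2 holomorphic_on {w. Fin w \<notin> D}"
    and y: "analytic_at_cp1 y p"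
  shows "\<forall>\<^sub>F q in nhds p. ode_near b1 b2 q y = ode_near b1 b2 p y"
proof -
  obtain e1 where e1: "e1 > 0" "(y \<circ> chart p) holomorphic_on ball 0 e1"
    using analytic_at_cp1_ball[OF y] .
  obtain e2 where e2: "e2 > 0" "\<And>t. t \<in> ball 0 e2 - {0} \<Longrightarrow> chart p t \<notin> D"
    using punctured_chart_ball[OF D(1), of p] by blast
  define e where "e = min e1 e2"
  have e: "e > 0" using e1 e2 by (simp add: e_def)
  define E where "E = (\<lambda>t. ode_lhs b1 b2 y (finite_coord p t))"
  have "E analytic_on {t}" if t: "t \<in> ball 0 e - {0}" for t
  proof -
    let ?w = "finite_coord p t"
    have w: "chart p t = Fin ?w" using t by (simp add: chart_eq_Fin)
    have "y \<circ> chart p analytic_on ball 0 e1" using e1 by (simp add: analytic_on_open)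
    then have "y \<circ> chart p analytic_on {t}"
      by (rule analytic_on_subset) (use t in \<open>auto simp: e_def\<close>)
    then have "(\<lambda>w. y (Fin w)) analytic_on {?w}"
      using analytic_at_chart[of y p t] analytic_at_Fin w by simp
    moreover have "?w \<in> {w. Fin w \<notin> D}" using e2(2)[of t] t w by (auto simp: e_def)
    then have "b1 analytic_on {?w}" "b2 analytic_on {?w}"
      using b open_finite_part[OF D(1)] by (auto simp: analytic_on_open[symmetric] intro: analytic_on_subset)
    ultimately have "ode_lhs b1 b2 y analytic_on finite_coord p ` {t}"
      using analytic_ode_lhs[of y ?w b1 b2] by simp
    from analytic_on_compose[OF analytic_finite_coord this] show ?thesis
      using t unfolding E_def o_def by simp
  qed
  then have "E analytic_on (ball 0 e - {0})" unfolding analytic_on_def by blast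
  then have holE: "E holomorphic_on ball 0 e - {0}" by (rule analytic_imp_holomorphic)
  have conn: "connected (ball (0::complex) e - {0})" by (intro connected_punctured_ball) simp
  have opn: "open (ball (0::complex) e - {0})" by auto
  have ident: "E t = 0" if "open V" "V \<subseteq> ball 0 e - {0}" "V \<noteq> {}" "\<And>t. t \<in> V \<Longrightarrow> E t = 0" "t \<in> ball 0 e - {0}" for V t
    by (rule analytic_continuation_open[OF that(1) opn that(3) conn that(2) holE, of "\<lambda>_. 0"]) (use that in auto)
  have iff: "ode_near b1 b2 (chart p t) y \<longleftrightarrow> (\<forall>s\<in>ball 0 e - {0}. E s = 0)" if t: "t \<in> ball 0 e" for t
  proof
    assume "ode_near b1 b2 (chart p t) y"
    then have "\<forall>\<^sub>F s in nhds t. chart p s \<noteq> chart p t \<longrightarrow> (\<forall>w. chart p s = Fin w \<longrightarrow> ode_lhs b1 b2 y w = 0)"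
      by (simp add: ode_near_def eventually_nhds_chart)
    then obtain V where V: "open V" "t \<in> V"
      "\<And>s. s \<in> V \<Longrightarrow> chart p s \<noteq> chart p t \<longrightarrow> (\<forall>w. chart p s = Fin w \<longrightarrow> ode_lhs b1 b2 y w = 0)"
      unfolding eventually_nhds by blast
    \<comment> \<open>\<open>ode_near\<close> says nothing at its centre \<open>t\<close>, and 0 is
      the puncture; a nonempty open set has more than these two points.\<close>
    let ?V = "V \<inter> (ball 0 e - {0}) - {t}"
    have "E s = 0" if "s \<in> ?V" for s
      using V(3)[of s] that inj_chart[of p] chart_eq_Fin[of s p] by (auto simp: E_def dest: injD)
    moreover have "open ?V" using V(1) opn by auto
    moreover have "?V \<noteq> {}"
    proof
      assume "?V = {}"
      then have "V \<inter> ball 0 e \<subseteq> {0, t}" by auto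
      then have "finite (V \<inter> ball 0 e)" by (rule finite_subset) simp
      moreover have "open (V \<inter> ball 0 e)" "t \<in> V \<inter> ball 0 e" using V t by auto
      ultimately show False by (metis empty_iff finite_imp_not_open)
    qed
    ultimately show "\<forall>s\<in>ball 0 e - {0}. E s = 0" using ident[of ?V] by blast
  next
    assume E0: "\<forall>s\<in>ball 0 e - {0}. E s = 0"
    have "\<forall>\<^sub>F s in nhds t. s \<noteq> t \<longrightarrow> s \<in> ball 0 e - {0}"
    proof (cases "t = 0")
      case True
      then show ?thesis using e by (intro eventually_mono[OF eventually_nhds_in_open[of "ball 0 e"]]) auto
    next
      case False
      then show ?thesis using t by (intro eventually_mono[OF eventually_nhds_in_open[OF opn]]) auto
    qed
    then show "ode_near b1 b2 (chart p t) y"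
      unfolding ode_near_def eventually_nhds_chart
    proof eventually_elim
      case (elim s)
      then show ?case using E0 chart_eq_Fin[of s p] by (auto simp: E_def)
    qed
  qed
  show ?thesis
    by (rule eventually_chart_ball[OF e]) (use iff iff[of 0] e in auto)
qed

text \<open>The independence clause of \<open>solution_basis\<close>, isolated in order to propagate
  it along paths.\<close>

definition independent_near :: "cp1 \<Rightarrow> (cp1 \<Rightarrow> complex^2) \<Rightarrow> bool" where
  "independent_near p f \<longleftrightarrow>
     (\<forall>c :: complex^2. (\<forall>\<^sub>F q in nhds p. (\<Sum>j\<in>UNIV. c $ j * f q $ j) = 0) \<longrightarrow> c = 0)"

lemma analytic_at_cp1_ball_vec:
  assumes "\<And>j::2. analytic_at_cp1 (\<lambda>q. f q $ j) p"
  obtains e where "e > 0" "\<And>j. (\<lambda>t. f (chart p t) $ j) holomorphic_on ball 0 e"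
proof -
  obtain e1 where e1: "e1 > 0" "((\<lambda>q. f q $ 1) \<circ> chart p) holomorphic_on ball 0 e1"
    using analytic_at_cp1_ball[OF assms] .
  obtain e2 where e2: "e2 > 0" "((\<lambda>q. f q $ 2) \<circ> chart p) holomorphic_on ball 0 e2"
    using analytic_at_cp1_ball[OF assms] .
  show ?thesis
  proof (rule that[of "min e1 e2"])
    fix j :: 2
    have "((\<lambda>q. f q $ j) \<circ> chart p) holomorphic_on ball 0 (min e1 e2)"
      using e1 e2 exhaust_2[of j] by (auto intro: holomorphic_on_subset)
    then show "(\<lambda>t. f (chart p t) $ j) holomorphic_on ball 0 (min e1 e2)" by (simp add: o_def)
  qed (use e1 e2 in auto)
qed

lemma independent_near_locally_constant:
  assumes "\<And>j. analytic_at_cp1 (\<lambda>q. f q $ j) p"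
  shows "\<forall>\<^sub>F q in nhds p. independent_near q f = independent_near p f"
proof -
  obtain e where e: "e > 0" "\<And>j. (\<lambda>t. f (chart p t) $ j) holomorphic_on ball 0 e"
    using analytic_at_cp1_ball_vec[of f p] assms by blast
  show ?thesis
  proof (rule eventually_chart_ball[OF e(1)])
    fix t :: complex assume t: "t \<in> ball 0 e"
    have "(\<forall>\<^sub>F r in nhds (chart p t). (\<Sum>j\<in>UNIV. c $ j * f r $ j) = 0) =
        (\<forall>\<^sub>F r in nhds p. (\<Sum>j\<in>UNIV. c $ j * f r $ j) = 0)" for c :: "complex^2"
      by (rule vanishing_iff_chart[OF e(1) _ t]) (auto simp: o_def intro!: holomorphic_intros e(2))
    then show "independent_near (chart p t) f = independent_near p f"
      by (simp add: independent_near_def)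
  qed
qed

lemma independent_near_cong:
  assumes "\<forall>\<^sub>F q in nhds p. f q = g q"
  shows "independent_near p f = independent_near p g"
proof -
  have "(\<forall>\<^sub>F q in nhds p. (\<Sum>j\<in>UNIV. c $ j * f q $ j) = 0) =
      (\<forall>\<^sub>F q in nhds p. (\<Sum>j\<in>UNIV. c $ j * g q $ j) = 0)" for c :: "complex^2"
    using assms by (rule eventually_cong) simp
  then show ?thesis by (simp add: independent_near_def)
qed

section \<open>The Wronskian\<close>

abbreviation comp1 :: "(cp1 \<Rightarrow> complex^2) \<Rightarrow> complex \<Rightarrow> complex" where "comp1 f w \<equiv> f (Fin w) $ 1"
abbreviation comp2 :: "(cp1 \<Rightarrow> complex^2) \<Rightarrow> complex \<Rightarrow> complex" where "comp2 f w \<equiv> f (Fin w) $ 2"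

definition wronskian :: "(cp1 \<Rightarrow> complex^2) \<Rightarrow> complex \<Rightarrow> complex" where
  "wronskian f w = comp1 f w * deriv (comp2 f) w - comp2 f w * deriv (comp1 f) w"

definition sym_A :: "(cp1 \<Rightarrow> complex^2) \<Rightarrow> complex \<Rightarrow> complex" where
  "sym_A f w = comp1 f w * comp2 f w / wronskian f w"
definition sym_B :: "(cp1 \<Rightarrow> complex^2) \<Rightarrow> complex \<Rightarrow> complex" where
  "sym_B f w = (deriv (comp1 f) w * comp2 f w + comp1 f w * deriv (comp2 f) w) / wronskian f w"
definition sym_C :: "(cp1 \<Rightarrow> complex^2) \<Rightarrow> complex \<Rightarrow> complex" where
  "sym_C f w = deriv (comp1 f) w * deriv (comp2 f) w / wronskian f w"

text \<open>\<open>((f g)')^2 - 4 f g f' g' = (f g' - g f')^2\<close>. This normalization prevents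
  the field from vanishing identically.\<close>

lemma sym_discriminant: "wronskian f w \<noteq> 0 \<Longrightarrow> (sym_B f w)\<^sup>2 - 4 * sym_A f w * sym_C f w = 1"
  by (simp add: sym_A_def sym_B_def sym_C_def divide_simps) (simp add: wronskian_def power2_eq_square algebra_simps)

text \<open>Stated with \<open>has_field_derivative\<close>, so that the equation includes
  differentiability up to second order, which an identity between values of \<open>deriv\<close>
  would not.\<close>

definition fundamental_on ::
  "(complex \<Rightarrow> complex) \<Rightarrow> (complex \<Rightarrow> complex) \<Rightarrow> complex set \<Rightarrow> (cp1 \<Rightarrow> complex^2) \<Rightarrow> bool" where
  "fundamental_on b1 b2 N f \<longleftrightarrow> (\<forall>w\<in>N. wronskian f w \<noteq> 0 \<and>
     (\<forall>j. ((\<lambda>w. f (Fin w) $ j) has_field_derivative deriv (\<lambda>w. f (Fin w) $ j) w) (at w) \<and>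
          (deriv (\<lambda>w. f (Fin w) $ j) has_field_derivative
             - b1 w * deriv (\<lambda>w. f (Fin w) $ j) w - b2 w * f (Fin w) $ j) (at w)))"

text \<open>Abel's identity.\<close>

lemma wronskian_derivative:
  assumes "\<And>j. ((\<lambda>w. f (Fin w) $ j) has_field_derivative deriv (\<lambda>w. f (Fin w) $ j) w) (at w)"
    and "\<And>j. (deriv (\<lambda>w. f (Fin w) $ j) has_field_derivative
             - b1 w * deriv (\<lambda>w. f (Fin w) $ j) w - b2 w * f (Fin w) $ j) (at w)"
  shows "(wronskian f has_field_derivative - b1 w * wronskian f w) (at w)"
  unfolding wronskian_def
  by (rule derivative_eq_intros refl assms)+ (simp add: algebra_simps)

lemma symmetric_square_of_fundamental:
  assumes "fundamental_on b1 b2 N f"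
  shows "symmetric_square_system N b1 b2 (sym_A f) (sym_B f) (sym_C f)"
  unfolding symmetric_square_system_def
proof (intro ballI)
  fix w assume "w \<in> N"
  then have nz: "wronskian f w \<noteq> 0"
    and d: "\<And>j. ((\<lambda>w. f (Fin w) $ j) has_field_derivative deriv (\<lambda>w. f (Fin w) $ j) w) (at w)"
    and d': "\<And>j. (deriv (\<lambda>w. f (Fin w) $ j) has_field_derivative
             - b1 w * deriv (\<lambda>w. f (Fin w) $ j) w - b2 w * f (Fin w) $ j) (at w)"
    using assms by (auto simp: fundamental_on_def)
  note W = wronskian_derivative[where f = f and w = w and ?b1.0 = b1 and ?b2.0 = b2, OF d d']
  have quot: "((\<lambda>w. n w / wronskian f w) has_field_derivative (n' + b1 w * n w) / wronskian f w) (at w)"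
    if "(n has_field_derivative n') (at w)" for n n'
    by (rule DERIV_cong[OF DERIV_divide[OF that W nz]]) (use nz in \<open>simp add: field_simps power2_eq_square\<close>)
  have "((\<lambda>w. comp1 f w * comp2 f w) has_field_derivative
      deriv (comp1 f) w * comp2 f w + comp1 f w * deriv (comp2 f) w) (at w)"
    by (rule derivative_eq_intros refl d)+ simp
  from quot[OF this] have A: "(sym_A f has_field_derivative sym_B f w + b1 w * sym_A f w) (at w)"
    unfolding sym_A_def sym_B_def by (simp add: add_divide_distrib)
  have "((\<lambda>w. deriv (comp1 f) w * comp2 f w + comp1 f w * deriv (comp2 f) w) has_field_derivative
      2 * (deriv (comp1 f) w * deriv (comp2 f) w) - 2 * b2 w * (comp1 f w * comp2 f w)
      - b1 w * (deriv (comp1 f) w * comp2 f w + comp1 f w * deriv (comp2 f) w)) (at w)"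
    by (rule derivative_eq_intros refl d d')+ (simp add: algebra_simps)
  from quot[OF this] have B: "(sym_B f has_field_derivative 2 * sym_C f w - 2 * b2 w * sym_A f w) (at w)"
    unfolding sym_A_def sym_B_def sym_C_def by (simp add: diff_divide_distrib)
  have "((\<lambda>w. deriv (comp1 f) w * deriv (comp2 f) w) has_field_derivative
      - 2 * b1 w * (deriv (comp1 f) w * deriv (comp2 f) w)
      - b2 w * (deriv (comp1 f) w * comp2 f w + comp1 f w * deriv (comp2 f) w)) (at w)"
    by (rule derivative_eq_intros refl d d')+ (simp add: algebra_simps)
  from quot[OF this] have C: "(sym_C f has_field_derivative - b1 w * sym_C f w - b2 w * sym_B f w) (at w)"
    unfolding sym_B_def sym_C_def by (rule DERIV_cong) (use nz in \<open>simp add: field_simps\<close>)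
  show "(sym_A f has_field_derivative sym_B f w + b1 w * sym_A f w) (at w) \<and>
      (sym_B f has_field_derivative 2 * sym_C f w - 2 * b2 w * sym_A f w) (at w) \<and>
      (sym_C f has_field_derivative - b1 w * sym_C f w - b2 w * sym_B f w) (at w)"
    using A B C by blast
qed

text \<open>Where \<open>comp1 f\<close> is nonzero, the quotient \<open>comp2 f / comp1 f\<close>
  has derivative 0, and the identity theorem spreads the resulting linear relation over the
  disc.\<close>

lemma wronskian_zero_imp_dependent:
  assumes hol: "\<And>j. (\<lambda>w. f (Fin w) $ j) holomorphic_on ball z d" and "d > 0"
    and W: "\<And>w. w \<in> ball z d \<Longrightarrow> wronskian f w = 0"
  shows "\<not> independent_near (Fin z) f"
proof (cases "\<forall>w\<in>ball z d. comp1 f w = 0")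
  case True
  have ev: "\<forall>\<^sub>F q in nhds (Fin z). (\<Sum>j\<in>UNIV. (vector [1, 0] :: complex^2) $ j * f q $ j) = 0"
    unfolding eventually_nhds_Fin
    by (rule eventually_mono[OF eventually_nhds_in_open[of "ball z d"]])
      (use True \<open>d > 0\<close> in \<open>auto simp: sum_2\<close>)
  have "(vector [1, 0] :: complex^2) \<noteq> 0" by (simp add: vec_eq_iff forall_2)
  then show ?thesis using ev unfolding independent_near_def by blast
next
  case False
  then obtain w0 where w0: "w0 \<in> ball z d" "comp1 f w0 \<noteq> 0" by blast
  have d1: "(comp1 f has_field_derivative deriv (comp1 f) w) (at w)"
    and d2: "(comp2 f has_field_derivative deriv (comp2 f) w) (at w)" if "w \<in> ball z d" for w
    using hol that by (meson holomorphic_derivI open_ball)+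
  have "isCont (comp1 f) w0" using d1[OF w0(1)] DERIV_isCont by blast
  from continuous_at_avoid[OF this w0(2)]
  obtain e1 where e1: "e1 > 0" "\<And>w. dist w0 w < e1 \<Longrightarrow> comp1 f w \<noteq> 0" by blast
  obtain e2 where e2: "e2 > 0" "ball w0 e2 \<subseteq> ball z d"
    using w0(1) open_contains_ball[of "ball z d"] by blast
  define e where "e = min e1 e2"
  have e: "e > 0" "ball w0 e \<subseteq> ball z d" "\<And>w. w \<in> ball w0 e \<Longrightarrow> comp1 f w \<noteq> 0"
    using e1 e2 by (auto simp: e_def subset_iff)
  have "\<exists>k. \<forall>w\<in>ball w0 e. comp2 f w / comp1 f w = k"
  proof (rule has_field_derivative_zero_constant[OF convex_ball])
    fix w assume w: "w \<in> ball w0 e"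
    have wd: "w \<in> ball z d" using e w by blast
    have "((\<lambda>w. comp2 f w / comp1 f w) has_field_derivative
        (deriv (comp2 f) w * comp1 f w - comp2 f w * deriv (comp1 f) w) / (comp1 f w * comp1 f w)) (at w)"
      by (rule DERIV_divide[OF d2[OF wd] d1[OF wd] e(3)[OF w]])
    moreover have "deriv (comp2 f) w * comp1 f w - comp2 f w * deriv (comp1 f) w = 0"
      using W[OF wd] by (simp add: wronskian_def mult.commute)
    ultimately show "((\<lambda>w. comp2 f w / comp1 f w) has_field_derivative 0) (at w within ball w0 e)"
      by (simp add: has_field_derivative_at_within)
  qed
  then obtain k where k: "\<And>w. w \<in> ball w0 e \<Longrightarrow> comp2 f w / comp1 f w = k" by blast
  have "comp2 f w - k * comp1 f w = 0" if "w \<in> ball z d" for w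
    by (rule analytic_continuation_open[of "ball w0 e" "ball z d" "\<lambda>w. comp2 f w - k * comp1 f w" "\<lambda>_. 0"])
      (use e that k in \<open>auto intro!: holomorphic_intros hol simp: field_simps\<close>)
  then have ev: "\<forall>\<^sub>F q in nhds (Fin z). (\<Sum>j\<in>UNIV. (vector [- k, 1] :: complex^2) $ j * f q $ j) = 0"
    unfolding eventually_nhds_Fin
    by (intro eventually_mono[OF eventually_nhds_in_open[of "ball z d"]])
      (use \<open>d > 0\<close> in \<open>auto simp: sum_2\<close>)
  have "(vector [- k, 1] :: complex^2) \<noteq> 0" by (simp add: vec_eq_iff forall_2)
  then show ?thesis using ev unfolding independent_near_def by blast
qed

text \<open>By Abel's identity \<open>wronskian f * exp K\<close> is constant for a primitive
  \<open>K\<close> of \<open>b1\<close>. So the Wronskian has no zeros or vanishes identically, and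
  the latter contradicts independence.\<close>

lemma fundamental_on_ball:
  assumes D: "finite D" "Fin z \<notin> D"
    and b: "b1 holomorphic_on {w. Fin w \<notin> D}" "b2 holomorphic_on {w. Fin w \<notin> D}"
    and f: "\<And>j. analytic_at_cp1 (\<lambda>q. f q $ j) (Fin z)"
    and ode: "\<And>j. ode_near b1 b2 (Fin z) (\<lambda>q. f q $ j)"
    and ind: "independent_near (Fin z) f"
  obtains d where "d > 0" "ball z d \<subseteq> {w. Fin w \<notin> D}" "fundamental_on b1 b2 (ball z d) f"
proof -
  obtain d1 where d1: "d1 > 0" "\<And>j. (\<lambda>t. f (chart (Fin 0) t) $ j) holomorphic_on ball z d1"
  proof -
    obtain e where e: "e > 0" "\<And>j. (\<lambda>t. f (chart (Fin z) t) $ j) holomorphic_on ball 0 e"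
      using analytic_at_cp1_ball_vec[of f "Fin z"] f by blast
    show ?thesis
    proof (rule that[OF e(1)])
      fix j :: 2
      have "((\<lambda>t. f (chart (Fin z) t) $ j) \<circ> (\<lambda>w. w - z)) holomorphic_on ball z e"
        by (rule holomorphic_on_compose_gen[OF _ e(2)]) (auto intro!: holomorphic_intros simp: dist_norm norm_minus_commute)
      then show "(\<lambda>t. f (chart (Fin 0) t) $ j) holomorphic_on ball z e" by (simp add: o_def)
    qed
  qed
  obtain d2 where d2: "d2 > 0" "ball z d2 \<subseteq> {w. Fin w \<notin> D}"
    using open_finite_part[OF D(1)] D(2) open_contains_ball by blast
  have "\<forall>\<^sub>F w in nhds z. \<forall>j. w \<noteq> z \<longrightarrow> ode_lhs b1 b2 (\<lambda>q. f q $ j) w = 0"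
    using ode unfolding ode_near_def eventually_nhds_Fin by (intro eventually_all_finite) simp
  then obtain V where V: "open V" "z \<in> V" "\<And>w j. w \<in> V \<Longrightarrow> w \<noteq> z \<Longrightarrow> ode_lhs b1 b2 (\<lambda>q. f q $ j) w = 0"
    unfolding eventually_nhds by blast
  obtain d3 where d3: "d3 > 0" "ball z d3 \<subseteq> V" using V open_contains_ball by blast
  define d where "d = min d1 (min d2 d3)"
  have d: "d > 0" "ball z d \<subseteq> {w. Fin w \<notin> D}" using d1 d2 d3 by (auto simp: d_def)
  have hol: "(\<lambda>w. f (Fin w) $ j) holomorphic_on ball z d" for j
  proof -
    have "(\<lambda>w. f (Fin w) $ j) holomorphic_on ball z d1" using d1(2)[of j] by simp
    then show ?thesis by (rule holomorphic_on_subset) (auto simp: d_def)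
  qed
  have hb: "b1 holomorphic_on ball z d" "b2 holomorphic_on ball z d"
    using b d(2) holomorphic_on_subset by blast+
  have odeall: "ode_lhs b1 b2 (\<lambda>q. f q $ j) w = 0" if w: "w \<in> ball z d" for w j
  proof (cases "w = z")
    case False
    then show ?thesis using V(3) d3 w by (auto simp: d_def)
  next
    case True
    \<comment> \<open>\<open>ode_near\<close> leaves out the centre; there the equation follows by
      continuity.\<close>
    let ?E = "ode_lhs b1 b2 (\<lambda>q. f q $ j)"
    have "?E holomorphic_on ball z d"
      by (intro holomorphic_on_add holomorphic_on_mult holomorphic_deriv open_ball hol hb)
    then have "isCont ?E z"
      by (rule continuous_on_interior[OF holomorphic_on_imp_continuous_on]) (use d(1) in simp)
    then have "(?E \<longlongrightarrow> ?E z) (at z)" by (simp add: isCont_def)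
    moreover have "(?E \<longlongrightarrow> 0) (at z)"
    proof (rule tendsto_eventually)
      show "\<forall>\<^sub>F w in at z. ?E w = 0"
        using V(3) d3 by (auto simp: eventually_at subset_iff dist_commute intro!: exI[of _ d3])
    qed
    ultimately show ?thesis using True tendsto_unique[of "at z"] by simp
  qed
  have D1: "((\<lambda>w. f (Fin w) $ j) has_field_derivative deriv (\<lambda>w. f (Fin w) $ j) w) (at w)"
    and D2: "(deriv (\<lambda>w. f (Fin w) $ j) has_field_derivative
             - b1 w * deriv (\<lambda>w. f (Fin w) $ j) w - b2 w * f (Fin w) $ j) (at w)"
    if w: "w \<in> ball z d" for w j
  proof -
    show "((\<lambda>w. f (Fin w) $ j) has_field_derivative deriv (\<lambda>w. f (Fin w) $ j) w) (at w)"
      using hol w by (meson holomorphic_derivI open_ball)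
    have "(deriv (\<lambda>w. f (Fin w) $ j) has_field_derivative deriv (deriv (\<lambda>w. f (Fin w) $ j)) w) (at w)"
      using hol w by (meson holomorphic_deriv holomorphic_derivI open_ball)
    moreover have "deriv (deriv (\<lambda>w. f (Fin w) $ j)) w = - b1 w * deriv (\<lambda>w. f (Fin w) $ j) w - b2 w * f (Fin w) $ j"
      using odeall[OF w, of j] by (simp add: algebra_simps eq_neg_iff_add_eq_0)
    ultimately show "(deriv (\<lambda>w. f (Fin w) $ j) has_field_derivative
             - b1 w * deriv (\<lambda>w. f (Fin w) $ j) w - b2 w * f (Fin w) $ j) (at w)" by simp
  qed
  have W': "(wronskian f has_field_derivative - b1 w * wronskian f w) (at w)" if "w \<in> ball z d" for w
    by (rule wronskian_derivative[where f = f and w = w and ?b1.0 = b1 and ?b2.0 = b2, OF D1[OF that] D2[OF that]])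
  obtain K where "\<And>w. w \<in> ball z d \<Longrightarrow> (K has_field_derivative b1 w) (at w within ball z d)"
    using holomorphic_convex_primitive'[OF convex_ball open_ball hb(1)] by blast
  then have K: "(K has_field_derivative b1 w) (at w)" if "w \<in> ball z d" for w
    using that by (metis at_within_open open_ball)
  have "\<exists>k. \<forall>w\<in>ball z d. wronskian f w * exp (K w) = k"
  proof (rule has_field_derivative_zero_constant[OF convex_ball])
    fix w assume w: "w \<in> ball z d"
    have "((\<lambda>w. wronskian f w * exp (K w)) has_field_derivative
       (- b1 w * wronskian f w) * exp (K w) + (exp (K w) * b1 w) * wronskian f w) (at w)"
      by (rule DERIV_mult[OF W'[OF w] DERIV_fun_exp[OF K[OF w]]])
    then show "((\<lambda>w. wronskian f w * exp (K w)) has_field_derivative 0) (at w within ball z d)"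
      by (simp add: algebra_simps has_field_derivative_at_within)
  qed
  then obtain k where k: "\<And>w. w \<in> ball z d \<Longrightarrow> wronskian f w * exp (K w) = k" by blast
  have "k \<noteq> 0"
  proof
    assume "k = 0"
    then have "wronskian f w = 0" if "w \<in> ball z d" for w using k[OF that] by simp
    then show False using wronskian_zero_imp_dependent[OF hol d(1)] ind by blast
  qed
  then have "wronskian f w \<noteq> 0" if "w \<in> ball z d" for w using k[OF that] by auto
  then have "fundamental_on b1 b2 (ball z d) f" using D1 D2 by (simp add: fundamental_on_def)
  then show ?thesis using that d by blast
qed

section \<open>Path connectedness\<close>

lemma path_chart_linepath: "path (chart p \<circ> linepath s t)"
  by (intro path_continuous_image continuous_on_chart) simp

text \<open>From \<open>p\<close>, possibly infinity, a short radial path in its own chart leads to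
  a finite point; finite points are joined in the plane minus finitely many points.\<close>

lemma path_connected_punctured_sphere:
  assumes "finite D"
  shows "path_connected (- D :: cp1 set)"
proof -
  have fin: "\<exists>w g. Fin w \<notin> D \<and> path g \<and> path_image g \<subseteq> - D \<and> pathstart g = p \<and> pathfinish g = Fin w"
    if p: "p \<notin> D" for p
  proof -
    obtain R where R: "R > 0" "\<And>t. t \<in> ball 0 R - {0} \<Longrightarrow> chart p t \<notin> D"
      using punctured_chart_ball[OF assms, of p] by blast
    have in_D: "chart p t \<notin> D" if "t \<in> ball 0 R" for t
      using R(2)[of t] that p by (cases "t = 0") auto
    define t :: complex where "t = of_real (R / 2)"
    have t: "t \<noteq> 0" "t \<in> ball 0 R" using R(1) by (auto simp: t_def)
    have "closed_segment 0 t \<subseteq> ball 0 R"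
      using t R(1) by (intro closed_segment_subset) auto
    then have "path_image (chart p \<circ> linepath 0 t) \<subseteq> - D"
      using in_D by (auto simp: path_image_compose)
    then show ?thesis
      using t in_D[OF t(2)] chart_eq_Fin[OF t(1), of p]
      by (intro exI[of _ "finite_coord p t"] exI[of _ "chart p \<circ> linepath 0 t"])
        (auto simp: path_chart_linepath pathstart_compose pathfinish_compose)
  qed
  show ?thesis
    unfolding path_connected_def
  proof (intro ballI)
    fix p q assume "p \<in> - D" "q \<in> - D"
    obtain v g where g: "Fin v \<notin> D" "path g" "path_image g \<subseteq> - D" "pathstart g = p" "pathfinish g = Fin v"
      using fin[of p] \<open>p \<in> - D\<close> by auto
    obtain w h where h: "Fin w \<notin> D" "path h" "path_image h \<subseteq> - D" "pathstart h = q" "pathfinish h = Fin w"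
      using fin[of q] \<open>q \<in> - D\<close> by auto
    have "finite (Fin -` D)" using assms by (intro finite_vimageI) (auto simp: inj_def)
    then have "path_connected (- (Fin -` D))"
      by (intro path_connected_complement_countable) (auto simp: countable_finite)
    then obtain m where m: "path m" "path_image m \<subseteq> - (Fin -` D)" "pathstart m = v" "pathfinish m = w"
      unfolding path_connected_def using g(1) h(1) by (metis ComplI vimageD)
    have "path (Fin \<circ> m)" using m(1) by (intro path_continuous_image continuous_on_Fin)
    then have "path (g +++ (Fin \<circ> m) +++ reversepath h)"
      using g h m by (simp add: pathstart_compose pathfinish_compose)
    moreover have "path_image (g +++ (Fin \<circ> m) +++ reversepath h) \<subseteq> - D"
      using g h m by (intro subset_path_image_join) (auto simp: path_image_compose)
    ultimately show "\<exists>k. path k \<and> path_image k \<subseteq> - D \<and> pathstart k = p \<and> pathfinish k = q"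
      using g h by (intro exI[of _ "g +++ (Fin \<circ> m) +++ reversepath h"]) auto
  qed
qed

section \<open>Equations with diagonal monodromy\<close>

lemma vector_diag2 [simp]:
  "((y::complex^2) v* diag2 a b) $ 1 = a * y $ 1" "(y v* diag2 a b) $ 2 = b * y $ 2"
  by (simp_all add: vector_matrix_mult_2 diag2_def)

text \<open>The three numerators and the Wronskian are all multiplied by \<open>a * b\<close>. This
  is where diagonality of the monodromy enters.\<close>

lemma sym_diag2_invariant:
  assumes f: "\<And>j. analytic_at_cp1 (\<lambda>q. f q $ j) (Fin z)"
    and g: "\<forall>\<^sub>F q in nhds (Fin z). g q = f q v* diag2 a b" and nz: "a \<noteq> 0" "b \<noteq> 0"
  shows "sym_A g z = sym_A f z" "sym_B g z = sym_B f z" "sym_C g z = sym_C f z"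
proof -
  have ev: "\<forall>\<^sub>F w in nhds z. g (Fin w) = f (Fin w) v* diag2 a b"
    using g by (simp add: eventually_nhds_Fin)
  have gz: "g (Fin z) = f (Fin z) v* diag2 a b" using eventually_nhds_x_imp_x[OF ev] .
  have diff: "(\<lambda>w. f (Fin w) $ j) field_differentiable at z" for j
    using f[of j] unfolding analytic_at_Fin by (simp add: analytic_on_imp_differentiable_at)
  have d1: "deriv (comp1 g) z = a * deriv (comp1 f) z"
  proof -
    have "deriv (comp1 g) z = deriv (\<lambda>w. a * comp1 f w) z"
      by (rule deriv_cong_ev[OF _ refl]) (use ev in \<open>auto elim: eventually_mono\<close>)
    then show ?thesis using diff by simp
  qed
  have d2: "deriv (comp2 g) z = b * deriv (comp2 f) z"
  proof -
    have "deriv (comp2 g) z = deriv (\<lambda>w. b * comp2 f w) z"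
      by (rule deriv_cong_ev[OF _ refl]) (use ev in \<open>auto elim: eventually_mono\<close>)
    then show ?thesis using diff by simp
  qed
  have w: "wronskian g z = (a * b) * wronskian f z"
    unfolding wronskian_def d1 d2 gz by (simp add: algebra_simps)
  have cancel: "(a * b) * u / ((a * b) * v) = u / v" for u v using nz by simp
  show "sym_A g z = sym_A f z"
    unfolding sym_A_def w gz cancel[symmetric, of _ "wronskian f z"] by (simp add: mult_ac)
  show "sym_B g z = sym_B f z"
    unfolding sym_B_def w gz d1 d2 cancel[symmetric, of _ "wronskian f z"] by (simp add: algebra_simps)
  show "sym_C g z = sym_C f z"
    unfolding sym_C_def w d1 d2 cancel[symmetric, of _ "wronskian f z"] by (simp add: mult_ac)
qed

text \<open>The data after passing to the diagonalizing basis; \<open>\<chi>1\<close> and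
  \<open>\<chi>2\<close> are the diagonal entries as functions of homotopy classes. Existence of a
  continuation along every loop is part of \<open>monodromy\<close>.\<close>

locale diagonal_monodromy =
  fixes D :: "cp1 set" and x :: cp1 and b1 b2 :: "complex \<Rightarrow> complex"
    and Z :: "cp1 \<Rightarrow> complex^2" and \<chi>1 \<chi>2 :: "(real \<Rightarrow> cp1) set \<Rightarrow> complex"
  assumes finite_D: "finite D" and x_notin: "x \<notin> D" and riem: "riemann_equation D b1 b2"
    and Z_solution: "\<And>j. solution_near b1 b2 x (\<lambda>q. Z q $ j)"
    and Z_independent: "independent_near x Z"
    and monodromy: "\<And>\<gamma>. is_loop (- D) x \<gamma> \<Longrightarrow>
       \<exists>F. germ_family \<gamma> F \<and> (\<forall>\<^sub>F q in nhds x. F 0 q = Z q) \<and>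
         (\<forall>\<^sub>F q in nhds x. Z q = F 1 q v* diag2 (\<chi>1 (path_class (- D) \<gamma>)) (\<chi>2 (path_class (- D) \<gamma>)))"
    and \<chi>_nonzero: "\<And>\<gamma>. is_loop (- D) x \<gamma> \<Longrightarrow>
       \<chi>1 (path_class (- D) \<gamma>) \<noteq> 0 \<and> \<chi>2 (path_class (- D) \<gamma>) \<noteq> 0"
begin

section \<open>Continuation of the basis along paths with free end point\<close>

definition lifts :: "(real \<Rightarrow> cp1) \<Rightarrow> (real \<Rightarrow> cp1 \<Rightarrow> complex^2) \<Rightarrow> bool" where
  "lifts d F \<longleftrightarrow> path d \<and> path_image d \<subseteq> - D \<and> pathstart d = x \<and> germ_family d F \<and>
     (\<forall>\<^sub>F q in nhds x. F 0 q = Z q)"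

lemma lifts_first_half:
  assumes "lifts (d +++ c) F" "path d" "path c" "pathfinish d = pathstart c"
  shows "lifts d (\<lambda>s. F (s / 2))"
proof -
  have "germ_family d (F \<circ> (\<lambda>s. s / 2))"
    by (rule germ_family_compose[of "d +++ c"])
      (use assms in \<open>auto simp: lifts_def joinpaths_def intro!: continuous_intros\<close>)
  then show ?thesis using assms by (auto simp: lifts_def o_def path_image_join)
qed

lemma germ_family_second_half:
  assumes "germ_family (d +++ c) F" "pathfinish d = pathstart c"
  shows "germ_family c (\<lambda>s. F ((1 + s) / 2))"
proof -
  have "germ_family c (F \<circ> (\<lambda>s. (1 + s) / 2))"
  proof (rule germ_family_compose[OF assms(1)])
    fix s :: real assume "s \<in> {0..1}"
    then show "c s = (d +++ c) ((1 + s) / 2)"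
      using assms(2) by (cases "s = 0") (auto simp: joinpaths_def pathstart_def pathfinish_def add_divide_distrib)
  qed (auto intro!: continuous_intros)
  then show ?thesis by (simp add: o_def)
qed

lemma lifts_unique:
  assumes "lifts d F" "lifts d G"
  shows "\<forall>\<^sub>F q in nhds (pathfinish d). F 1 q = G 1 q"
proof -
  have "\<forall>\<^sub>F q in nhds x. F 0 q = Z q" "\<forall>\<^sub>F q in nhds x. G 0 q = Z q"
    using assms by (auto simp: lifts_def)
  then have "\<forall>\<^sub>F q in nhds x. F 0 q = G 0 q" by eventually_elim simp
  then show ?thesis
    using germ_family_unique[of d F G] assms by (simp add: lifts_def pathfinish_def pathstart_def)
qed

text \<open>The loop out and back along \<open>d\<close> has a continuation by hypothesis; its first
  half is a continuation along \<open>d\<close>.\<close>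

lemma lifts_exists:
  assumes "path d" "path_image d \<subseteq> - D" "pathstart d = x"
  obtains F where "lifts d F"
proof -
  have loop: "is_loop (- D) x (d +++ reversepath d)"
    using assms by (auto simp: is_loop_def path_image_join)
  obtain F where "germ_family (d +++ reversepath d) F" "\<forall>\<^sub>F q in nhds x. F 0 q = Z q"
    using monodromy[OF loop] by blast
  then have "lifts (d +++ reversepath d) F" using loop by (auto simp: lifts_def is_loop_def)
  then show ?thesis using lifts_first_half[of d "reversepath d" F] assms that by auto
qed

text \<open>A continuation \<open>H\<close> along the loop passes the end of \<open>d\<close> at
  time \<open>1 / 2\<close>, where it agrees with \<open>F 1\<close>. Run backwards from its end and
  multiplied by the monodromy matrix, it starts as \<open>Z\<close> and so continues
  \<open>Z\<close> along \<open>d'\<close>.\<close>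

lemma lifts_compare:
  assumes F: "lifts d F" and G: "lifts d' G" and eq: "pathfinish d = pathfinish d'"
  shows "is_loop (- D) x (d +++ reversepath d')"
    and "\<forall>\<^sub>F q in nhds (pathfinish d). G 1 q = F 1 q v* diag2
      (\<chi>1 (path_class (- D) (d +++ reversepath d'))) (\<chi>2 (path_class (- D) (d +++ reversepath d')))"
proof -
  let ?l = "d +++ reversepath d'"
  show loop: "is_loop (- D) x ?l"
    using F G eq by (auto simp: is_loop_def lifts_def path_image_join)
  let ?X = "diag2 (\<chi>1 (path_class (- D) ?l)) (\<chi>2 (path_class (- D) ?l))"
  obtain H where H: "germ_family ?l H" "\<forall>\<^sub>F q in nhds x. H 0 q = Z q"
    "\<forall>\<^sub>F q in nhds x. Z q = H 1 q v* ?X"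
    using monodromy[OF loop] by blast
  have "lifts ?l H" using loop H by (auto simp: lifts_def is_loop_def)
  then have "lifts d (\<lambda>s. H (s / 2))"
    by (rule lifts_first_half) (use F G eq in \<open>auto simp: lifts_def\<close>)
  from lifts_unique[OF F this] have 1: "\<forall>\<^sub>F q in nhds (pathfinish d). F 1 q = H (1 / 2) q" by simp
  have "germ_family d' (H \<circ> (\<lambda>s. 1 - s / 2))"
  proof (rule germ_family_compose[OF H(1)])
    fix s :: real assume "s \<in> {0..1}"
    then show "d' s = ?l (1 - s / 2)"
      using eq by (cases "s = 1") (auto simp: joinpaths_def reversepath_def pathfinish_def)
  qed (auto intro!: continuous_intros)
  then have "germ_family d' (\<lambda>s q. H (1 - s / 2) q v* ?X)"
    using germ_family_matrix by (fastforce simp: o_def)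
  moreover have "\<forall>\<^sub>F q in nhds x. H 1 q v* ?X = Z q" using H(3) by (elim eventually_mono) simp
  ultimately have "lifts d' (\<lambda>s q. H (1 - s / 2) q v* ?X)" using G by (simp add: lifts_def)
  from lifts_unique[OF G this] have "\<forall>\<^sub>F q in nhds (pathfinish d). G 1 q = H (1 / 2) q v* ?X"
    using eq by simp
  with 1 show "\<forall>\<^sub>F q in nhds (pathfinish d). G 1 q = F 1 q v* ?X" by eventually_elim simp
qed

lemma coefficients_holomorphic:
  "b1 holomorphic_on {w. Fin w \<notin> D}" "b2 holomorphic_on {w. Fin w \<notin> D}"
  using riem by (auto simp: riemann_equation_def)

text \<open>By permanence: off \<open>D\<close>, satisfying the equation and being independent are
  locally constant properties of germs.\<close>

lemma lifts_solution:
  assumes "lifts d F"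
  shows "analytic_at_cp1 (\<lambda>q. F 1 q $ j) (pathfinish d)"
    and "ode_near b1 b2 (pathfinish d) (\<lambda>q. F 1 q $ j)"
    and "independent_near (pathfinish d) (F 1)"
proof -
  have F: "germ_family d F" "path d" "path_image d \<subseteq> - D" "d 0 = x" "\<forall>\<^sub>F q in nhds x. F 0 q = Z q"
    using assms by (auto simp: lifts_def pathstart_def)
  show "analytic_at_cp1 (\<lambda>q. F 1 q $ j) (pathfinish d)"
    using F(1) by (simp add: germ_family_def pathfinish_def)
  let ?P = "\<lambda>p f. (\<forall>j. ode_near b1 b2 p (\<lambda>q. f q $ j)) \<and> independent_near p f"
  have cong: "?P p f = ?P p g" if "\<forall>\<^sub>F q in nhds p. f q = g q" for p and f g :: "cp1 \<Rightarrow> complex^2"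
  proof -
    have "ode_near b1 b2 p (\<lambda>q. f q $ j) = ode_near b1 b2 p (\<lambda>q. g q $ j)" for j
      by (rule ode_near_cong) (use that in \<open>auto elim: eventually_mono\<close>)
    then show ?thesis using independent_near_cong[OF that] by simp
  qed
  have "?P (d 0) (F 0) = ?P (d 1) (F 1)"
  proof (rule germ_family_invariant[OF F(1,2)])
    fix s :: real and f :: "cp1 \<Rightarrow> complex^2"
    assume s: "s \<in> {0..1}" and f: "\<And>j. analytic_at_cp1 (\<lambda>q. f q $ j) (d s)"
    have "d s \<notin> D" using F(3) s unfolding path_image_def by blast
    then have "\<forall>\<^sub>F q in nhds (d s). \<forall>j. ode_near b1 b2 q (\<lambda>q. f q $ j) = ode_near b1 b2 (d s) (\<lambda>q. f q $ j)"
      by (intro eventually_all_finite ode_near_locally_constant[OF finite_D _ coefficients_holomorphic f])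
    moreover have "\<forall>\<^sub>F q in nhds (d s). independent_near q f = independent_near (d s) f"
      by (rule independent_near_locally_constant[OF f])
    ultimately show "\<forall>\<^sub>F q in nhds (d s). ?P q f = ?P (d s) f" by eventually_elim simp
  qed (rule cong)
  moreover have "?P x Z" using Z_solution Z_independent by (simp add: solution_near_iff)
  ultimately have "?P (d 1) (F 1)" using cong[OF F(5)] F(4) by simp
  then show "ode_near b1 b2 (pathfinish d) (\<lambda>q. F 1 q $ j)" "independent_near (pathfinish d) (F 1)"
    by (auto simp: pathfinish_def)
qed

text \<open>The branches at \<open>p\<close> of the multivalued vector \<open>Z\<close>. The path is
  hidden, since by \<open>reaches_unique\<close> branches differ only by nonzero diagonal
  factors.\<close>

definition reaches :: "cp1 \<Rightarrow> (cp1 \<Rightarrow> complex^2) \<Rightarrow> bool" where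
  "reaches p f \<longleftrightarrow> (\<exists>d F. lifts d F \<and> pathfinish d = p \<and> (\<forall>\<^sub>F q in nhds p. F 1 q = f q))"

lemma reaches_notin: "reaches p f \<Longrightarrow> p \<notin> D"
  using pathfinish_in_path_image by (fastforce simp: reaches_def lifts_def)

lemma reaches_exists:
  assumes "p \<notin> D"
  shows "\<exists>f. reaches p f"
proof -
  obtain d where d: "path d" "path_image d \<subseteq> - D" "pathstart d = x" "pathfinish d = p"
    using path_connected_punctured_sphere[OF finite_D] x_notin assms unfolding path_connected_def by blast
  obtain F where "lifts d F" using lifts_exists[OF d(1-3)] .
  then have "reaches p (F 1)" using d(4) unfolding reaches_def by (intro exI[of _ d] exI[of _ F]) simp
  then show ?thesis by blast
qed

lemma reaches_solution:
  assumes "reaches p f"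
  shows "analytic_at_cp1 (\<lambda>q. f q $ j) p" "ode_near b1 b2 p (\<lambda>q. f q $ j)" "independent_near p f"
proof -
  obtain d F where F: "lifts d F" "pathfinish d = p" "\<forall>\<^sub>F q in nhds p. F 1 q = f q"
    using assms by (auto simp: reaches_def)
  have ev: "\<forall>\<^sub>F q in nhds p. F 1 q $ j = f q $ j" using F(3) by (rule eventually_mono) simp
  show "analytic_at_cp1 (\<lambda>q. f q $ j) p" "ode_near b1 b2 p (\<lambda>q. f q $ j)" "independent_near p f"
    using lifts_solution[OF F(1)] F(2) analytic_at_cp1_cong[OF ev] ode_near_cong[OF ev]
      independent_near_cong[OF F(3)] by auto
qed

lemma reaches_unique:
  assumes "reaches p f" "reaches p g"
  obtains a b where "a \<noteq> 0" "b \<noteq> 0" "\<forall>\<^sub>F q in nhds p. g q = f q v* diag2 a b"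
proof -
  obtain d F where F: "lifts d F" "pathfinish d = p" "\<forall>\<^sub>F q in nhds p. F 1 q = f q"
    using assms(1) by (auto simp: reaches_def)
  obtain d' G where G: "lifts d' G" "pathfinish d' = p" "\<forall>\<^sub>F q in nhds p. G 1 q = g q"
    using assms(2) by (auto simp: reaches_def)
  have eq: "pathfinish d = pathfinish d'" using F G by simp
  note loop = lifts_compare(1)[OF F(1) G(1) eq]
  have "\<forall>\<^sub>F q in nhds p. G 1 q = F 1 q v* diag2
      (\<chi>1 (path_class (- D) (d +++ reversepath d'))) (\<chi>2 (path_class (- D) (d +++ reversepath d')))"
    using lifts_compare(2)[OF F(1) G(1) eq] F(2) by simp
  with F(3) G(3) have "\<forall>\<^sub>F q in nhds p. g q = f q v* diag2
      (\<chi>1 (path_class (- D) (d +++ reversepath d'))) (\<chi>2 (path_class (- D) (d +++ reversepath d')))"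
    by eventually_elim simp
  then show ?thesis using that \<chi>_nonzero[OF loop] by blast
qed

text \<open>The path is prolonged by a radius of a small disc; by uniqueness the continuation along
  it is the constant family \<open>f\<close>.\<close>

lemma reaches_near:
  assumes "reaches p f"
  shows "\<forall>\<^sub>F q in nhds p. reaches q f"
proof -
  obtain d F where F: "lifts d F" "pathfinish d = p" "\<forall>\<^sub>F q in nhds p. F 1 q = f q"
    using assms by (auto simp: reaches_def)
  have d: "path d" "path_image d \<subseteq> - D" "pathstart d = x" using F by (auto simp: lifts_def)
  obtain e1 where e1: "e1 > 0" "\<And>j. (\<lambda>t. f (chart p t) $ j) holomorphic_on ball 0 e1"
    using analytic_at_cp1_ball_vec[of f p] reaches_solution(1)[OF assms] by blast
  obtain e2 where e2: "e2 > 0" "\<And>t. t \<in> ball 0 e2 - {0} \<Longrightarrow> chart p t \<notin> D"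
    using punctured_chart_ball[OF finite_D, of p] by blast
  have inD: "chart p t \<notin> D" if "t \<in> ball 0 e2" for t
    using e2(2)[of t] that reaches_notin[OF assms] by (cases "t = 0") auto
  define e where "e = min e1 e2"
  have e: "e > 0" using e1 e2 by (simp add: e_def)
  show ?thesis
  proof (rule eventually_chart_ball[OF e])
    fix t :: complex assume t: "t \<in> ball 0 e"
    let ?c = "chart p \<circ> linepath 0 t"
    have seg: "closed_segment 0 t \<subseteq> ball 0 e"
      using t e by (intro closed_segment_subset) auto
    have c: "path ?c" "path_image ?c \<subseteq> - D" "pathstart ?c = p" "pathfinish ?c = chart p t"
      using seg inD by (auto simp: path_chart_linepath path_image_compose pathstart_compose pathfinish_compose e_def subset_iff)
    have dc: "path (d +++ ?c)" "path_image (d +++ ?c) \<subseteq> - D" "pathstart (d +++ ?c) = x"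
      using d c F(2) by (auto simp: path_image_join)
    obtain G where G: "lifts (d +++ ?c) G" using lifts_exists[OF dc] .
    have "lifts d (\<lambda>s. G (s / 2))" using lifts_first_half[OF G d(1) c(1)] F(2) c(3) by simp
    from lifts_unique[OF F(1) this] have "\<forall>\<^sub>F q in nhds p. F 1 q = G (1 / 2) q" using F(2) by simp
    with F(3) have half: "\<forall>\<^sub>F q in nhds p. G (1 / 2) q = f q" by eventually_elim simp
    have "germ_family (d +++ ?c) G" using G by (simp only: lifts_def)
    then have "germ_family ?c (\<lambda>s. G ((1 + s) / 2))"
      by (rule germ_family_second_half) (simp only: F(2) c(3))
    moreover have "germ_family ?c (\<lambda>_. f)"
    proof (rule germ_family_const)
      fix s :: real and j :: 2 assume s: "s \<in> {0..1}"
      then have "linepath 0 t s \<in> ball 0 e" using seg linepath_in_path by blast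
      then have "linepath 0 t s \<in> ball 0 e1" by (simp add: e_def)
      moreover have "(\<lambda>t. f (chart p t) $ j) analytic_on ball 0 e1" using e1 by (simp add: analytic_on_open)
      ultimately show "analytic_at_cp1 (\<lambda>q. f q $ j) (?c s)"
        unfolding o_def analytic_at_chart by (auto intro: analytic_on_subset)
    qed
    ultimately have "\<forall>\<^sub>F q in nhds (?c 1). G ((1 + 1) / 2) q = f q"
      by (rule germ_family_unique) (use half c(1,3) in \<open>simp_all add: pathstart_def\<close>)
    then have "\<forall>\<^sub>F q in nhds (chart p t). G 1 q = f q" using c(4) by (simp add: pathfinish_def)
    then show "reaches (chart p t) f"
      unfolding reaches_def using G c(4) by (intro exI[of _ "d +++ ?c"] exI[of _ G]) auto
  qed
qed

text \<open>An arbitrary branch at each point, chosen without regard to the neighbouring points;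
  \<open>sym_eq_of_reaches\<close> shows that the functions formed from it do not depend on the
  choice.\<close>

definition germ_at :: "complex \<Rightarrow> cp1 \<Rightarrow> complex^2" where
  "germ_at z = (SOME f. reaches (Fin z) f)"

section \<open>The globally defined symmetric square functions\<close>

abbreviation "A z \<equiv> sym_A (germ_at z) z"
abbreviation "B z \<equiv> sym_B (germ_at z) z"
abbreviation "C z \<equiv> sym_C (germ_at z) z"

lemma sym_eq_of_reaches:
  assumes "reaches (Fin z) f"
  shows "A z = sym_A f z" "B z = sym_B f z" "C z = sym_C f z"
proof -
  have "reaches (Fin z) (germ_at z)" unfolding germ_at_def using someI[of "reaches (Fin z)" f] assms by simp
  then obtain a b where "a \<noteq> 0" "b \<noteq> 0" "\<forall>\<^sub>F q in nhds (Fin z). germ_at z q = f q v* diag2 a b"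
    using reaches_unique[OF assms] by blast
  then show "A z = sym_A f z" "B z = sym_B f z" "C z = sym_C f z"
    using sym_diag2_invariant[OF reaches_solution(1)[OF assms]] by blast+
qed

lemma reaches_fundamental:
  assumes "reaches (Fin z) f"
  obtains d where "d > 0" "ball z d \<subseteq> {w. Fin w \<notin> D}" "fundamental_on b1 b2 (ball z d) f"
    "\<And>w. w \<in> ball z d \<Longrightarrow> reaches (Fin w) f"
proof -
  obtain d1 where d1: "d1 > 0" "ball z d1 \<subseteq> {w. Fin w \<notin> D}" "fundamental_on b1 b2 (ball z d1) f"
    using fundamental_on_ball[OF finite_D reaches_notin[OF assms] coefficients_holomorphic
        reaches_solution[OF assms]] by blast
  have "\<forall>\<^sub>F w in nhds z. reaches (Fin w) f"
    using reaches_near[OF assms] by (simp add: eventually_nhds_Fin)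
  then obtain d2 where d2: "d2 > 0" "\<And>w. dist w z < d2 \<Longrightarrow> reaches (Fin w) f"
    unfolding eventually_nhds_metric by blast
  show ?thesis
  proof (rule that[of "min d1 d2"])
    show "fundamental_on b1 b2 (ball z (min d1 d2)) f" using d1(3) by (simp add: fundamental_on_def)
  qed (use d1 d2 in \<open>auto simp: dist_commute subset_iff\<close>)
qed

text \<open>Near \<open>z\<close> one branch \<open>f\<close> serves all points, so
  \<open>A\<close>, \<open>B\<close>, \<open>C\<close> agree there with the functions formed from
  \<open>f\<close> and inherit their system.\<close>

lemma symmetric_square_global: "symmetric_square_system {z. Fin z \<notin> D} b1 b2 A B C"
  unfolding symmetric_square_system_def
proof (intro ballI)
  fix z assume "z \<in> {z. Fin z \<notin> D}"
  then obtain f where f: "reaches (Fin z) f" using reaches_exists by blast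
  obtain d where d: "d > 0" "fundamental_on b1 b2 (ball z d) f" "\<And>w. w \<in> ball z d \<Longrightarrow> reaches (Fin w) f"
    using reaches_fundamental[OF f] by metis
  have sys: "symmetric_square_system (ball z d) b1 b2 (sym_A f) (sym_B f) (sym_C f)"
    by (rule symmetric_square_of_fundamental[OF d(2)])
  have ev: "\<forall>\<^sub>F w in nhds z. w \<in> ball z d" using d(1) by (intro eventually_nhds_in_open) auto
  have "\<forall>\<^sub>F w in nhds z. sym_A f w = A w" "\<forall>\<^sub>F w in nhds z. sym_B f w = B w"
    "\<forall>\<^sub>F w in nhds z. sym_C f w = C w"
    using ev by (auto elim!: eventually_mono simp: sym_eq_of_reaches[OF d(3)])
  note cong = this[THEN DERIV_cong_ev[OF refl, OF _ refl]]
  show "(A has_field_derivative B z + b1 z * A z) (at z) \<and>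
      (B has_field_derivative 2 * C z - 2 * b2 z * A z) (at z) \<and>
      (C has_field_derivative - b1 z * C z - b2 z * B z) (at z)"
    using sys d(1) unfolding symmetric_square_system_def sym_eq_of_reaches[OF f] cong[symmetric] by simp
qed

lemma discriminant_global:
  assumes "Fin z \<notin> D"
  shows "(B z)\<^sup>2 - 4 * A z * C z = 1"
proof -
  obtain f where f: "reaches (Fin z) f" using reaches_exists[OF assms] by blast
  obtain d where "d > 0" "fundamental_on b1 b2 (ball z d) f" using reaches_fundamental[OF f] by metis
  then have "wronskian f z \<noteq> 0" by (simp add: fundamental_on_def)
  then show ?thesis unfolding sym_eq_of_reaches[OF f] by (rule sym_discriminant)
qed

text \<open>If all three singular points were zeros of the field, \<open>A\<close> would vanish
  identically, then \<open>B = 0\<close> by the first equation of the system, against the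
  discriminant 1.\<close>

lemma exists_primitive:
  assumes "card D = 3"
  shows "\<exists>p\<in>D. \<exists>e>0. \<exists>K. \<forall>t\<in>ball 0 e - {0}. chart p t \<notin> D \<and> field_in_chart A p t \<noteq> 0 \<and>
       (K has_field_derivative 1 / field_in_chart A p t) (at t)"
proof (rule ccontr)
  assume "\<not> ?thesis"
  then have zero: "(field_in_chart A p \<longlongrightarrow> 0) (at 0)" if "p \<in> D" for p
    using field_zero_or_primitive[OF finite_D riem that symmetric_square_global] that by blast
  have A0: "A z = 0" if "Fin z \<notin> D" for z
    by (rule field_vanishing_at_three_points[OF finite_D assms riem symmetric_square_global zero that])
  have "infinite (UNIV :: complex set)" by (rule infinite_UNIV_char_0)
  moreover have "finite (Fin -` D)" using finite_D by (intro finite_vimageI) (auto simp: inj_def)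
  ultimately obtain z where z: "Fin z \<notin> D" by (metis UNIV_eq_I vimageI)
  have "\<forall>\<^sub>F w in nhds z. A w = 0"
    by (rule eventually_mono[OF eventually_nhds_in_open[OF open_finite_part[OF finite_D]]]) (use z A0 in auto)
  then have "(A has_field_derivative 0) (at z)"
    using DERIV_cong_ev[OF refl, of A "\<lambda>_. 0"] by simp
  moreover have "(A has_field_derivative B z + b1 z * A z) (at z)"
    using symmetric_square_global z by (simp add: symmetric_square_system_def)
  ultimately have "B z = 0" using DERIV_unique A0[OF z] by fastforce
  then show False using discriminant_global[OF z] A0[OF z] by simp
qed

end

text \<open>The radius in \<open>loop_around\<close> is arbitrary, but a primitive is available only
  on a small disc. In the logarithmic coordinate the punctured disc becomes the half plane
  \<open>Re w \<le> ln r\<close>, which is simply connected, and the circle becomes a vertical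
  segment of length \<open>2 pi\<close>; pushing it to the left shrinks the circle.\<close>

lemma loop_shrink:
  assumes d: "path d" "path_image d \<subseteq> S" "pathfinish d = chart p (of_real r)"
    and r: "0 < r'" "r' \<le> r" "chart p ` (cball 0 r - {0}) \<subseteq> S"
  defines "a \<equiv> complex_of_real (ln r)" and "b \<equiv> complex_of_real (ln r')"
  defines "L \<equiv> (chart p \<circ> exp) \<circ> linepath a b"
    and "c \<equiv> (chart p \<circ> exp) \<circ> linepath b (b + 2 * of_real pi * \<i>)"
  shows "path L" "path_image L \<subseteq> S" "pathstart L = pathfinish d" "pathfinish L = chart p (of_real r')"
    and "path c" "path_image c \<subseteq> S" "pathstart c = chart p (of_real r')" "pathfinish c = chart p (of_real r')"
    and "\<And>s. s \<in> {0..1} \<Longrightarrow> \<exists>t. norm t = r' \<and> c s = chart p t"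
    and "homotopic_paths S (d +++ (chart p \<circ> circlepath 0 r) +++ reversepath d)
           (((d +++ L) +++ c) +++ reversepath (d +++ L))"
proof -
  have r0: "r > 0" using r by simp
  let ?h = "chart p \<circ> exp"
  let ?H = "{w::complex. Re w \<le> ln r}"
  let ?a' = "a + 2 * of_real pi * \<i>" and ?b' = "b + 2 * of_real pi * \<i>"
  have ends: "exp a = of_real r" "exp b = of_real r'" "exp ?a' = of_real r" "exp ?b' = of_real r'"
    using r r0 by (auto simp: a_def b_def exp_add exp_of_real)
  have cvx: "convex ?H" by (rule convex_halfspace_Re_le)
  have inH: "a \<in> ?H" "b \<in> ?H" "?a' \<in> ?H" "?b' \<in> ?H"
    using r r0 by (auto simp: a_def b_def)
  have h_cont: "continuous_on A ?h" for A
    by (intro continuous_on_compose continuous_on_chart continuous_intros)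
  have h_in: "?h w \<in> S" if "w \<in> ?H" for w
  proof -
    have "norm (exp w) \<le> r" using that r0 by (simp add: exp_le_cancel_iff ln_ge_iff)
    then show ?thesis using r(3) by auto
  qed
  have seg: "path_image (linepath u v) \<subseteq> ?H" if "u \<in> ?H" "v \<in> ?H" for u v
    using closed_segment_subset[OF that cvx] by simp
  have h_path: "path (?h \<circ> linepath u v)" "path_image (?h \<circ> linepath u v) \<subseteq> S" if "u \<in> ?H" "v \<in> ?H" for u v
  proof -
    show "path (?h \<circ> linepath u v)" by (rule path_continuous_image[OF path_linepath h_cont])
    show "path_image (?h \<circ> linepath u v) \<subseteq> S"
      unfolding path_image_compose using seg[OF that] h_in by blast
  qed
  show L: "path L" "path_image L \<subseteq> S" "pathstart L = pathfinish d" "pathfinish L = chart p (of_real r')"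
    using h_path[OF inH(1,2)] ends d(3) by (auto simp: L_def pathstart_compose pathfinish_compose)
  show c: "path c" "path_image c \<subseteq> S" "pathstart c = chart p (of_real r')" "pathfinish c = chart p (of_real r')"
    using h_path[OF inH(2,4)] ends by (auto simp: c_def pathstart_compose pathfinish_compose)
  show "\<exists>t. norm t = r' \<and> c s = chart p t" if "s \<in> {0..1}" for s
  proof (intro exI conjI)
    have "Re (linepath b ?b' s) = ln r'" by (simp add: linepath_def b_def algebra_simps)
    then show "norm (exp (linepath b ?b' s)) = r'" using r by simp
  qed (simp add: c_def)
  let ?q = "(linepath a b +++ linepath b ?b') +++ linepath ?b' ?a'"
  have "simply_connected ?H" by (rule convex_imp_simply_connected[OF cvx])
  moreover have "path_image (linepath a ?a') \<subseteq> ?H" using seg inH by blast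
  moreover have "path_image ?q \<subseteq> ?H" using seg inH by (intro subset_path_image_join) blast+
  ultimately have "homotopic_paths ?H (linepath a ?a') ?q"
    unfolding simply_connected_eq_homotopic_paths by simp
  then have hom: "homotopic_paths S (?h \<circ> linepath a ?a') (?h \<circ> ?q)"
    by (rule homotopic_paths_continuous_image[OF _ h_cont]) (use h_in in blast)
  have circ: "?h \<circ> linepath a ?a' = chart p \<circ> circlepath 0 r"
  proof
    fix s
    have "linepath a ?a' s = a + 2 * of_real pi * \<i> * of_real s"
      by (simp add: linepath_def algebra_simps scaleR_conv_of_real)
    then have "exp (linepath a ?a' s) = circlepath 0 r s"
      using ends by (simp add: exp_add circlepath algebra_simps)
    then show "(?h \<circ> linepath a ?a') s = (chart p \<circ> circlepath 0 r) s" by simp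
  qed
  \<comment> \<open>The last edge is the first one shifted by the period of \<open>exp\<close> and
    reversed, hence the reversed path on the sphere.\<close>
  have revL: "?h \<circ> linepath ?b' ?a' = reversepath L"
  proof
    fix s
    have "linepath ?b' ?a' s = linepath a b (1 - s) + 2 * of_real pi * \<i>"
      by (simp add: linepath_def algebra_simps scaleR_conv_of_real)
    then have "exp (linepath ?b' ?a' s) = exp (linepath a b (1 - s))"
      by (simp add: exp_add)
    then show "(?h \<circ> linepath ?b' ?a') s = reversepath L s" by (simp add: L_def reversepath_def)
  qed
  have "?h \<circ> ?q = (L +++ c) +++ reversepath L"
    using revL by (simp only: path_compose_join L_def c_def)
  with hom circ have hom: "homotopic_paths S (chart p \<circ> circlepath 0 r) ((L +++ c) +++ reversepath L)"
    by simp
  let ?C = "chart p \<circ> circlepath 0 r" and ?Lr = "reversepath L" and ?dr = "reversepath d"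
  have C: "pathstart ?C = chart p (of_real r)" "pathfinish ?C = chart p (of_real r)"
    by (simp_all add: pathstart_compose pathfinish_compose)
  have refl: "homotopic_paths S d d" "homotopic_paths S ?dr ?dr"
    using d by simp_all
  have "homotopic_paths S (d +++ (?C +++ ?dr)) (d +++ (((L +++ c) +++ ?Lr) +++ ?dr))"
    using C d by (intro homotopic_paths_join hom refl) auto
  also have "homotopic_paths S (((L +++ c) +++ ?Lr) +++ ?dr) ((L +++ c) +++ (?Lr +++ ?dr))"
    by (rule homotopic_paths_sym, rule homotopic_paths_assoc) (use L c d in \<open>auto simp: path_image_join\<close>)
  then have "homotopic_paths S (d +++ (((L +++ c) +++ ?Lr) +++ ?dr)) (d +++ ((L +++ c) +++ (?Lr +++ ?dr)))"
    by (rule homotopic_paths_join[OF refl(1)]) (use L d in simp)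
  also have "homotopic_paths S (d +++ ((L +++ c) +++ (?Lr +++ ?dr))) ((d +++ (L +++ c)) +++ (?Lr +++ ?dr))"
    by (rule homotopic_paths_assoc) (use L c d in \<open>auto simp: path_image_join\<close>)
  also have "homotopic_paths S ((d +++ (L +++ c)) +++ (?Lr +++ ?dr)) (((d +++ L) +++ c) +++ (?Lr +++ ?dr))"
  proof (rule homotopic_paths_join)
    show "homotopic_paths S (d +++ (L +++ c)) ((d +++ L) +++ c)"
      by (rule homotopic_paths_assoc) (use L c d in \<open>auto simp: path_image_join\<close>)
    show "homotopic_paths S (?Lr +++ ?dr) (?Lr +++ ?dr)"
      using L c d by (auto simp: path_image_join)
  qed (use L c d in auto)
  also have "?Lr +++ ?dr = reversepath (d +++ L)"
    using L by (simp add: reversepath_joinpaths)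
  finally show "homotopic_paths S (d +++ ?C +++ ?dr) (((d +++ L) +++ c) +++ reversepath (d +++ L))" .
qed

section \<open>Local monodromy at a point where the field does not vanish\<close>

fun inverse_coord :: "cp1 \<Rightarrow> complex \<Rightarrow> complex" where
  "inverse_coord (Fin c) w = w - c"
| "inverse_coord Infty w = 1 / w"

text \<open>The differential \<open>dz / A\<close> dual to the field does not depend on the
  coordinate, so a primitive in \<open>t\<close> is one in \<open>z\<close>.\<close>

lemma primitive_in_finite_coord:
  assumes "t \<noteq> 0" "(K has_field_derivative 1 / field_in_chart A p t) (at t)" "field_in_chart A p t \<noteq> 0"
  shows "((\<lambda>w. K (inverse_coord p w)) has_field_derivative 1 / A (finite_coord p t)) (at (finite_coord p t))"
    and "A (finite_coord p t) \<noteq> 0"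
proof -
  show "A (finite_coord p t) \<noteq> 0" using assms by (cases p) auto
  show "((\<lambda>w. K (inverse_coord p w)) has_field_derivative 1 / A (finite_coord p t)) (at (finite_coord p t))"
  proof (cases p)
    case (Fin c)
    have "((\<lambda>w. w - c) has_field_derivative 1) (at (c + t))" by (auto intro!: derivative_eq_intros)
    moreover have "(K has_field_derivative 1 / A (c + t)) (at ((c + t) - c))" using assms Fin by simp
    ultimately have "((\<lambda>w. K (w - c)) has_field_derivative 1 / A (c + t) * 1) (at (c + t))"
      by (rule DERIV_chain2[rotated])
    then show ?thesis using Fin by simp
  next
    case Infty
    have "((\<lambda>w. 1 / w) has_field_derivative - (t\<^sup>2)) (at (1 / t))"
      using assms(1) by (auto intro!: derivative_eq_intros simp: power2_eq_square)
    moreover have "(K has_field_derivative 1 / (- t\<^sup>2 * A (1 / t))) (at (1 / (1 / t)))" using assms Infty by simp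
    ultimately have "((\<lambda>w. K (1 / w)) has_field_derivative 1 / (- t\<^sup>2 * A (1 / t)) * - (t\<^sup>2)) (at (1 / t))"
      by (rule DERIV_chain2[rotated])
    then show ?thesis using Infty assms(1) by simp
  qed
qed

context diagonal_monodromy
begin

text \<open>The logarithmic derivative of \<open>y2 / y1\<close> is
  \<open>W / (y1 y2) = 1 / A\<close>, so \<open>y2 = k y1 exp \<kappa>\<close> with
  \<open>\<kappa>\<close> single valued around \<open>p\<close>. The relation survives continuation
  along the circle, while the components before and after differ by the factors
  \<open>\<chi>1\<close> and \<open>\<chi>2\<close>; hence these agree.\<close>

lemma local_monodromy_trivial:
  assumes e: "e > 0" "\<And>t. t \<in> ball 0 e - {0} \<Longrightarrow> field_in_chart A p t \<noteq> 0"
      "\<And>t. t \<in> ball 0 e - {0} \<Longrightarrow> (K has_field_derivative 1 / field_in_chart A p t) (at t)"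
    and g: "loop_around D x p g"
  shows "\<chi>1 (path_class (- D) g) = \<chi>2 (path_class (- D) g)"
proof -
  obtain d0 r where r: "0 < r" "chart p ` (cball 0 r - {0}) \<inter> D = {}"
    and d0: "path d0" "path_image d0 \<subseteq> - D" "pathstart d0 = x" "pathfinish d0 = chart p (of_real r)"
    and hom: "homotopic_paths (- D) g (d0 +++ (chart p \<circ> circlepath 0 r) +++ reversepath d0)"
    using g unfolding loop_around_def by blast
  define r' where "r' = min r (e / 2)"
  have r': "0 < r'" "r' \<le> r" "r' < e" using r e by (auto simp: r'_def)
  have sub: "chart p ` (cball 0 r - {0}) \<subseteq> - D" using r(2) by blast
  define L where "L = (chart p \<circ> exp) \<circ> linepath (complex_of_real (ln r)) (complex_of_real (ln r'))"
  define c where "c = (chart p \<circ> exp) \<circ>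
    linepath (complex_of_real (ln r')) (complex_of_real (ln r') + 2 * of_real pi * \<i>)"
  note shrink = loop_shrink[OF d0(1,2,4) r'(1,2) sub, folded L_def c_def]
  define d where "d = d0 +++ L"
  define P where "P = chart p (of_real r')"
  have d: "path d" "path_image d \<subseteq> - D" "pathstart d = x" "pathfinish d = P"
    using d0 shrink(1-4) by (auto simp: d_def P_def path_image_join)
  have c: "path c" "path_image c \<subseteq> - D" "pathstart c = P" "pathfinish c = P"
    using shrink(5-8) by (auto simp: P_def)
  have dc: "path (d +++ c)" "path_image (d +++ c) \<subseteq> - D" "pathstart (d +++ c) = x" "pathfinish (d +++ c) = P"
    using d c by (auto simp: path_image_join)
  have cls: "path_class (- D) g = path_class (- D) ((d +++ c) +++ reversepath d)"
    by (rule path_class_eqI, rule homotopic_paths_trans[OF hom]) (use shrink(10) in \<open>simp add: d_def\<close>)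
  obtain F where F: "lifts (d +++ c) F" using lifts_exists[OF dc(1-3)] .
  obtain G where G: "lifts d G" using lifts_exists[OF d(1-3)] .
  define X1 where "X1 = \<chi>1 (path_class (- D) g)"
  define X2 where "X2 = \<chi>2 (path_class (- D) g)"
  have GF: "\<forall>\<^sub>F q in nhds P. G 1 q = F 1 q v* diag2 X1 X2"
    using lifts_compare(2)[OF F G] dc(4) d(4) by (simp add: cls X1_def X2_def)
  have "lifts d (\<lambda>s. F (s / 2))" using lifts_first_half[OF F d(1) c(1)] d(4) c(3) by simp
  from lifts_unique[OF this G] have half: "\<forall>\<^sub>F q in nhds P. F (1 / 2) q = G 1 q" using d(4) by simp
  have "germ_family (d +++ c) F" using F by (simp add: lifts_def)
  then have fam: "germ_family c (\<lambda>s. F ((1 + s) / 2))"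
    by (rule germ_family_second_half) (simp add: d(4) c(3))
  define z where "z = finite_coord p (of_real r')"
  have Pz: "P = Fin z" using r'(1) by (simp add: P_def z_def chart_eq_Fin)
  define N where "N = Fin -` (chart p ` (ball 0 e - {0}))"
  have openN: "open N" unfolding N_def by (intro open_Fin_vimage open_chart_image) auto
  define \<kappa> where "\<kappa> = (\<lambda>w. K (inverse_coord p w))"
  have \<kappa>: "(\<kappa> has_field_derivative 1 / A w) (at w)" "A w \<noteq> 0" if wN: "w \<in> N" for w
  proof -
    obtain t where t: "t \<in> ball 0 e - {0}" "Fin w = chart p t" using wN unfolding N_def by blast
    then have w: "w = finite_coord p t" by (simp add: chart_eq_Fin)
    have t0: "t \<noteq> 0" using t by simp
    show "(\<kappa> has_field_derivative 1 / A w) (at w)" "A w \<noteq> 0"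
      using primitive_in_finite_coord[where A = A, OF t0 e(3)[OF t(1)] e(2)[OF t(1)]]
      unfolding w \<kappa>_def by blast+
  qed
  have zN: "z \<in> N" using r' by (auto simp: N_def z_def chart_eq_Fin[symmetric] intro!: imageI)
  have reach: "reaches (Fin z) (G 1)"
    unfolding reaches_def using G d(4) Pz by (intro exI[of _ d] exI[of _ G]) simp
  obtain \<delta>1 where \<delta>1: "\<delta>1 > 0" "fundamental_on b1 b2 (ball z \<delta>1) (G 1)"
      "\<And>w. w \<in> ball z \<delta>1 \<Longrightarrow> reaches (Fin w) (G 1)"
    using reaches_fundamental[OF reach] by metis
  obtain \<delta>2 where \<delta>2: "\<delta>2 > 0" "ball z \<delta>2 \<subseteq> N" using openN zN open_contains_ball by blast
  define \<delta> where "\<delta> = min \<delta>1 \<delta>2"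
  have \<delta>: "\<delta> > 0" using \<delta>1 \<delta>2 by (simp add: \<delta>_def)
  \<comment> \<open>A nonzero \<open>A\<close> keeps both components away from zero, which allows
    the quotient below.\<close>
  have props: "comp1 (G 1) w \<noteq> 0" "comp2 (G 1) w \<noteq> 0" "wronskian (G 1) w \<noteq> 0"
      "A w = comp1 (G 1) w * comp2 (G 1) w / wronskian (G 1) w" "w \<in> N"
      "(comp1 (G 1) has_field_derivative deriv (comp1 (G 1)) w) (at w)"
      "(comp2 (G 1) has_field_derivative deriv (comp2 (G 1)) w) (at w)" if w: "w \<in> ball z \<delta>" for w
  proof -
    show N: "w \<in> N" using w \<delta>2 by (auto simp: \<delta>_def)
    have w1: "w \<in> ball z \<delta>1" using w by (simp add: \<delta>_def)
    show eq: "A w = comp1 (G 1) w * comp2 (G 1) w / wronskian (G 1) w"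
      using sym_eq_of_reaches(1)[OF \<delta>1(3)[OF w1]] by (simp add: sym_A_def)
    then show "comp1 (G 1) w \<noteq> 0" "comp2 (G 1) w \<noteq> 0" using \<kappa>(2)[OF N] by auto
    show "wronskian (G 1) w \<noteq> 0"
      "(comp1 (G 1) has_field_derivative deriv (comp1 (G 1)) w) (at w)"
      "(comp2 (G 1) has_field_derivative deriv (comp2 (G 1)) w) (at w)"
      using \<delta>1(2) w1 by (auto simp: fundamental_on_def)
  qed
  have "\<exists>k. \<forall>w\<in>ball z \<delta>. comp2 (G 1) w / comp1 (G 1) w * exp (- \<kappa> w) = k"
  proof (rule has_field_derivative_zero_constant[OF convex_ball])
    fix w assume w: "w \<in> ball z \<delta>"
    note pr = props[OF w]
    have "((\<lambda>w. comp2 (G 1) w / comp1 (G 1) w * exp (- \<kappa> w)) has_field_derivative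
        (deriv (comp2 (G 1)) w * comp1 (G 1) w - comp2 (G 1) w * deriv (comp1 (G 1)) w) /
          (comp1 (G 1) w * comp1 (G 1) w) * exp (- \<kappa> w) +
        exp (- \<kappa> w) * - (1 / A w) * (comp2 (G 1) w / comp1 (G 1) w)) (at w)"
      by (rule DERIV_mult[OF DERIV_divide[OF pr(7,6,1)] DERIV_fun_exp[OF DERIV_minus[OF \<kappa>(1)[OF pr(5)]]]])
    moreover have "deriv (comp2 (G 1)) w * comp1 (G 1) w - comp2 (G 1) w * deriv (comp1 (G 1)) w = wronskian (G 1) w"
      by (simp add: wronskian_def mult.commute)
    ultimately show "((\<lambda>w. comp2 (G 1) w / comp1 (G 1) w * exp (- \<kappa> w)) has_field_derivative 0) (at w within ball z \<delta>)"
      using pr(1-3) unfolding pr(4) by (simp add: field_simps has_field_derivative_at_within)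
  qed
  then obtain k where k: "\<And>w. w \<in> ball z \<delta> \<Longrightarrow> comp2 (G 1) w / comp1 (G 1) w * exp (- \<kappa> w) = k" by blast
  have keq: "comp2 (G 1) w = k * comp1 (G 1) w * exp (\<kappa> w)" if "w \<in> ball z \<delta>" for w
    using k[OF that] props(1)[OF that] by (simp add: exp_minus field_simps)
  \<comment> \<open>The value at infinity is a placeholder: the circle consists of finite
    points.\<close>
  define \<kappa>' where "\<kappa>' = (\<lambda>q. case q of Fin w \<Rightarrow> \<kappa> w | Infty \<Rightarrow> 0)"
  define Q where "Q = (\<lambda>q (h :: cp1 \<Rightarrow> complex^2). \<forall>\<^sub>F r in nhds q. h r $ 2 - k * h r $ 1 * exp (\<kappa>' r) = 0)"
  have Qcong: "Q q f = Q q h" if "\<forall>\<^sub>F r in nhds q. f r = h r" for q f h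
    unfolding Q_def using that by (rule eventually_cong) simp
  have "Q (c 0) (F ((1 + 0) / 2)) = Q (c 1) (F ((1 + 1) / 2))"
  proof (rule germ_family_invariant[OF fam c(1)])
    fix s :: real and h :: "cp1 \<Rightarrow> complex^2"
    assume s: "s \<in> {0..1}" and h: "\<And>j. analytic_at_cp1 (\<lambda>q. h q $ j) (c s)"
    obtain t where t: "norm t = r'" "c s = chart p t" using shrink(9)[OF s] by blast
    have t0: "t \<in> ball 0 e - {0}" using t r' by auto
    then have cs: "c s = Fin (finite_coord p t)" using t by (simp add: chart_eq_Fin)
    have N: "finite_coord p t \<in> N" using t0 by (auto simp: N_def chart_eq_Fin[symmetric] intro!: imageI)
    have "\<kappa> holomorphic_on N" using \<kappa>(1) openN by (meson holomorphic_on_open)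
    then have "\<kappa> analytic_on {finite_coord p t}"
      using N openN by (auto simp: analytic_on_open[symmetric] intro: analytic_on_subset)
    then have "analytic_at_cp1 (\<lambda>r. h r $ 2 - k * h r $ 1 * exp (\<kappa>' r)) (c s)"
      using h unfolding cs analytic_at_Fin \<kappa>'_def by (auto intro!: analytic_intros)
    then show "\<forall>\<^sub>F q in nhds (c s). Q q h = Q (c s) h"
      unfolding Q_def by (rule eventually_vanishing_iff)
  qed (rule Qcong)
  moreover have "Q P (G 1)"
    unfolding Q_def Pz eventually_nhds_Fin
    by (rule eventually_mono[OF eventually_nhds_in_open[of "ball z \<delta>"]]) (use \<delta> keq in \<open>auto simp: \<kappa>'_def\<close>)
  then have "Q (c 0) (F ((1 + 0) / 2))" using Qcong[OF half] c(3) by (simp add: pathstart_def)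
  ultimately have "Q P (F 1)" using c(4) by (simp add: pathfinish_def)
  then have F1: "comp2 (F 1) z = k * comp1 (F 1) z * exp (\<kappa> z)"
    unfolding Q_def Pz using eventually_nhds_x_imp_x by (fastforce simp: \<kappa>'_def)
  have "G 1 (Fin z) = F 1 (Fin z) v* diag2 X1 X2" using eventually_nhds_x_imp_x[OF GF] Pz by simp
  then have G1: "comp1 (G 1) z = X1 * comp1 (F 1) z" "comp2 (G 1) z = X2 * comp2 (F 1) z" by simp_all
  have "z \<in> ball z \<delta>" using \<delta> by simp
  then have "comp2 (G 1) z \<noteq> 0" "comp2 (G 1) z = k * comp1 (G 1) z * exp (\<kappa> z)"
    using props(2) keq by blast+
  then have "X2 * comp2 (F 1) z = X1 * comp2 (F 1) z" "comp2 (F 1) z \<noteq> 0"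
    using F1 G1 by auto
  then show ?thesis by (simp add: X1_def X2_def)
qed

lemma exists_trivial_local_monodromy:
  assumes "card D = 3"
  shows "\<exists>p\<in>D. \<forall>g. loop_around D x p g \<longrightarrow> \<chi>1 (path_class (- D) g) = \<chi>2 (path_class (- D) g)"
proof -
  obtain p e K where "p \<in> D" "e > 0" "\<forall>t\<in>ball 0 e - {0}. chart p t \<notin> D \<and> field_in_chart A p t \<noteq> 0 \<and>
       (K has_field_derivative 1 / field_in_chart A p t) (at t)"
    using exists_primitive[OF assms] by blast
  then show ?thesis using local_monodromy_trivial[of e p K] by blast
qed

end

section \<open>Simultaneous diagonalisation\<close>

lemma matrix_inv_both:
  assumes "invertible (S :: complex^2^2)"
  shows "S ** matrix_inv S = mat 1" "matrix_inv S ** S = mat 1"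
proof -
  have "S ** matrix_inv S = mat 1 \<and> matrix_inv S ** S = mat 1"
    using assms unfolding matrix_inv_def invertible_def by (rule someI_ex)
  then show "S ** matrix_inv S = mat 1" "matrix_inv S ** S = mat 1" by auto
qed

definition conj_diag :: "complex^2^2 \<Rightarrow> complex \<Rightarrow> complex \<Rightarrow> complex^2^2" where
  "conj_diag S a b = S ** diag2 a b ** matrix_inv S"

lemma diag2_mult: "diag2 a b ** diag2 c d = diag2 (a * c) (b * d)"
  by (simp add: diag2_def matrix_matrix_mult_def vec_eq_iff forall_2 sum_2)

lemma diag2_scalar: "diag2 a a = mat a"
  by (simp add: diag2_def mat_def vec_eq_iff forall_2)

lemma diag2_eq_iff: "diag2 a b = diag2 c d \<longleftrightarrow> a = c \<and> b = d"
  by (auto simp: diag2_def vec_eq_iff forall_2)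

lemma mat_commute: "(A :: complex^2^2) ** mat c = mat c ** A"
  by (simp add: mat_def matrix_matrix_mult_def vec_eq_iff sum_2 forall_2)

context
  fixes S :: "complex^2^2"
  assumes S: "invertible S"
begin

lemma conj_diag_eqI:
  assumes "matrix_inv S ** M ** S = diag2 a b"
  shows "M = conj_diag S a b"
proof -
  have "conj_diag S a b = (S ** matrix_inv S) ** M ** (S ** matrix_inv S)"
    unfolding conj_diag_def assms[symmetric] by (simp only: matrix_mul_assoc)
  then show ?thesis by (simp add: matrix_inv_both[OF S])
qed

lemma conj_diag_mult_right: "conj_diag S a b ** S = S ** diag2 a b"
  unfolding conj_diag_def
  by (simp only: matrix_mul_assoc[symmetric] matrix_inv_both[OF S] matrix_mul_rid)

lemma conj_diag_mult: "conj_diag S a b ** conj_diag S c d = conj_diag S (a * c) (b * d)"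
proof -
  have "conj_diag S a b ** conj_diag S c d = (conj_diag S a b ** S) ** diag2 c d ** matrix_inv S"
    unfolding conj_diag_def[of S c d] by (simp only: matrix_mul_assoc)
  then show ?thesis
    unfolding conj_diag_mult_right by (simp only: conj_diag_def matrix_mul_assoc[symmetric] diag2_mult)
qed

lemma conj_diag_scalar: "conj_diag S a a = mat a"
proof -
  have "conj_diag S a a = mat a ** (S ** matrix_inv S)"
    unfolding conj_diag_def diag2_scalar mat_commute by (simp only: matrix_mul_assoc)
  then show ?thesis by (simp add: matrix_inv_both[OF S])
qed

lemma conj_diag_eq_iff: "conj_diag S a b = conj_diag S c d \<longleftrightarrow> a = c \<and> b = d"
proof
  assume "conj_diag S a b = conj_diag S c d"
  then have "S ** diag2 a b = S ** diag2 c d" by (metis conj_diag_mult_right)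
  then have "(matrix_inv S ** S) ** diag2 a b = (matrix_inv S ** S) ** diag2 c d"
    by (metis matrix_mul_assoc)
  then show "a = c \<and> b = d" by (simp add: matrix_inv_both[OF S] diag2_eq_iff)
qed simp

lemma scalar_conj_diag: "scalar_matrix (conj_diag S a b) \<longleftrightarrow> a = b"
  unfolding scalar_matrix_def using conj_diag_eq_iff conj_diag_scalar by metis

lemma conj_diag_invertible_nonzero:
  assumes "invertible (conj_diag S a b)"
  shows "a \<noteq> 0" "b \<noteq> 0"
proof -
  obtain N where "conj_diag S a b ** N = mat 1" using assms unfolding invertible_def by blast
  then have "det (conj_diag S a b) \<noteq> 0"
    by (metis det_I det_mul mult_zero_left zero_neq_one)
  then have "det (diag2 a b) \<noteq> 0" by (auto simp: conj_diag_def det_mul)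
  then show "a \<noteq> 0" "b \<noteq> 0" by (auto simp: det_2 diag2_def)
qed

lemma GL2_inv_conj_diag:
  assumes "a \<noteq> 0" "b \<noteq> 0"
  shows "conj_diag S a b \<in> carrier GL2" "inv\<^bsub>GL2\<^esub> (conj_diag S a b) = conj_diag S (1 / a) (1 / b)"
proof -
  have *: "invertible (conj_diag S a b)" if "a \<noteq> 0" "b \<noteq> 0" for a b
    unfolding invertible_def using that
    by (intro exI[of _ "conj_diag S (1 / a) (1 / b)"]) (simp add: conj_diag_mult conj_diag_scalar)
  then show car: "conj_diag S a b \<in> carrier GL2" using assms by (simp add: GL2_def)
  show "inv\<^bsub>GL2\<^esub> (conj_diag S a b) = conj_diag S (1 / a) (1 / b)"
    by (rule group.inv_equality[OF group_GL2 _ car])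
      (use assms * in \<open>simp_all add: GL2_def conj_diag_mult conj_diag_scalar\<close>)
qed

text \<open>Invertible matrices that are diagonal in the basis given by \<open>S\<close> are closed
  under products and inverses.\<close>

lemma hom_conj_diag:
  assumes P: "group P" and \<rho>: "\<rho> \<in> hom P GL2" and gen: "generate P H = carrier P"
    and H: "\<And>h. h \<in> H \<Longrightarrow> \<exists>a b. \<rho> h = conj_diag S a b" and "A \<in> carrier P"
  shows "\<exists>a b. a \<noteq> 0 \<and> b \<noteq> 0 \<and> \<rho> A = conj_diag S a b"
proof -
  interpret group_hom P GL2 \<rho>
    using P \<rho> group_GL2 by (simp add: group_hom_def group_hom_axioms_def)
  have H': "\<exists>a b. a \<noteq> 0 \<and> b \<noteq> 0 \<and> \<rho> h = conj_diag S a b" if h: "h \<in> H" for h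
  proof -
    obtain a b where ab: "\<rho> h = conj_diag S a b" using H[OF h] by blast
    have "h \<in> carrier P" using gen generate.incl[OF h, of P] by simp
    then have "invertible (conj_diag S a b)" using ab hom_closed by (fastforce simp: GL2_def)
    then show ?thesis using ab conj_diag_invertible_nonzero by blast
  qed
  have "A \<in> generate P H" using assms by simp
  then show ?thesis
  proof (induction A rule: generate.induct)
    case one
    then show ?case using conj_diag_scalar[of 1] hom_one
      by (intro exI[of _ 1]) (simp add: GL2_def)
  next
    case (incl h)
    then show ?case by (rule H')
  next
    case (inv h)
    obtain a b where ab: "a \<noteq> 0" "b \<noteq> 0" "\<rho> h = conj_diag S a b" using H'[OF inv] by blast
    have "h \<in> carrier P" using gen generate.incl[OF inv, of P] by simp
    then have "\<rho> (inv\<^bsub>P\<^esub> h) = conj_diag S (1 / a) (1 / b)"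
      using hom_inv GL2_inv_conj_diag[OF ab(1,2)] ab(3) by simp
    then show ?case using ab by (intro exI[of _ "1 / a"] exI[of _ "1 / b"]) auto
  next
    case (eng h1 h2)
    obtain a b c d where "a \<noteq> 0" "b \<noteq> 0" "\<rho> h1 = conj_diag S a b" "c \<noteq> 0" "d \<noteq> 0" "\<rho> h2 = conj_diag S c d"
      using eng by blast
    moreover have "h1 \<in> carrier P" "h2 \<in> carrier P" using eng gen by auto
    ultimately have "\<rho> (h1 \<otimes>\<^bsub>P\<^esub> h2) = conj_diag S (a * c) (b * d)" "a * c \<noteq> 0" "b * d \<noteq> 0"
      by (auto simp: GL2_def conj_diag_mult)
    then show ?case by blast
  qed
qed

end

section \<open>Linear changes of basis\<close>

lemma solution_near_combination:
  assumes "solution_near b1 b2 p y1" "solution_near b1 b2 p y2"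
  shows "solution_near b1 b2 p (\<lambda>q. a * y1 q + b * y2 q)"
proof -
  have an: "analytic_at_cp1 y1 p" "analytic_at_cp1 y2 p"
    and ode: "ode_near b1 b2 p y1" "ode_near b1 b2 p y2"
    using assms by (auto simp: solution_near_iff)
  have "\<forall>\<^sub>F q in nhds p. analytic_at_cp1 y1 q" "\<forall>\<^sub>F q in nhds p. analytic_at_cp1 y2 q"
    using an by (auto intro: eventually_analytic_at_cp1)
  then have "ode_near b1 b2 p (\<lambda>q. a * y1 q + b * y2 q)"
    using ode unfolding ode_near_def
  proof eventually_elim
    case (elim q)
    show ?case
    proof (intro impI allI)
      fix w assume q: "q \<noteq> p" "q = Fin w"
      let ?Y1 = "\<lambda>w. y1 (Fin w)" and ?Y2 = "\<lambda>w. y2 (Fin w)"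
      have Y: "?Y1 analytic_on {w}" "?Y2 analytic_on {w}" using elim(1,2) q(2) by (auto simp: analytic_at_Fin)
      then obtain r1 r2 where "r1 > 0" "?Y1 holomorphic_on ball w r1" "r2 > 0" "?Y2 holomorphic_on ball w r2"
        by (auto simp: analytic_at_ball)
      then have r: "min r1 r2 > 0" "?Y1 holomorphic_on ball w (min r1 r2)" "?Y2 holomorphic_on ball w (min r1 r2)"
        by (auto intro: holomorphic_on_subset)
      have d: "deriv (\<lambda>w. a * ?Y1 w + b * ?Y2 w) v = a * deriv ?Y1 v + b * deriv ?Y2 v"
        if "v \<in> ball w (min r1 r2)" for v
        using r(2,3) that by (intro DERIV_imp_deriv DERIV_add DERIV_cmult) (meson holomorphic_derivI open_ball)+
      have "deriv (deriv (\<lambda>w. a * ?Y1 w + b * ?Y2 w)) w = deriv (\<lambda>v. a * deriv ?Y1 v + b * deriv ?Y2 v) w"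
        by (rule deriv_cong_ev[OF _ refl], rule eventually_mono[OF eventually_nhds_in_open[of "ball w (min r1 r2)"]])
          (use r(1) d in auto)
      also have "\<dots> = a * deriv (deriv ?Y1) w + b * deriv (deriv ?Y2) w"
        using r by (intro DERIV_imp_deriv DERIV_add DERIV_cmult)
          (meson holomorphic_derivI holomorphic_deriv open_ball centre_in_ball)+
      finally have d2: "deriv (deriv (\<lambda>w. a * ?Y1 w + b * ?Y2 w)) w = a * deriv (deriv ?Y1) w + b * deriv (deriv ?Y2) w" .
      have "ode_lhs b1 b2 (\<lambda>q. a * y1 q + b * y2 q) w = a * ode_lhs b1 b2 y1 w + b * ode_lhs b1 b2 y2 w"
        unfolding d2 using d[of w] r(1) by (simp add: algebra_simps)
      then show "ode_lhs b1 b2 (\<lambda>q. a * y1 q + b * y2 q) w = 0" using elim(3,4) q by simp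
    qed
  qed
  then show ?thesis using an by (auto simp: solution_near_iff intro!: analytic_at_cp1_intros)
qed

lemma solution_near_matrix:
  fixes Y :: "cp1 \<Rightarrow> complex^2" and M :: "complex^2^2"
  assumes "\<And>j. solution_near b1 b2 p (\<lambda>q. Y q $ j)"
  shows "solution_near b1 b2 p (\<lambda>q. (Y q v* M) $ j)"
  unfolding vector_matrix_mult_2 by (intro solution_near_combination assms)

lemma sum_vector_matrix:
  fixes M :: "complex^2^2" shows
  "(\<Sum>j\<in>UNIV. (c::complex^2) $ j * (y v* M) $ j) = (\<Sum>j\<in>UNIV. (M *v c) $ j * y $ j)"
  by (simp add: vector_matrix_mult_2 sum_2 matrix_vector_mult_def algebra_simps)

lemma independent_near_matrix:
  assumes "independent_near p Y" "invertible M"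
  shows "independent_near p (\<lambda>q. Y q v* M)"
  unfolding independent_near_def sum_vector_matrix
proof (intro allI impI)
  fix c :: "complex^2"
  assume "\<forall>\<^sub>F q in nhds p. (\<Sum>j\<in>UNIV. (M *v c) $ j * Y q $ j) = 0"
  then have "M *v c = 0" using assms(1) unfolding independent_near_def by blast
  then have "(matrix_inv M ** M) *v c = 0" by (simp add: matrix_vector_mul_assoc[symmetric])
  then show "c = 0" by (simp add: matrix_inv_both[OF assms(2)])
qed

text \<open>In the basis \<open>Y v* S\<close> the matrix \<open>conj_diag S a b\<close> becomes
  \<open>diag2 a b\<close>, since \<open>conj_diag S a b ** S = S ** diag2 a b\<close>.\<close>

lemma realizes_imp_diagonal_monodromy:
  assumes D: "finite D" "x \<notin> D" and riem: "riemann_equation D b1 b2" and S: "invertible S"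
    and real: "realizes D x b1 b2 \<rho>"
    and \<rho>: "\<And>\<gamma>. is_loop (- D) x \<gamma> \<Longrightarrow> \<rho> (path_class (- D) \<gamma>) =
        conj_diag S (\<chi>1 (path_class (- D) \<gamma>)) (\<chi>2 (path_class (- D) \<gamma>))"
    and nz: "\<And>\<gamma>. is_loop (- D) x \<gamma> \<Longrightarrow> \<chi>1 (path_class (- D) \<gamma>) \<noteq> 0 \<and> \<chi>2 (path_class (- D) \<gamma>) \<noteq> 0"
  shows "\<exists>Z. diagonal_monodromy D x b1 b2 Z \<chi>1 \<chi>2"
proof -
  obtain Y where Y: "solution_basis b1 b2 x Y"
    and mon: "\<And>\<gamma>. is_loop (- D) x \<gamma> \<Longrightarrow> \<exists>Y'. continuation_along \<gamma> Y Y' \<and>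
              (\<forall>\<^sub>F q in nhds x. Y q = Y' q v* \<rho> (path_class (- D) \<gamma>))"
    using real unfolding realizes_def by blast
  have "diagonal_monodromy D x b1 b2 (\<lambda>q. Y q v* S) \<chi>1 \<chi>2"
  proof
    show "solution_near b1 b2 x (\<lambda>q. (Y q v* S) $ j)" for j
      using Y by (intro solution_near_matrix) (simp add: solution_basis_def)
    have "independent_near x Y" using Y by (simp add: solution_basis_def independent_near_def)
    then show "independent_near x (\<lambda>q. Y q v* S)" using S by (rule independent_near_matrix)
    fix \<gamma> assume loop: "is_loop (- D) x \<gamma>"
    let ?X = "diag2 (\<chi>1 (path_class (- D) \<gamma>)) (\<chi>2 (path_class (- D) \<gamma>))"
    have ends: "\<gamma> 0 = x" "\<gamma> 1 = x" using loop by (auto simp: is_loop_def pathstart_def pathfinish_def)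
    obtain Y' F where Y': "\<forall>\<^sub>F q in nhds x. Y q = Y' q v* \<rho> (path_class (- D) \<gamma>)"
      and F: "germ_family \<gamma> F" "\<forall>\<^sub>F q in nhds x. F 0 q = Y q" "\<forall>\<^sub>F q in nhds x. F 1 q = Y' q"
      using mon[OF loop] unfolding continuation_along_iff ends by blast
    show "\<exists>F. germ_family \<gamma> F \<and> (\<forall>\<^sub>F q in nhds x. F 0 q = Y q v* S) \<and>
         (\<forall>\<^sub>F q in nhds x. Y q v* S = F 1 q v* ?X)"
    proof (intro exI[of _ "\<lambda>s q. F s q v* S"] conjI)
      show "germ_family \<gamma> (\<lambda>s q. F s q v* S)" by (rule germ_family_matrix[OF F(1)])
      show "\<forall>\<^sub>F q in nhds x. F 0 q v* S = Y q v* S" using F(2) by (rule eventually_mono) simp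
      show "\<forall>\<^sub>F q in nhds x. Y q v* S = F 1 q v* S v* ?X"
        using Y' F(3)
      proof eventually_elim
        case (elim q)
        have "Y q v* S = Y' q v* (\<rho> (path_class (- D) \<gamma>) ** S)"
          by (subst elim(1)) (simp only: vector_matrix_mul_assoc)
        also have "\<rho> (path_class (- D) \<gamma>) ** S = S ** ?X"
          unfolding \<rho>[OF loop] by (rule conj_diag_mult_right[OF S])
        finally show ?case unfolding elim(2) by (simp only: vector_matrix_mul_assoc)
      qed
    qed
    show "\<chi>1 (path_class (- D) \<gamma>) \<noteq> 0 \<and> \<chi>2 (path_class (- D) \<gamma>) \<noteq> 0" by (rule nz[OF loop])
  qed (use D riem in auto)
  then show ?thesis by blast
qed

lemma realized_diagonal_imp_scalar:
  fixes a :: "3 \<Rightarrow> cp1"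
  assumes a: "inj a" "x \<notin> range a" and loops: "standard_loops a x \<gamma>"
    and \<rho>: "\<rho> \<in> hom (fundamental_group (- range a) x) GL2"
    and S: "invertible S" "\<And>i. \<rho> (path_class (- range a) (\<gamma> i)) = conj_diag S (\<alpha> i) (\<beta> i)"
    and riem: "riemann_equation (range a) b1 b2" and real: "realizes (range a) x b1 b2 \<rho>"
  shows "\<exists>i. \<alpha> i = \<beta> i"
proof -
  let ?P = "fundamental_group (- range a) x"
  let ?c = "\<lambda>i. path_class (- range a) (\<gamma> i)"
  have gen: "generate ?P (range ?c) = carrier ?P" and around: "\<And>i. loop_around (range a) x (a i) (\<gamma> i)"
    using loops by (auto simp: standard_loops_def Let_def)
  have grp: "group ?P" using a by (intro group_fundamental_group) simp
  have ex: "\<exists>u v. u \<noteq> 0 \<and> v \<noteq> 0 \<and> \<rho> A = conj_diag S u v" if "A \<in> carrier ?P" for A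
    by (rule hom_conj_diag[OF S(1) grp \<rho> gen _ that]) (use S(2) in blast)
  \<comment> \<open>The diagonal entries exist for every class but are not given as functions of it.
    For invertible \<open>S\<close> they are unique, which identifies them with
    \<open>\<alpha> i\<close> and \<open>\<beta> i\<close> at the end.\<close>
  define \<xi> where "\<xi> = (\<lambda>A. SOME uv. fst uv \<noteq> 0 \<and> snd uv \<noteq> 0 \<and> \<rho> A = conj_diag S (fst uv) (snd uv))"
  have \<xi>: "fst (\<xi> A) \<noteq> 0 \<and> snd (\<xi> A) \<noteq> 0 \<and> \<rho> A = conj_diag S (fst (\<xi> A)) (snd (\<xi> A))" if A: "A \<in> carrier ?P" for A
  proof -
    have "\<exists>uv. fst uv \<noteq> 0 \<and> snd uv \<noteq> 0 \<and> \<rho> A = conj_diag S (fst uv) (snd uv)"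
      using ex[OF A] by auto
    then show ?thesis unfolding \<xi>_def by (rule someI_ex)
  qed
  have fin: "finite (range a)" by simp
  have car: "path_class (- range a) g \<in> carrier ?P" if "is_loop (- range a) x g" for g
    using that by (auto simp: carrier_fundamental_group)
  obtain Z where "diagonal_monodromy (range a) x b1 b2 Z (\<lambda>A. fst (\<xi> A)) (\<lambda>A. snd (\<xi> A))"
    using realizes_imp_diagonal_monodromy[OF fin a(2) riem S(1) real, of "\<lambda>A. fst (\<xi> A)" "\<lambda>A. snd (\<xi> A)"]
      \<xi> car by blast
  then interpret diagonal_monodromy "range a" x b1 b2 Z "\<lambda>A. fst (\<xi> A)" "\<lambda>A. snd (\<xi> A)" .
  have "card (range a) = 3" using a(1) by (simp add: card_image)
  then obtain i where i: "\<And>g. loop_around (range a) x (a i) g \<Longrightarrow>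
      fst (\<xi> (path_class (- range a) g)) = snd (\<xi> (path_class (- range a) g))"
    using exists_trivial_local_monodromy by blast
  have "?c i \<in> carrier ?P" using gen generate.incl[of "?c i" "range ?c" ?P] by simp
  then have "conj_diag S (\<alpha> i) (\<beta> i) = conj_diag S (fst (\<xi> (?c i))) (snd (\<xi> (?c i)))"
    using \<xi> S(2) by metis
  then have "\<alpha> i = \<beta> i" using i[OF around] conj_diag_eq_iff[OF S(1)] by metis
  then show ?thesis by blast
qed

section \<open>Ratios of linear forms on the sphere\<close>

text \<open>The linear form vanishing at \<open>a\<close>, evaluated at \<open>chart p t\<close> with homogeneous coordinates
  \<open>(c + t, 1)\<close> for \<open>p = Fin c\<close> and \<open>(1, t)\<close> for \<open>p = Infty\<close>.\<close>

fun factor :: "cp1 \<Rightarrow> cp1 \<Rightarrow> complex \<Rightarrow> complex" where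
  "factor (Fin c) (Fin a) t = c + t - a"
| "factor (Fin c) Infty t = 1"
| "factor Infty (Fin a) t = 1 - a * t"
| "factor Infty Infty t = t"

text \<open>The logarithmic derivative of \<open>factor p a\<close> with respect to
  \<open>t\<close>.\<close>

fun dlog :: "cp1 \<Rightarrow> cp1 \<Rightarrow> complex \<Rightarrow> complex" where
  "dlog (Fin c) (Fin a) t = 1 / (c + t - a)"
| "dlog (Fin c) Infty t = 0"
| "dlog Infty (Fin a) t = - a / (1 - a * t)"
| "dlog Infty Infty t = 1 / t"

text \<open>Numerator and denominator use the same homogeneous coordinates, so this is a function on
  the sphere; for distinct points it is a Moebius map with zero \<open>a\<close> and pole
  \<open>b\<close>.\<close>

definition ratio :: "cp1 \<Rightarrow> cp1 \<Rightarrow> cp1 \<Rightarrow> complex" where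
  "ratio a b q = factor q a 0 / factor q b 0"

lemma factor_eq_0_iff: "factor p a t = 0 \<longleftrightarrow> chart p t = a"
  by (cases p; cases a) (auto simp: field_simps split: if_splits)

lemma factor_self: "factor p p t = t"
  by (cases p) auto

lemma factor_affine: "\<exists>u v. \<forall>t. factor p a t = u + v * t"
proof (cases p; cases a)
  fix c b assume "p = Fin c" "a = Fin b"
  then show ?thesis by (intro exI[of _ "c - b"] exI[of _ 1]) auto
next
  fix c assume "p = Fin c" "a = Infty"
  then show ?thesis by (intro exI[of _ 1] exI[of _ 0]) auto
next
  fix b assume "p = Infty" "a = Fin b"
  then show ?thesis by (intro exI[of _ 1] exI[of _ "- b"]) auto
next
  assume "p = Infty" "a = Infty"
  then show ?thesis by (intro exI[of _ 0] exI[of _ 1]) auto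
qed

lemma analytic_factor: "factor p a analytic_on A"
proof -
  obtain u v where "\<forall>t. factor p a t = u + v * t" using factor_affine by blast
  then have "factor p a = (\<lambda>t. u + v * t)" by auto
  then show ?thesis by (simp add: analytic_intros)
qed

lemma factor_derivative:
  assumes "chart p t \<noteq> a"
  shows "(factor p a has_field_derivative factor p a t * dlog p a t) (at t)"
proof -
  have nz: "factor p a t \<noteq> 0" using assms by (simp add: factor_eq_0_iff)
  show ?thesis
  proof (cases p; cases a)
    fix c b assume [simp]: "p = Fin c" "a = Fin b"
    have "factor p a = (\<lambda>t. c + t - b)" by auto
    then show ?thesis using nz by (auto intro!: derivative_eq_intros)
  next
    fix c assume [simp]: "p = Fin c" "a = Infty"
    have "factor p a = (\<lambda>t. 1)" by auto
    then show ?thesis by (auto intro!: derivative_eq_intros)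
  next
    fix b assume [simp]: "p = Infty" "a = Fin b"
    have "factor p a = (\<lambda>t. 1 - b * t)" by auto
    then show ?thesis using nz by (auto intro!: derivative_eq_intros)
  next
    assume [simp]: "p = Infty" "a = Infty"
    have "factor p a = (\<lambda>t. t)" by auto
    then show ?thesis using nz by (auto intro!: derivative_eq_intros)
  qed
qed

lemma dlog_derivative:
  assumes "chart p t \<noteq> a"
  shows "(dlog p a has_field_derivative - (dlog p a t)\<^sup>2) (at t)"
proof -
  have nz: "factor p a t \<noteq> 0" using assms by (simp add: factor_eq_0_iff)
  show ?thesis
  proof (cases p; cases a)
    fix c b assume [simp]: "p = Fin c" "a = Fin b"
    have "dlog p a = (\<lambda>t. 1 / (c + t - b))" by auto
    then show ?thesis using nz by (auto intro!: derivative_eq_intros simp: power2_eq_square)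
  next
    fix c assume [simp]: "p = Fin c" "a = Infty"
    have "dlog p a = (\<lambda>t. 0)" by auto
    then show ?thesis by (auto intro!: derivative_eq_intros)
  next
    fix b assume [simp]: "p = Infty" "a = Fin b"
    have "dlog p a = (\<lambda>t. - b / (1 - b * t))" by auto
    then show ?thesis using nz by (auto intro!: derivative_eq_intros simp: power2_eq_square)
  next
    assume [simp]: "p = Infty" "a = Infty"
    have "dlog p a = (\<lambda>t. 1 / t)" by auto
    then show ?thesis using nz by (auto intro!: derivative_eq_intros simp: power2_eq_square)
  qed
qed

text \<open>A change of chart multiplies both homogeneous coordinates by the same nonzero number,
  which cancels.\<close>

lemma ratio_chart: "ratio a b (chart p t) = factor p a t / factor p b t"
proof (cases "t = 0 \<or> p \<noteq> Infty")
  case True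
  then show ?thesis by (cases p; cases a; cases b) (auto simp: ratio_def)
next
  case False
  then show ?thesis by (cases a; cases b) (auto simp: ratio_def divide_simps)
qed

lemma ratio_nonzero: "q \<noteq> a \<Longrightarrow> q \<noteq> b \<Longrightarrow> ratio a b q \<noteq> 0"
  using factor_eq_0_iff[of q _ 0] by (auto simp: ratio_def)

lemma analytic_ratio:
  assumes "q \<noteq> b" shows "analytic_at_cp1 (ratio a b) q"
proof -
  have eq: "ratio a b \<circ> chart q = (\<lambda>t. factor q a t / factor q b t)"
    by (simp add: fun_eq_iff ratio_chart)
  show ?thesis
    unfolding analytic_at_cp1_def eq
    using assms by (intro analytic_on_divide analytic_factor) (simp add: factor_eq_0_iff)
qed

lemma analytic_at_cp1_tendsto:
  assumes "analytic_at_cp1 f p"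
  shows "(f \<longlongrightarrow> f p) (nhds p)"
proof (rule topological_tendstoI)
  fix V assume V: "open V" "f p \<in> V"
  have "isCont (f \<circ> chart p) 0"
    using assms unfolding analytic_at_cp1_def by (rule analytic_at_imp_isCont)
  then have "((f \<circ> chart p) \<longlongrightarrow> f p) (nhds 0)"
    using tendsto_at_iff_tendsto_nhds[of "f \<circ> chart p" 0] by (simp add: isCont_def)
  then have "\<forall>\<^sub>F t in nhds 0. (f \<circ> chart p) t \<in> V" using V by (intro topological_tendstoD)
  then show "\<forall>\<^sub>F q in nhds p. f q \<in> V" by (simp add: eventually_nhds_cp1)
qed

text \<open>A positive real part keeps the quotient where the principal \<open>Ln\<close> is
  holomorphic and has imaginary part below \<open>pi / 2\<close> in absolute value.\<close>

lemma ratio_positive_near: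
  assumes "p \<noteq> a" "p \<noteq> b"
  shows "\<forall>\<^sub>F q in nhds p. 0 < Re (ratio a b q / ratio a b p)"
proof -
  have "((\<lambda>q. Re (ratio a b q / ratio a b p)) \<longlongrightarrow> Re (ratio a b p / ratio a b p)) (nhds p)"
    using assms by (intro tendsto_intros analytic_at_cp1_tendsto analytic_ratio ratio_nonzero)
  then show ?thesis
    using ratio_nonzero[OF assms] by (intro order_tendstoD(1)[where y = "Re (ratio a b p / ratio a b p)"]) auto
qed

section \<open>Continuous logarithms of ratios\<close>

text \<open>Near \<open>p\<close>, the branch with value \<open>c\<close> at \<open>p\<close> of a
  logarithm of \<open>ratio a b\<close> up to an additive constant; it is a genuine logarithm if
  \<open>exp c = ratio a b p\<close>.\<close>

definition log_germ :: "cp1 \<Rightarrow> cp1 \<Rightarrow> complex \<Rightarrow> cp1 \<Rightarrow> cp1 \<Rightarrow> complex" where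
  "log_germ a b c p q = c + Ln (ratio a b q / ratio a b p)"

lemma analytic_log_germ:
  assumes "p \<noteq> a" "p \<noteq> b"
  shows "analytic_at_cp1 (log_germ a b c p) p"
proof -
  have nz: "ratio a b p \<noteq> 0" using assms by (rule ratio_nonzero)
  have an: "(ratio a b \<circ> chart p) analytic_on {0}"
    using analytic_ratio[OF assms(2)] by (simp add: analytic_at_cp1_def)
  show ?thesis
    unfolding analytic_at_cp1_def log_germ_def o_def
    using nz an by (intro analytic_intros) (auto simp: o_def)
qed

text \<open>Both germs are logarithms of the same function, so they agree once their imaginary parts
  differ by less than \<open>2 pi\<close>. Three contributions below \<open>pi / 2\<close> ensure
  this: one from the continuity of \<open>l\<close> and two from the principal logarithms.\<close>

lemma log_germ_coherent:
  assumes \<gamma>: "path \<gamma>" and l: "continuous_on {0..1} l" "\<And>s. s \<in> {0..1} \<Longrightarrow> ratio a b (\<gamma> s) = exp (l s)"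
    and ab: "\<And>s. s \<in> {0..1} \<Longrightarrow> \<gamma> s \<noteq> a \<and> \<gamma> s \<noteq> b" and s: "s \<in> {0..1}"
  shows "\<forall>\<^sub>F u in at s within {0..1}. \<forall>\<^sub>F q in nhds (\<gamma> u).
           log_germ a b (l u) (\<gamma> u) q = log_germ a b (l s) (\<gamma> s) q"
proof -
  have "\<forall>\<^sub>F q in nhds (\<gamma> s). \<forall>\<^sub>F r in nhds q. 0 < Re (ratio a b r / ratio a b (\<gamma> s))"
    using ratio_positive_near[of "\<gamma> s" a b] ab[OF s] by (simp add: eventually_eventually)
  from eventually_path_at[OF \<gamma> s this]
  have 1: "\<forall>\<^sub>F u in at s within {0..1}. \<forall>\<^sub>F r in nhds (\<gamma> u). 0 < Re (ratio a b r / ratio a b (\<gamma> s))" .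
  have "(l \<longlongrightarrow> l s) (at s within {0..1})" using l(1) s by (simp add: continuous_on_def)
  then have 2: "\<forall>\<^sub>F u in at s within {0..1}. dist (l u) (l s) < pi / 2"
    by (rule tendstoD) simp
  have 3: "\<forall>\<^sub>F u in at s within {0..1}. u \<in> {0..1}" by (simp add: eventually_at_filter)
  from 1 2 3 show ?thesis
  proof eventually_elim
    case (elim u)
    note ab_u = ab[OF elim(3)]
    have "\<forall>\<^sub>F q in nhds (\<gamma> u). 0 < Re (ratio a b q / ratio a b (\<gamma> u))"
      using ratio_positive_near ab_u by blast
    with elim(1) show ?case
    proof eventually_elim
      case (elim q)
      let ?u = "ratio a b q / ratio a b (\<gamma> u)" and ?s = "ratio a b q / ratio a b (\<gamma> s)"
      have nz: "?u \<noteq> 0" "?s \<noteq> 0" using elim by auto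
      have im: "\<bar>Im (Ln ?u)\<bar> < pi / 2" "\<bar>Im (Ln ?s)\<bar> < pi / 2"
        using elim by (simp_all only: Re_Ln_pos_lt[OF nz(1)] Re_Ln_pos_lt[OF nz(2)])
      have "\<bar>Im (l u - l s)\<bar> < pi / 2"
        using \<open>dist (l u) (l s) < pi / 2\<close> abs_Im_le_cmod[of "l u - l s"] by (simp add: dist_norm)
      then have "\<bar>Im (l u + Ln ?u) - Im (l s + Ln ?s)\<bar> < 2 * pi"
        using im pi_gt_zero unfolding plus_complex.simps minus_complex.simps by linarith
      moreover have "exp (l u + Ln ?u) = exp (l s + Ln ?s)"
        using nz l(2)[OF s] l(2)[OF \<open>u \<in> {0..1}\<close>] by (simp add: exp_add)
      ultimately show ?case unfolding log_germ_def by (rule exp_complex_eqI)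
    qed
  qed
qed

lemma log_germ_derivative:
  assumes "0 < Re (ratio a b (Fin w) / ratio a b p)" "Fin w \<noteq> a" "Fin w \<noteq> b"
  shows "((\<lambda>w. log_germ a b c p (Fin w)) has_field_derivative dlog (Fin 0) a w - dlog (Fin 0) b w) (at w)"
proof -
  let ?fa = "factor (Fin 0) a" and ?fb = "factor (Fin 0) b" and ?r = "ratio a b p"
  have eq: "ratio a b (Fin w) = ?fa w / ?fb w" for w using ratio_chart[of a b "Fin 0" w] by simp
  have nz: "?fa w \<noteq> 0" "?fb w \<noteq> 0" "?r \<noteq> 0" using assms by (auto simp: factor_eq_0_iff)
  have "((\<lambda>w. ?fa w / ?fb w) has_field_derivative
      (?fa w * dlog (Fin 0) a w * ?fb w - ?fa w * (?fb w * dlog (Fin 0) b w)) / (?fb w * ?fb w)) (at w)"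
    using assms by (intro DERIV_divide factor_derivative nz) auto
  from DERIV_cdivide[OF this, of ?r]
  have r: "((\<lambda>w. ?fa w / ?fb w / ?r) has_field_derivative
      (?fa w * dlog (Fin 0) a w * ?fb w - ?fa w * (?fb w * dlog (Fin 0) b w)) / (?fb w * ?fb w) / ?r) (at w)" .
  have "?fa w / ?fb w / ?r \<notin> \<real>\<^sub>\<le>\<^sub>0"
    using assms(1) unfolding eq by (auto simp: complex_nonpos_Reals_iff)
  from DERIV_chain2[OF has_field_derivative_Ln[OF this] r]
  have "((\<lambda>w. c + Ln (?fa w / ?fb w / ?r)) has_field_derivative 0 +
     inverse (?fa w / ?fb w / ?r) * ((?fa w * dlog (Fin 0) a w * ?fb w - ?fa w * (?fb w * dlog (Fin 0) b w)) / (?fb w * ?fb w) / ?r)) (at w)"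
    by (intro DERIV_add DERIV_const)
  then show ?thesis
    unfolding log_germ_def eq by (rule DERIV_cong) (use nz in \<open>simp add: field_simps\<close>)
qed

section \<open>Winding numbers around the singular points\<close>

text \<open>If \<open>p = a\<close> the factor is \<open>t\<close> itself, with an explicit
  logarithm that gains one period. Otherwise it is affine and has no zero in the disc, so
  \<open>1 + (v / u) t\<close> stays in the right half plane and its principal logarithm returns to
  its initial value.\<close>

lemma factor_log_on_circle:
  assumes "r > 0" and nz: "\<And>t. t \<noteq> 0 \<Longrightarrow> norm t \<le> r \<Longrightarrow> chart p t \<noteq> a"
  obtains l where "path l" "\<And>s. exp (l s) = factor p a (circlepath 0 r s)"
    "l 1 - l 0 = (if p = a then 2 * of_real pi * \<i> else 0)"
proof (cases "p = a")
  case True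
  define l where "l = (\<lambda>s::real. of_real (ln r) + 2 * of_real pi * \<i> * of_real s :: complex)"
  have "path l" unfolding path_def l_def by (intro continuous_intros)
  moreover have "exp (l s) = factor p a (circlepath 0 r s)" for s
    using True \<open>r > 0\<close> by (simp add: l_def exp_add factor_self circlepath exp_of_real)
  ultimately show ?thesis using that[of l] True by (simp add: l_def)
next
  case False
  obtain u v where uv: "\<And>t. factor p a t = u + v * t" using factor_affine by blast
  have u: "u \<noteq> 0" using uv[of 0] False factor_eq_0_iff[of p a 0] by auto
  have small: "norm (v / u) * r < 1"
  proof (rule ccontr)
    assume "\<not> ?thesis"
    then have ge: "norm (v / u) * r \<ge> 1" by simp
    then have v: "v \<noteq> 0" by auto
    have "norm (- u / v) \<le> r" using ge u v by (simp add: norm_divide field_simps)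
    then have "chart p (- u / v) \<noteq> a" using u v by (intro nz) auto
    then show False using uv[of "- u / v"] v factor_eq_0_iff[of p a "- u / v"] by simp
  qed
  define l where "l = (\<lambda>s. Ln u + Ln (1 + (v / u) * circlepath 0 r s))"
  have re: "0 < Re (1 + (v / u) * circlepath 0 r s)" for s
  proof -
    have "norm ((v / u) * circlepath 0 r s) = norm (v / u) * r"
      using \<open>r > 0\<close> by (simp add: norm_mult norm_divide circlepath norm_exp_eq_Re)
    then show ?thesis using small abs_Re_le_cmod[of "(v / u) * circlepath 0 r s"] by simp
  qed
  have "path l"
    unfolding path_def l_def
  proof (intro continuous_intros)
    show "continuous_on {0..1} (circlepath 0 r)" using path_circlepath unfolding path_def by blast
    show "1 + (v / u) * circlepath 0 r s \<notin> \<real>\<^sub>\<le>\<^sub>0" for s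
      using re[of s] by (auto simp: complex_nonpos_Reals_iff)
  qed
  moreover have "exp (l s) = factor p a (circlepath 0 r s)" for s
  proof -
    have "1 + (v / u) * circlepath 0 r s \<noteq> 0"
      using re[of s] by (metis less_irrefl zero_complex.simps(1))
    then show ?thesis using u by (simp add: l_def exp_add uv field_simps)
  qed
  moreover have "l 1 = l 0" unfolding l_def by (simp add: circlepath)
  ultimately show ?thesis using that[of l] False by simp
qed

lemma winding_number_ratio_circle:
  assumes "r > 0" "\<And>t. t \<noteq> 0 \<Longrightarrow> norm t \<le> r \<Longrightarrow> chart p t \<noteq> a \<and> chart p t \<noteq> b"
  shows "winding_number (ratio a b \<circ> (chart p \<circ> circlepath 0 r)) 0 = of_bool (p = a) - of_bool (p = b)"
proof -
  obtain la where la: "path la" "\<And>s. exp (la s) = factor p a (circlepath 0 r s)"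
    "la 1 - la 0 = (if p = a then 2 * of_real pi * \<i> else 0)"
    using factor_log_on_circle[OF assms(1), of p a] assms(2) by blast
  obtain lb where lb: "path lb" "\<And>s. exp (lb s) = factor p b (circlepath 0 r s)"
    "lb 1 - lb 0 = (if p = b then 2 * of_real pi * \<i> else 0)"
    using factor_log_on_circle[OF assms(1), of p b] assms(2) by blast
  let ?l = "\<lambda>s. la s - lb s"
  have eq: "ratio a b \<circ> (chart p \<circ> circlepath 0 r) = exp \<circ> ?l"
    by (simp add: fun_eq_iff ratio_chart exp_diff la(2) lb(2))
  have "path ?l" using la(1) lb(1) unfolding path_def by (intro continuous_intros)
  then have "winding_number (exp \<circ> ?l) 0 = (?l 1 - ?l 0) / (2 * of_real pi * \<i>)"
    using winding_number_compose_exp[of ?l] by (simp add: pathstart_def pathfinish_def)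
  also have "?l 1 - ?l 0 = (la 1 - la 0) - (lb 1 - lb 0)" by simp
  finally show ?thesis unfolding eq la(3) lb(3) by (auto simp: o_def)
qed

section \<open>Equations with power solutions\<close>

lemma pole_order_at_most_mono:
  assumes "pole_order_at_most k f" "k \<le> n"
  shows "pole_order_at_most n f"
proof -
  obtain g where g: "g analytic_on {0}" "\<forall>\<^sub>F t in at 0. f t = g t / t ^ k"
    using assms(1) unfolding pole_order_at_most_def by blast
  have "\<forall>\<^sub>F t::complex in at 0. t \<noteq> 0" by (simp add: eventually_at_filter)
  with g(2) have "\<forall>\<^sub>F t in at 0. f t = (g t * t ^ (n - k)) / t ^ n"
  proof eventually_elim
    case (elim t)
    have "t ^ n = t ^ k * t ^ (n - k)" using assms(2) by (simp add: power_add[symmetric])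
    then show ?case using elim by simp
  qed
  moreover have "(\<lambda>t. g t * t ^ (n - k)) analytic_on {0}" using g(1) by (intro analytic_intros)
  ultimately show ?thesis unfolding pole_order_at_most_def by blast
qed

lemma pole_order_at_most_add:
  assumes "pole_order_at_most k f" "pole_order_at_most k g"
  shows "pole_order_at_most k (\<lambda>t. f t + g t)"
proof -
  obtain F G where F: "F analytic_on {0}" "\<forall>\<^sub>F t in at 0. f t = F t / t ^ k"
    and G: "G analytic_on {0}" "\<forall>\<^sub>F t in at 0. g t = G t / t ^ k"
    using assms unfolding pole_order_at_most_def by blast
  have "\<forall>\<^sub>F t in at 0. f t + g t = (F t + G t) / t ^ k"
    using F(2) G(2) by eventually_elim (simp add: add_divide_distrib)
  moreover have "(\<lambda>t. F t + G t) analytic_on {0}" using F(1) G(1) by (intro analytic_intros)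
  ultimately show ?thesis unfolding pole_order_at_most_def by blast
qed

lemma pole_order_at_most_mult:
  assumes "pole_order_at_most k f" "pole_order_at_most n g"
  shows "pole_order_at_most (k + n) (\<lambda>t. f t * g t)"
proof -
  obtain F G where F: "F analytic_on {0}" "\<forall>\<^sub>F t in at 0. f t = F t / t ^ k"
    and G: "G analytic_on {0}" "\<forall>\<^sub>F t in at 0. g t = G t / t ^ n"
    using assms unfolding pole_order_at_most_def by blast
  have "\<forall>\<^sub>F t in at 0. f t * g t = (F t * G t) / t ^ (k + n)"
    using F(2) G(2) by eventually_elim (simp add: power_add)
  moreover have "(\<lambda>t. F t * G t) analytic_on {0}" using F(1) G(1) by (intro analytic_intros)
  ultimately show ?thesis unfolding pole_order_at_most_def by blast
qed

lemma pole_order_at_most_const: "pole_order_at_most 0 (\<lambda>t. c)"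
  unfolding pole_order_at_most_def by (intro exI[of _ "\<lambda>t. c"]) auto

lemma pole_order_at_most_cmult:
  "pole_order_at_most k f \<Longrightarrow> pole_order_at_most k (\<lambda>t. c * f t)"
  using pole_order_at_most_mult[OF pole_order_at_most_const, of k f c] by simp

lemma pole_order_at_most_diff:
  "pole_order_at_most k f \<Longrightarrow> pole_order_at_most k g \<Longrightarrow> pole_order_at_most k (\<lambda>t. f t - g t)"
  using pole_order_at_most_add[of k f "\<lambda>t. - 1 * g t"] pole_order_at_most_cmult[of k g "- 1"] by simp

lemma pole_order_at_most_cong:
  assumes "pole_order_at_most k f" "\<forall>\<^sub>F t in at 0. g t = f t"
  shows "pole_order_at_most k g"
proof -
  obtain F where F: "F analytic_on {0}" "\<forall>\<^sub>F t in at 0. f t = F t / t ^ k"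
    using assms unfolding pole_order_at_most_def by blast
  have "\<forall>\<^sub>F t in at 0. g t = F t / t ^ k" using F(2) assms(2) by eventually_elim simp
  then show ?thesis unfolding pole_order_at_most_def using F(1) by blast
qed

lemma pole_order_dlog:
  "p \<noteq> a \<Longrightarrow> pole_order_at_most 0 (dlog p a)" "pole_order_at_most 1 (dlog p a)"
proof -
  show 0: "pole_order_at_most 0 (dlog p a)" if "p \<noteq> a"
  proof -
    have "dlog p a analytic_on {0}"
    proof (cases p; cases a)
      fix c b assume [simp]: "p = Fin c" "a = Fin b"
      have "dlog p a = (\<lambda>t. 1 / (c + t - b))" by auto
      then show ?thesis using that by (auto intro!: analytic_intros)
    next
      fix c assume [simp]: "p = Fin c" "a = Infty"
      have "dlog p a = (\<lambda>t. 0)" by auto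
      then show ?thesis by (auto intro!: analytic_intros)
    next
      fix b assume [simp]: "p = Infty" "a = Fin b"
      have "dlog p a = (\<lambda>t. - b / (1 - b * t))" by auto
      then show ?thesis by (auto intro!: analytic_intros)
    qed (use that in auto)
    then show ?thesis unfolding pole_order_at_most_def by (intro exI[of _ "dlog p a"]) simp
  qed
  show "pole_order_at_most 1 (dlog p a)"
  proof (cases "p = a")
    case True
    then have "dlog p a = (\<lambda>t. 1 / t)" by (cases p) (auto simp: fun_eq_iff)
    then show ?thesis unfolding pole_order_at_most_def by (intro exI[of _ "\<lambda>t. 1"]) auto
  qed (use 0 pole_order_at_most_mono[of 0] in auto)
qed

text \<open>The two solutions have exponents \<open>l\<close> and \<open>l + \<nu>\<close> at
  \<open>p1\<close>, and \<open>m\<close> and \<open>m - \<nu>\<close> at \<open>p2\<close>. Both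
  have the factor with exponent \<open>- (l + m)\<close> at \<open>p3\<close>, where their quotient
  is holomorphic and nonzero.\<close>

locale power_solutions =
  fixes p1 p2 p3 :: cp1 and l m \<nu> :: complex
  assumes distinct: "p1 \<noteq> p2" "p1 \<noteq> p3" "p2 \<noteq> p3" and \<nu>: "\<nu> \<noteq> 0"
begin

abbreviation D :: "cp1 set" where "D \<equiv> {p1, p2, p3}"

text \<open>In the coordinate at \<open>p\<close>, the logarithmic derivatives of the two solutions are \<open>u\<close> and \<open>u + v\<close>,
  and \<open>c1, c2\<close> are the coefficients of the equation that they satisfy.\<close>

definition u :: "cp1 \<Rightarrow> complex \<Rightarrow> complex" where
  "u p t = l * dlog p p1 t + m * dlog p p2 t - (l + m) * dlog p p3 t"

definition v :: "cp1 \<Rightarrow> complex \<Rightarrow> complex" where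
  "v p t = \<nu> * (dlog p p1 t - dlog p p2 t)"

text \<open>For a solution with logarithmic derivative \<open>r\<close> the equation reads
  \<open>r' + r^2 + c1 r + c2 = 0\<close>. Taking \<open>r = u\<close> and \<open>r = u + v\<close>
  gives \<open>c1 = - v' / v - 2 u - v\<close>. As
  \<open>v' / v = - (dlog p p1 + dlog p p2)\<close>, no division by \<open>v\<close> is
  left.\<close>

definition c1 :: "cp1 \<Rightarrow> complex \<Rightarrow> complex" where
  "c1 p t = dlog p p1 t + dlog p p2 t - 2 * u p t - v p t"

definition c2 :: "cp1 \<Rightarrow> complex \<Rightarrow> complex" where
  "c2 p t = l * (dlog p p1 t * dlog p p1 t) + m * (dlog p p2 t * dlog p p2 t)
     - (l + m) * (dlog p p3 t * dlog p p3 t)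
     - u p t * (dlog p p1 t + dlog p p2 t - u p t - v p t)"

text \<open>\<open>c1\<close> has degree 1 and \<open>c2\<close> degree 2 in the logarithmic
  derivatives. The case \<open>k = 0\<close> serves infinity as an ordinary point,
  \<open>k = 1\<close> the singular points.\<close>

lemma pole_order_coefficients:
  assumes "\<And>a. a \<in> D \<Longrightarrow> pole_order_at_most k (dlog p a)"
  shows "pole_order_at_most k (c1 p)" "pole_order_at_most (k + k) (c2 p)"
proof -
  note intros = pole_order_at_most_add pole_order_at_most_diff pole_order_at_most_cmult
    pole_order_at_most_mult
  have d: "pole_order_at_most k (dlog p p1)" "pole_order_at_most k (dlog p p2)" "pole_order_at_most k (dlog p p3)"
    using assms by auto
  have uv: "pole_order_at_most k (u p)" "pole_order_at_most k (v p)"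
    unfolding u_def v_def by (intro intros d)+
  show "pole_order_at_most k (c1 p)" unfolding c1_def by (intro intros d uv)
  show "pole_order_at_most (k + k) (c2 p)" unfolding c2_def by (intro intros d uv)
qed

text \<open>The extra \<open>t\<close> comes from \<open>z - b = (1 - b t) / t\<close>. In
  \<open>u\<close> and \<open>v\<close> these terms cancel because the exponents add up to zero; in
  \<open>c1\<close> a term \<open>2 * t\<close> remains, which \<open>coeff1\<close>
  compensates.\<close>

lemma dlog_infinity:
  assumes "t \<noteq> 0" "Fin (1 / t) \<noteq> a"
  shows "dlog (Fin 0) a (1 / t) = t - t\<^sup>2 * dlog Infty a t"
proof (cases a)
  case (Fin b)
  then have "1 - b * t \<noteq> 0" using assms by (auto simp: field_simps)
  moreover have "1 / t - b = (1 - b * t) / t" using assms by (simp add: field_simps)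
  ultimately show ?thesis using Fin assms by (simp add: field_simps power2_eq_square)
qed (use assms in \<open>auto simp: power2_eq_square\<close>)

lemma coefficients_in_chart:
  assumes "t \<noteq> 0" "chart p t \<notin> D"
  shows "coeff1 (c1 (Fin 0)) p t = c1 p t" "coeff2 (c2 (Fin 0)) p t = c2 p t"
proof -
  have "coeff1 (c1 (Fin 0)) p t = c1 p t \<and> coeff2 (c2 (Fin 0)) p t = c2 p t"
  proof (cases p)
    case (Fin c)
    have "dlog (Fin 0) a (c + t) = dlog (Fin c) a t" for a by (cases a) auto
    then show ?thesis using Fin by (simp add: c1_def c2_def u_def v_def)
  next
    case Infty
    then have "Fin (1 / t) \<noteq> p1" "Fin (1 / t) \<noteq> p2" "Fin (1 / t) \<noteq> p3" using assms by auto
    note dl = this[THEN dlog_infinity[OF assms(1)]]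
    have u: "u (Fin 0) (1 / t) = - t\<^sup>2 * u Infty t" unfolding u_def dl by (simp add: algebra_simps)
    have v: "v (Fin 0) (1 / t) = - t\<^sup>2 * v Infty t" unfolding v_def dl by (simp add: algebra_simps)
    have s: "dlog (Fin 0) p1 (1 / t) + dlog (Fin 0) p2 (1 / t) = 2 * t - t\<^sup>2 * (dlog Infty p1 t + dlog Infty p2 t)"
      unfolding dl by (simp add: algebra_simps)
    have 1: "c1 (Fin 0) (1 / t) = 2 * t - t\<^sup>2 * c1 Infty t"
      unfolding c1_def s u v by (simp add: algebra_simps)
    have q: "l * (dlog (Fin 0) p1 (1 / t) * dlog (Fin 0) p1 (1 / t)) + m * (dlog (Fin 0) p2 (1 / t) * dlog (Fin 0) p2 (1 / t))
        - (l + m) * (dlog (Fin 0) p3 (1 / t) * dlog (Fin 0) p3 (1 / t)) =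
      t ^ 4 * (l * (dlog Infty p1 t * dlog Infty p1 t) + m * (dlog Infty p2 t * dlog Infty p2 t)
        - (l + m) * (dlog Infty p3 t * dlog Infty p3 t)) - 2 * t ^ 3 * u Infty t"
      unfolding dl u_def by (simp add: algebra_simps power2_eq_square power3_eq_cube power4_eq_xxxx)
    have 2: "c2 (Fin 0) (1 / t) = t ^ 4 * c2 Infty t"
      unfolding c2_def q s u v by (simp add: algebra_simps power2_eq_square power3_eq_cube power4_eq_xxxx)
    have "coeff1 (c1 (Fin 0)) p t = 2 / t - (2 * t - t\<^sup>2 * c1 Infty t) / t\<^sup>2" using Infty 1 by simp
    also have "\<dots> = c1 Infty t" using assms(1) by (simp add: field_simps power2_eq_square)
    finally show ?thesis using Infty 2 assms(1) by simp
  qed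
  then show "coeff1 (c1 (Fin 0)) p t = c1 p t" "coeff2 (c2 (Fin 0)) p t = c2 p t" by auto
qed

lemma coefficients_in_chart_near:
  "\<forall>\<^sub>F t in at 0. coeff1 (c1 (Fin 0)) p t = c1 p t" "\<forall>\<^sub>F t in at 0. coeff2 (c2 (Fin 0)) p t = c2 p t"
proof -
  obtain R where R: "R > 0" "\<And>t. t \<in> ball 0 R - {0} \<Longrightarrow> chart p t \<notin> D"
    using punctured_chart_ball[of D p] by blast
  have "\<forall>\<^sub>F t in at 0. t \<in> ball 0 R - {0}" using R(1) by (auto simp: eventually_at dist_commute intro!: exI[of _ R])
  then show "\<forall>\<^sub>F t in at 0. coeff1 (c1 (Fin 0)) p t = c1 p t" "\<forall>\<^sub>F t in at 0. coeff2 (c2 (Fin 0)) p t = c2 p t"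
    by (eventually_elim, use R(2) coefficients_in_chart in auto)+
qed

lemma dlog_Fin_holomorphic: "a \<in> D \<Longrightarrow> dlog (Fin 0) a holomorphic_on {w. Fin w \<notin> D}"
proof -
  assume a: "a \<in> D"
  show ?thesis
  proof (rule holomorphic_on_subset)
    show "dlog (Fin 0) a holomorphic_on {w. Fin w \<noteq> a}"
      unfolding holomorphic_on_def field_differentiable_def
      using dlog_derivative[of "Fin 0" _ a] has_field_derivative_at_within by fastforce
  qed (use a in auto)
qed

lemma riemann_equation_power: "riemann_equation D (c1 (Fin 0)) (c2 (Fin 0))"
  unfolding riemann_equation_def
proof (intro conjI impI ballI)
  show "c1 (Fin 0) holomorphic_on {z. Fin z \<notin> D}" "c2 (Fin 0) holomorphic_on {z. Fin z \<notin> D}"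
    unfolding c1_def c2_def u_def v_def by (intro holomorphic_intros dlog_Fin_holomorphic; simp)+
next
  assume "Infty \<notin> D"
  then have "pole_order_at_most 0 (dlog Infty a)" if "a \<in> D" for a using that by (intro pole_order_dlog) auto
  from pole_order_coefficients[OF this]
  have "pole_order_at_most 0 (c1 Infty)" "pole_order_at_most 0 (c2 Infty)" by auto
  then show "pole_order_at_most 0 (coeff1 (c1 (Fin 0)) Infty)" "pole_order_at_most 0 (coeff2 (c2 (Fin 0)) Infty)"
    by (blast intro: pole_order_at_most_cong[OF _ coefficients_in_chart_near(1)]
        pole_order_at_most_cong[OF _ coefficients_in_chart_near(2)])+
next
  fix p assume "p \<in> D"
  have "pole_order_at_most 1 (c1 p)" "pole_order_at_most (1 + 1) (c2 p)"
    by (rule pole_order_coefficients, rule pole_order_dlog)+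
  then have "pole_order_at_most 1 (c1 p)" "pole_order_at_most 2 (c2 p)" by (simp_all add: numeral_2_eq_2)
  then show "pole_order_at_most 1 (coeff1 (c1 (Fin 0)) p)" "pole_order_at_most 2 (coeff2 (c2 (Fin 0)) p)"
    by (blast intro: pole_order_at_most_cong[OF _ coefficients_in_chart_near(1)]
        pole_order_at_most_cong[OF _ coefficients_in_chart_near(2)])+
qed

text \<open>\<open>a\<close> and \<open>b\<close> are the values at \<open>p\<close> of the
  logarithms of \<open>ratio p1 p3\<close> and \<open>ratio p2 p3\<close>; they select the branch of
  both power functions.\<close>

definition power_germ :: "complex \<Rightarrow> complex \<Rightarrow> cp1 \<Rightarrow> cp1 \<Rightarrow> complex^2" where
  "power_germ a b p q =
     vector [exp (l * log_germ p1 p3 a p q + m * log_germ p2 p3 b p q),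
             exp ((l + \<nu>) * log_germ p1 p3 a p q + (m - \<nu>) * log_germ p2 p3 b p q)]"

lemma analytic_power_germ:
  assumes "p \<notin> D"
  shows "analytic_at_cp1 (\<lambda>q. power_germ a b p q $ j) p"
proof -
  have an: "(\<lambda>t. log_germ p1 p3 a p (chart p t)) analytic_on {0}" "(\<lambda>t. log_germ p2 p3 b p (chart p t)) analytic_on {0}"
    using analytic_log_germ[of p p1 p3 a] analytic_log_germ[of p p2 p3 b] assms
    by (auto simp: analytic_at_cp1_def o_def)
  have "j = 1 \<or> j = 2" by (rule exhaust_2)
  then show ?thesis
    unfolding analytic_at_cp1_def power_germ_def o_def by (auto intro!: analytic_intros an)
qed

text \<open>Here the principal logarithms in both log germs are differentiable.\<close>

definition positive_near :: "cp1 \<Rightarrow> cp1 set" where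
  "positive_near p = {q. q \<notin> D \<and> 0 < Re (ratio p1 p3 q / ratio p1 p3 p) \<and> 0 < Re (ratio p2 p3 q / ratio p2 p3 p)}"

lemma eventually_positive_near:
  assumes "p \<notin> D"
  shows "\<forall>\<^sub>F q in nhds p. q \<in> positive_near p"
proof -
  have "\<forall>\<^sub>F q in nhds p. 0 < Re (ratio p1 p3 q / ratio p1 p3 p)" "\<forall>\<^sub>F q in nhds p. 0 < Re (ratio p2 p3 q / ratio p2 p3 p)"
    using assms by (intro ratio_positive_near; simp)+
  moreover have "\<forall>\<^sub>F q in nhds p. q \<in> - D"
    using assms by (intro eventually_nhds_in_open closed_finite_cp1) auto
  ultimately show ?thesis unfolding positive_near_def by eventually_elim auto
qed

lemma power_germ_derivative:
  assumes w: "Fin w \<in> positive_near p"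
  shows "(comp1 (power_germ a b p) has_field_derivative u (Fin 0) w * comp1 (power_germ a b p) w) (at w)"
    and "(comp2 (power_germ a b p) has_field_derivative (u (Fin 0) w + v (Fin 0) w) * comp2 (power_germ a b p) w) (at w)"
proof -
  have 1: "((\<lambda>w. log_germ p1 p3 a p (Fin w)) has_field_derivative dlog (Fin 0) p1 w - dlog (Fin 0) p3 w) (at w)"
    and 2: "((\<lambda>w. log_germ p2 p3 b p (Fin w)) has_field_derivative dlog (Fin 0) p2 w - dlog (Fin 0) p3 w) (at w)"
    using w by (auto simp: positive_near_def intro!: log_germ_derivative)
  show "(comp1 (power_germ a b p) has_field_derivative u (Fin 0) w * comp1 (power_germ a b p) w) (at w)"
    unfolding power_germ_def vector_2
    by (rule DERIV_cong[OF DERIV_fun_exp[OF DERIV_add[OF DERIV_cmult[OF 1] DERIV_cmult[OF 2]]]])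
      (simp add: u_def algebra_simps)
  show "(comp2 (power_germ a b p) has_field_derivative (u (Fin 0) w + v (Fin 0) w) * comp2 (power_germ a b p) w) (at w)"
    unfolding power_germ_def vector_2
    by (rule DERIV_cong[OF DERIV_fun_exp[OF DERIV_add[OF DERIV_cmult[OF 1] DERIV_cmult[OF 2]]]])
      (simp add: u_def v_def algebra_simps)
qed

lemma log_derivative_derivatives:
  assumes "Fin w \<notin> D"
  shows "(u (Fin 0) has_field_derivative
      - (l * (dlog (Fin 0) p1 w)\<^sup>2 + m * (dlog (Fin 0) p2 w)\<^sup>2 - (l + m) * (dlog (Fin 0) p3 w)\<^sup>2)) (at w)"
    and "(v (Fin 0) has_field_derivative - v (Fin 0) w * (dlog (Fin 0) p1 w + dlog (Fin 0) p2 w)) (at w)"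
proof -
  have d: "(dlog (Fin 0) p1 has_field_derivative - (dlog (Fin 0) p1 w)\<^sup>2) (at w)"
    "(dlog (Fin 0) p2 has_field_derivative - (dlog (Fin 0) p2 w)\<^sup>2) (at w)"
    "(dlog (Fin 0) p3 has_field_derivative - (dlog (Fin 0) p3 w)\<^sup>2) (at w)"
    using assms by (intro dlog_derivative; auto)+
  show "(u (Fin 0) has_field_derivative
      - (l * (dlog (Fin 0) p1 w)\<^sup>2 + m * (dlog (Fin 0) p2 w)\<^sup>2 - (l + m) * (dlog (Fin 0) p3 w)\<^sup>2)) (at w)"
    unfolding u_def by (rule derivative_eq_intros refl d)+ (simp add: algebra_simps)
  show "(v (Fin 0) has_field_derivative - v (Fin 0) w * (dlog (Fin 0) p1 w + dlog (Fin 0) p2 w)) (at w)"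
    unfolding v_def by (rule derivative_eq_intros refl d)+ (simp add: algebra_simps power2_eq_square)
qed

lemma open_positive_near_Fin:
  assumes "Fin w \<in> positive_near p" "p \<notin> D"
  shows "\<forall>\<^sub>F w' in nhds w. Fin w' \<in> positive_near p"
proof -
  have w: "Fin w \<notin> D" using assms by (simp add: positive_near_def)
  have "((\<lambda>q. Re (ratio a p3 q / ratio a p3 p)) \<longlongrightarrow> Re (ratio a p3 (Fin w) / ratio a p3 p)) (nhds (Fin w))" if "a \<in> {p1, p2}" for a
    using w that assms(2) by (intro tendsto_intros analytic_at_cp1_tendsto analytic_ratio ratio_nonzero) auto
  from this[THEN order_tendstoD(1)]
  have "\<forall>\<^sub>F q in nhds (Fin w). 0 < Re (ratio p1 p3 q / ratio p1 p3 p)" "\<forall>\<^sub>F q in nhds (Fin w). 0 < Re (ratio p2 p3 q / ratio p2 p3 p)"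
    using assms(1) by (auto simp: positive_near_def)
  moreover have "\<forall>\<^sub>F q in nhds (Fin w). q \<in> - D"
    using w by (intro eventually_nhds_in_open closed_finite_cp1) auto
  ultimately have "\<forall>\<^sub>F q in nhds (Fin w). q \<in> positive_near p" unfolding positive_near_def by eventually_elim auto
  then show ?thesis by (simp add: eventually_nhds_Fin)
qed

lemma power_germ_ode:
  assumes w: "Fin w \<in> positive_near p" and p: "p \<notin> D"
  shows "ode_lhs (c1 (Fin 0)) (c2 (Fin 0)) (\<lambda>q. power_germ a b p q $ j) w = 0"
proof -
  have wD: "Fin w \<notin> D" using w by (simp add: positive_near_def)
  note ev = open_positive_near_Fin[OF w p]
  \<comment> \<open>From \<open>f' = r f\<close> follows \<open>f'' = (r' + r^2) f\<close>, which
    reduces the equation to a polynomial identity between logarithmic derivatives.\<close>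
  have second: "deriv f w = r w * f w" "deriv (deriv f) w = (r' + (r w)\<^sup>2) * f w"
    if f: "\<And>w. Fin w \<in> positive_near p \<Longrightarrow> (f has_field_derivative r w * f w) (at w)"
      and r: "(r has_field_derivative r') (at w)" for f r r'
  proof -
    show "deriv f w = r w * f w" using f[OF w] by (rule DERIV_imp_deriv)
    have "deriv (deriv f) w = deriv (\<lambda>w. r w * f w) w"
      by (rule deriv_cong_ev[OF _ refl]) (use ev f in \<open>auto elim!: eventually_mono intro: DERIV_imp_deriv\<close>)
    also have "\<dots> = r' * f w + r w * f w * r w"
      by (rule DERIV_imp_deriv, rule DERIV_mult[OF r f[OF w]])
    finally show "deriv (deriv f) w = (r' + (r w)\<^sup>2) * f w" by (simp add: algebra_simps power2_eq_square)
  qed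
  let ?S = "l * (dlog (Fin 0) p1 w)\<^sup>2 + m * (dlog (Fin 0) p2 w)\<^sup>2 - (l + m) * (dlog (Fin 0) p3 w)\<^sup>2"
  have d1: "deriv (comp1 (power_germ a b p)) w = u (Fin 0) w * comp1 (power_germ a b p) w"
      "deriv (deriv (comp1 (power_germ a b p))) w = (- ?S + (u (Fin 0) w)\<^sup>2) * comp1 (power_germ a b p) w"
    by (rule second[OF _ log_derivative_derivatives(1)[OF wD]], erule power_germ_derivative(1))+
  have d2: "deriv (comp2 (power_germ a b p)) w = (u (Fin 0) w + v (Fin 0) w) * comp2 (power_germ a b p) w"
      "deriv (deriv (comp2 (power_germ a b p))) w =
        (- ?S + - v (Fin 0) w * (dlog (Fin 0) p1 w + dlog (Fin 0) p2 w) + (u (Fin 0) w + v (Fin 0) w)\<^sup>2) * comp2 (power_germ a b p) w"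
    by (rule second[OF _ DERIV_add[OF log_derivative_derivatives[OF wD]]], erule power_germ_derivative(2))+
  have "j = 1 \<or> j = 2" by (rule exhaust_2)
  then show ?thesis
  proof
    assume "j = 1"
    then show ?thesis
      unfolding \<open>j = 1\<close> d1 by (simp add: c1_def c2_def algebra_simps power2_eq_square)
  next
    assume "j = 2"
    then show ?thesis
      unfolding \<open>j = 2\<close> d2 by (simp add: c1_def c2_def algebra_simps power2_eq_square)
  qed
qed

lemma power_germ_solution:
  assumes "p \<notin> D"
  shows "solution_near (c1 (Fin 0)) (c2 (Fin 0)) p (\<lambda>q. power_germ a b p q $ j)"
proof -
  have "ode_near (c1 (Fin 0)) (c2 (Fin 0)) p (\<lambda>q. power_germ a b p q $ j)"
    unfolding ode_near_def using eventually_positive_near[OF assms]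
    by (rule eventually_mono) (use power_germ_ode[OF _ assms] in blast)
  then show ?thesis using analytic_power_germ[OF assms] by (simp add: solution_near_iff)
qed

lemma power_germ_nonzero: "power_germ a b p q $ j \<noteq> 0"
  using exhaust_2[of j] by (auto simp: power_germ_def)

lemma v_nonzero:
  assumes "Fin w \<notin> D"
  shows "v (Fin 0) w \<noteq> 0"
proof -
  have "dlog (Fin 0) p1 w \<noteq> dlog (Fin 0) p2 w"
    using distinct(1) assms by (cases p1; cases p2) (auto simp: field_simps)
  then show ?thesis using \<nu> by (simp add: v_def)
qed

end

section \<open>Independence and spanning for the power solutions\<close>

lemma finite_point_near:
  assumes "\<forall>\<^sub>F q in nhds p. Q q" "e > 0"
  obtains t where "t \<noteq> 0" "t \<in> ball 0 e" "Q (chart p t)"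
proof -
  have "\<forall>\<^sub>F t in nhds 0. Q (chart p t) \<and> t \<in> ball 0 e"
    using assms by (intro eventually_conj eventually_nhds_in_open) (auto simp: eventually_nhds_cp1)
  then have "\<forall>\<^sub>F t in at 0. t \<noteq> 0 \<and> Q (chart p t) \<and> t \<in> ball 0 e"
    unfolding eventually_at_filter by eventually_elim simp
  then obtain t where "t \<noteq> 0 \<and> Q (chart p t) \<and> t \<in> ball 0 e"
    using eventually_happens[of _ "at (0::complex)"] by auto
  then show ?thesis using that by blast
qed

lemma solution_basis_iff:
  "solution_basis b1 b2 p Y \<longleftrightarrow>
     (\<forall>j. solution_near b1 b2 p (\<lambda>q. Y q $ j)) \<and> independent_near p Y \<and>
     (\<forall>y. solution_near b1 b2 p y \<longrightarrow>
        (\<exists>c :: complex^2. \<forall>\<^sub>F q in nhds p. y q = (\<Sum>j\<in>UNIV. c $ j * Y q $ j)))"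
  unfolding solution_basis_def independent_near_def ..

lemma solution_basis_matrix:
  assumes "solution_basis b1 b2 p Y" "invertible M"
  shows "solution_basis b1 b2 p (\<lambda>q. Y q v* M)"
  unfolding solution_basis_iff
proof (intro conjI allI impI)
  show "solution_near b1 b2 p (\<lambda>q. (Y q v* M) $ j)" for j
    using assms(1) by (intro solution_near_matrix) (simp add: solution_basis_iff)
  show "independent_near p (\<lambda>q. Y q v* M)"
    using assms by (intro independent_near_matrix) (auto simp: solution_basis_iff)
  fix y assume "solution_near b1 b2 p y"
  then obtain c :: "complex^2" where c: "\<forall>\<^sub>F q in nhds p. y q = (\<Sum>j\<in>UNIV. c $ j * Y q $ j)"
    using assms(1) unfolding solution_basis_iff by blast
  have "M *v (matrix_inv M *v c) = c"
    by (simp add: matrix_vector_mul_assoc matrix_inv_both[OF assms(2)])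
  then show "\<exists>c :: complex^2. \<forall>\<^sub>F q in nhds p. y q = (\<Sum>j\<in>UNIV. c $ j * (Y q v* M) $ j)"
    unfolding sum_vector_matrix using c by (intro exI[of _ "matrix_inv M *v c"]) simp
qed

context power_solutions
begin

abbreviation b1 :: "complex \<Rightarrow> complex" where "b1 \<equiv> c1 (Fin 0)"
abbreviation b2 :: "complex \<Rightarrow> complex" where "b2 \<equiv> c2 (Fin 0)"

text \<open>A linear relation is differentiated at a finite point. Subtracting \<open>u\<close>
  times the relation leaves the second coefficient times \<open>v\<close> times the second solution,
  and the last two are nonzero.\<close>

lemma power_germ_independent:
  assumes p: "p \<notin> D"
  shows "independent_near p (power_germ a b p)"
  unfolding independent_near_def
proof (intro allI impI)
  fix c :: "complex^2"
  let ?g = "power_germ a b p"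
  assume "\<forall>\<^sub>F q in nhds p. (\<Sum>j\<in>UNIV. c $ j * ?g q $ j) = 0"
  then have "\<forall>\<^sub>F q in nhds p. \<forall>\<^sub>F r in nhds q. (\<Sum>j\<in>UNIV. c $ j * ?g r $ j) = 0"
    by (simp add: eventually_eventually)
  with eventually_positive_near[OF p]
  have ev0: "\<forall>\<^sub>F q in nhds p. q \<in> positive_near p \<and> (\<forall>\<^sub>F r in nhds q. (\<Sum>j\<in>UNIV. c $ j * ?g r $ j) = 0)"
    by eventually_elim simp
  obtain t where t: "t \<noteq> 0" "chart p t \<in> positive_near p"
    "\<forall>\<^sub>F r in nhds (chart p t). (\<Sum>j\<in>UNIV. c $ j * ?g r $ j) = 0"
    using finite_point_near[OF ev0 zero_less_one] by blast
  define w where "w = finite_coord p t"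
  have w: "Fin w \<in> positive_near p" "chart p t = Fin w" using t chart_eq_Fin[of t p] by (auto simp: w_def)
  have ev: "\<forall>\<^sub>F v in nhds w. c $ 1 * comp1 ?g v + c $ 2 * comp2 ?g v = 0"
    using t(3) unfolding w(2) eventually_nhds_Fin by (simp add: sum_2)
  have "((\<lambda>v. c $ 1 * comp1 ?g v + c $ 2 * comp2 ?g v) has_field_derivative
      c $ 1 * (u (Fin 0) w * comp1 ?g w) + c $ 2 * ((u (Fin 0) w + v (Fin 0) w) * comp2 ?g w)) (at w)"
    by (intro DERIV_add DERIV_cmult power_germ_derivative[OF w(1)])
  moreover have "((\<lambda>v. c $ 1 * comp1 ?g v + c $ 2 * comp2 ?g v) has_field_derivative 0) (at w)"
    using DERIV_cong_ev[OF refl ev refl, of 0] by simp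
  ultimately have "c $ 1 * (u (Fin 0) w * comp1 ?g w) + c $ 2 * ((u (Fin 0) w + v (Fin 0) w) * comp2 ?g w) = 0"
    by (rule DERIV_unique)
  then have "u (Fin 0) w * (c $ 1 * comp1 ?g w + c $ 2 * comp2 ?g w) + c $ 2 * v (Fin 0) w * comp2 ?g w = 0"
    by (simp add: algebra_simps)
  moreover have z: "c $ 1 * comp1 ?g w + c $ 2 * comp2 ?g w = 0" using eventually_nhds_x_imp_x[OF ev] .
  moreover have "v (Fin 0) w \<noteq> 0" using w(1) by (intro v_nonzero) (simp add: positive_near_def)
  ultimately have "c $ 2 = 0" using power_germ_nonzero by simp
  then have "c $ 1 = 0" using z power_germ_nonzero by simp
  with \<open>c $ 2 = 0\<close> show "c = 0" by (simp add: vec_eq_iff forall_2)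
qed

text \<open>\<open>k1\<close>, \<open>k2\<close> match value and derivative of \<open>y\<close> at a
  finite point \<open>w\<close>. That the remainder \<open>h\<close> vanishes is seen from
  Wronskians: the pair of \<open>h\<close> and the first solution has Wronskian 0 at
  \<open>w\<close>, so it is dependent, and as the first solution is nonzero at \<open>w\<close>,
  the relation reduces to \<open>h = 0\<close>.\<close>

lemma power_germ_spanning:
  assumes p: "p \<notin> D" and y: "solution_near b1 b2 p y"
  shows "\<exists>c :: complex^2. \<forall>\<^sub>F q in nhds p. y q = (\<Sum>j\<in>UNIV. c $ j * power_germ a b p q $ j)"
proof -
  let ?g = "power_germ a b p"
  have hb: "b1 holomorphic_on {w. Fin w \<notin> D}" "b2 holomorphic_on {w. Fin w \<notin> D}"
    using riemann_equation_power by (auto simp: riemann_equation_def)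
  have an: "analytic_at_cp1 y p" "\<And>j. analytic_at_cp1 (\<lambda>q. ?g q $ j) p"
    using y analytic_power_germ[OF p] by (auto simp: solution_near_iff)
  obtain e1 where e1: "e1 > 0" "(y \<circ> chart p) holomorphic_on ball 0 e1"
    using analytic_at_cp1_ball[OF an(1)] .
  obtain e2 where e2: "e2 > 0" "\<And>j. (\<lambda>t. ?g (chart p t) $ j) holomorphic_on ball 0 e2"
    using analytic_at_cp1_ball_vec[of ?g p] an(2) by blast
  define e where "e = min e1 e2"
  have e: "e > 0" "(\<lambda>t. y (chart p t)) holomorphic_on ball 0 e" "\<And>j. (\<lambda>t. ?g (chart p t) $ j) holomorphic_on ball 0 e"
  proof -
    show "e > 0" using e1 e2 by (simp add: e_def)
    show "(\<lambda>t. y (chart p t)) holomorphic_on ball 0 e"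
      using e1(2) unfolding o_def by (rule holomorphic_on_subset) (auto simp: e_def)
    show "(\<lambda>t. ?g (chart p t) $ j) holomorphic_on ball 0 e" for j
      using e2(2)[of j] by (rule holomorphic_on_subset) (auto simp: e_def)
  qed
  have sol: "\<forall>\<^sub>F q in nhds p. solution_near b1 b2 q f" if "solution_near b1 b2 p f" for f
  proof -
    have f: "analytic_at_cp1 f p" "ode_near b1 b2 p f" using that by (auto simp: solution_near_iff)
    have "\<forall>\<^sub>F q in nhds p. ode_near b1 b2 q f = ode_near b1 b2 p f"
      by (rule ode_near_locally_constant[OF _ p hb f(1)]) simp
    with eventually_analytic_at_cp1[OF f(1)] show ?thesis
      by eventually_elim (simp add: solution_near_iff f(2))
  qed
  have "\<forall>\<^sub>F q in nhds p. \<forall>j. solution_near b1 b2 q (\<lambda>q. ?g q $ j)"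
    by (intro eventually_all_finite sol power_germ_solution p)
  with sol[OF y] eventually_positive_near[OF p]
  have ev0: "\<forall>\<^sub>F q in nhds p. solution_near b1 b2 q y \<and> (\<forall>j. solution_near b1 b2 q (\<lambda>q. ?g q $ j)) \<and> q \<in> positive_near p"
    by eventually_elim simp
  obtain t where t: "t \<noteq> 0" "t \<in> ball 0 e" "solution_near b1 b2 (chart p t) y"
    "\<And>j. solution_near b1 b2 (chart p t) (\<lambda>q. ?g q $ j)" "chart p t \<in> positive_near p"
    using finite_point_near[OF ev0 e(1)] by blast
  define w where "w = finite_coord p t"
  have w: "chart p t = Fin w" using t chart_eq_Fin[of t p] by (auto simp: w_def)
  have wD: "Fin w \<notin> D" using t(5) w by (simp add: positive_near_def)
  note dg = power_germ_derivative[OF t(5)[unfolded w], of a b]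
  let ?Y = "\<lambda>w. y (Fin w)"
  have "?Y analytic_on {w}" using t(3) by (simp add: w solution_near_iff analytic_at_Fin)
  then have dY: "(?Y has_field_derivative deriv ?Y w) (at w)"
    by (simp add: analytic_on_imp_differentiable_at field_differentiable_derivI)
  \<comment> \<open>Solved from \<open>y = k1 y1 + k2 y2\<close> and its derivative, where
    \<open>y1' = u y1\<close> and \<open>y2' = (u + v) y2\<close>.\<close>
  define k2 where "k2 = (deriv ?Y w - u (Fin 0) w * ?Y w) / (v (Fin 0) w * comp2 ?g w)"
  define k1 where "k1 = (?Y w - k2 * comp2 ?g w) / comp1 ?g w"
  define h where "h = (\<lambda>q. 1 * y q + (- 1) * (k1 * ?g q $ 1 + k2 * ?g q $ 2))"
  have nz: "comp1 ?g w \<noteq> 0" "comp2 ?g w \<noteq> 0" "v (Fin 0) w \<noteq> 0"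
    using power_germ_nonzero v_nonzero[OF wD] by auto
  have k1: "k1 * comp1 ?g w = ?Y w - k2 * comp2 ?g w" using nz by (simp add: k1_def)
  have k2: "k2 * (v (Fin 0) w * comp2 ?g w) = deriv ?Y w - u (Fin 0) w * ?Y w" using nz by (simp add: k2_def)
  have hw: "h (Fin w) = 0" using k1 by (simp add: h_def)
  have "((\<lambda>w. h (Fin w)) has_field_derivative 1 * deriv ?Y w +
      (- 1) * (k1 * (u (Fin 0) w * comp1 ?g w) + k2 * ((u (Fin 0) w + v (Fin 0) w) * comp2 ?g w))) (at w)"
    unfolding h_def by (intro DERIV_add DERIV_cmult dY dg)
  moreover have "k1 * (u (Fin 0) w * comp1 ?g w) + k2 * ((u (Fin 0) w + v (Fin 0) w) * comp2 ?g w) =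
      u (Fin 0) w * (k1 * comp1 ?g w) + u (Fin 0) w * k2 * comp2 ?g w + k2 * (v (Fin 0) w * comp2 ?g w)"
    by (simp add: algebra_simps)
  then have "k1 * (u (Fin 0) w * comp1 ?g w) + k2 * ((u (Fin 0) w + v (Fin 0) w) * comp2 ?g w) = deriv ?Y w"
    unfolding k1 k2 by (simp add: algebra_simps)
  ultimately have hw': "deriv (\<lambda>w. h (Fin w)) w = 0" by (simp add: DERIV_imp_deriv)
  have hsol: "solution_near b1 b2 (Fin w) h"
    unfolding h_def using t(3,4) w by (intro solution_near_combination) auto
  define f where "f = (\<lambda>q. vector [h q, ?g q $ 1] :: complex^2)"
  have fj: "solution_near b1 b2 (Fin w) (\<lambda>q. f q $ j)" for j
    using hsol t(4)[of 1] w exhaust_2[of j] by (auto simp: f_def)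
  have "\<not> independent_near (Fin w) f"
  proof
    assume "independent_near (Fin w) f"
    then obtain d where "d > 0" "fundamental_on b1 b2 (ball w d) f"
      using fundamental_on_ball[OF _ wD hb, of f] fj unfolding solution_near_iff by (metis finite.simps)
    then have "wronskian f w \<noteq> 0" by (simp add: fundamental_on_def)
    then show False using hw hw' by (simp add: wronskian_def f_def)
  qed
  then obtain c :: "complex^2" where c: "c \<noteq> 0" "\<forall>\<^sub>F q in nhds (Fin w). (\<Sum>j\<in>UNIV. c $ j * f q $ j) = 0"
    unfolding independent_near_def by blast
  have ev: "\<forall>\<^sub>F q in nhds (Fin w). c $ 1 * h q + c $ 2 * ?g q $ 1 = 0"
    using c(2) by (simp add: sum_2 f_def)
  have "c $ 2 = 0" using eventually_nhds_x_imp_x[OF ev] hw nz(1) by simp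
  moreover have "c $ 1 \<noteq> 0" using c(1) \<open>c $ 2 = 0\<close> by (auto simp: vec_eq_iff forall_2)
  ultimately have "\<forall>\<^sub>F q in nhds (chart p t). h q = 0" using ev w by simp
  moreover have "(h \<circ> chart p) holomorphic_on ball 0 e"
    unfolding h_def o_def by (intro holomorphic_intros e)
  ultimately have "\<forall>\<^sub>F q in nhds p. h q = 0" using vanishing_iff_chart[OF e(1) _ t(2)] by blast
  moreover have "y q = h q + (k1 * ?g q $ 1 + k2 * ?g q $ 2)" for q by (simp add: h_def)
  ultimately have "\<forall>\<^sub>F q in nhds p. y q = (\<Sum>j\<in>UNIV. (vector [k1, k2] :: complex^2) $ j * ?g q $ j)"
    by (auto elim!: eventually_mono simp: sum_2)
  then show ?thesis by blast
qed

lemma power_germ_basis: "p \<notin> D \<Longrightarrow> solution_basis b1 b2 p (power_germ a b p)"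
  unfolding solution_basis_iff
  using power_germ_solution power_germ_independent power_germ_spanning by blast

section \<open>Winding numbers and monodromy of the power solutions\<close>

lemma continuous_on_ratio: "b \<in> D \<Longrightarrow> continuous_on (- D) (ratio a b)"
  unfolding continuous_on_def
proof (intro ballI)
  fix q assume "q \<in> - D" "b \<in> D"
  then have "(ratio a b \<longlongrightarrow> ratio a b q) (nhds q)"
    by (intro analytic_at_cp1_tendsto analytic_ratio) auto
  then show "(ratio a b \<longlongrightarrow> ratio a b q) (at q within - D)"
    by (rule tendsto_mono[rotated]) (simp add: at_within_def)
qed

lemma ratio_path:
  assumes "path g" "path_image g \<subseteq> - D" "a \<in> D" "b \<in> D"
  shows "path (ratio a b \<circ> g)" "0 \<notin> path_image (ratio a b \<circ> g)"
proof -
  show "path (ratio a b \<circ> g)"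
    using assms by (intro path_continuous_image continuous_on_subset[OF continuous_on_ratio])
  show "0 \<notin> path_image (ratio a b \<circ> g)"
  proof
    assume "0 \<in> path_image (ratio a b \<circ> g)"
    then obtain q where q: "q \<in> path_image g" "ratio a b q = 0" unfolding path_image_compose by force
    then have "q \<notin> D" using assms(2) by blast
    then show False using assms(3,4) ratio_nonzero[of q a b] q(2) by blast
  qed
qed

definition turns :: "cp1 \<Rightarrow> cp1 \<Rightarrow> (real \<Rightarrow> cp1) \<Rightarrow> complex" where
  "turns a b g = winding_number (ratio a b \<circ> g) 0"

lemma turns_homotopic:
  assumes "homotopic_paths (- D) g h" "a \<in> D" "b \<in> D"
  shows "turns a b g = turns a b h"
  unfolding turns_def
  by (rule winding_number_homotopic_paths, rule homotopic_paths_continuous_image[OF assms(1)])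
    (use assms ratio_nonzero in \<open>auto intro: continuous_on_ratio\<close>)

lemma turns_join:
  assumes "path g" "path_image g \<subseteq> - D" "path h" "path_image h \<subseteq> - D" "pathfinish g = pathstart h" "a \<in> D" "b \<in> D"
  shows "turns a b (g +++ h) = turns a b g + turns a b h"
  unfolding turns_def path_compose_join
  using ratio_path assms by (intro winding_number_join) (auto simp: pathstart_compose pathfinish_compose)

lemma turns_reversepath:
  assumes "path g" "path_image g \<subseteq> - D" "a \<in> D" "b \<in> D"
  shows "turns a b (reversepath g) = - turns a b g"
  unfolding turns_def path_compose_reversepath
  using ratio_path assms by (intro winding_number_reversepath) auto

text \<open>The winding along the connecting path cancels against that of its reverse; only the
  small circle counts.\<close>

lemma turns_loop_around:
  assumes "loop_around D x p g" "a \<in> D" "b \<in> D"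
  shows "turns a b g = of_bool (p = a) - of_bool (p = b)"
proof -
  obtain d r where r: "0 < r" "chart p ` (cball 0 r - {0}) \<inter> D = {}"
    and d: "path d" "path_image d \<subseteq> - D" "pathfinish d = chart p (of_real r)"
    and hom: "homotopic_paths (- D) g (d +++ (chart p \<circ> circlepath 0 r) +++ reversepath d)"
    using assms(1) unfolding loop_around_def by blast
  let ?C = "chart p \<circ> circlepath 0 r"
  have nD: "chart p t \<notin> D" if "t \<noteq> 0" "norm t \<le> r" for t
    using r(2) that by (auto simp: disjoint_iff)
  have C: "path ?C" "path_image ?C \<subseteq> - D" "pathstart ?C = chart p (of_real r)" "pathfinish ?C = chart p (of_real r)"
  proof -
    show "path ?C" by (intro path_continuous_image continuous_on_chart path_circlepath)
    show "path_image ?C \<subseteq> - D"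
    proof -
      have "sphere 0 r \<subseteq> cball 0 r - {0}" using r(1) by auto
      then show ?thesis using r unfolding path_image_compose by auto
    qed
  qed (simp_all add: pathstart_compose pathfinish_compose)
  have Cr: "path (?C +++ reversepath d)" "path_image (?C +++ reversepath d) \<subseteq> - D"
    using C d by (auto simp: path_image_join)
  have cancel: "u + (v + - u) = v" for u v :: complex by simp
  have "turns a b g = turns a b (d +++ (?C +++ reversepath d))"
    by (rule turns_homotopic[OF hom assms(2,3)])
  also have "\<dots> = turns a b d + turns a b (?C +++ reversepath d)"
    using C d Cr assms(2,3) by (intro turns_join) auto
  also have "turns a b (?C +++ reversepath d) = turns a b ?C + turns a b (reversepath d)"
    using C d assms(2,3) by (intro turns_join) auto
  also have "turns a b (reversepath d) = - turns a b d" by (rule turns_reversepath[OF d(1,2) assms(2,3)])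
  finally have "turns a b g = turns a b ?C" unfolding cancel .
  also have "\<dots> = of_bool (p = a) - of_bool (p = b)"
    unfolding turns_def using nD assms by (intro winding_number_ratio_circle r(1)) auto
  finally show ?thesis .
qed

lemma log_along_loop:
  assumes g: "is_loop (- D) x g" and ab: "a \<in> D" "b \<in> D"
  obtains k where "continuous_on {0..1} k" "\<And>s. s \<in> {0..1} \<Longrightarrow> ratio a b (g s) = exp (k s)"
    "k 0 = Ln (ratio a b x)" "k 1 = Ln (ratio a b x) + 2 * of_real pi * \<i> * turns a b g"
proof -
  have g': "path g" "path_image g \<subseteq> - D" "g 0 = x"
    using g by (auto simp: is_loop_def pathstart_def)
  obtain q where q: "path q" "pathfinish q - pathstart q = 2 * of_real pi * \<i> * winding_number (ratio a b \<circ> g) 0"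
    "\<And>t. t \<in> {0..1} \<Longrightarrow> (ratio a b \<circ> g) t = 0 + exp (q t)"
    using winding_number_as_continuous_log[OF ratio_path[OF g'(1,2) ab]] by blast
  \<comment> \<open>\<open>q\<close> is shifted to start at the principal logarithm; the shift is a
    period of \<open>exp\<close>, since both are logarithms of the same number.\<close>
  define k where "k = (\<lambda>s. Ln (ratio a b x) + (q s - q 0))"
  have nz: "ratio a b x = exp (q 0)" using q(3)[of 0] g'(3) by simp
  show ?thesis
  proof (rule that[of k])
    show "continuous_on {0..1} k" using q(1) unfolding k_def path_def by (intro continuous_intros)
    show "ratio a b (g s) = exp (k s)" if "s \<in> {0..1}" for s
      using q(3)[OF that] nz by (simp add: k_def exp_add exp_diff)
    show "k 1 = Ln (ratio a b x) + 2 * of_real pi * \<i> * turns a b g"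
      using q(2) by (simp add: k_def turns_def pathstart_def pathfinish_def)
  qed (simp add: k_def)
qed

text \<open>The sign is negative because the initial basis equals the continued one times the
  monodromy matrix: continuation multiplies by the inverse.\<close>

definition multiplier1 :: "(real \<Rightarrow> cp1) \<Rightarrow> complex" where
  "multiplier1 g = exp (- (2 * of_real pi * \<i> * (l * turns p1 p3 g + m * turns p2 p3 g)))"

definition multiplier2 :: "(real \<Rightarrow> cp1) \<Rightarrow> complex" where
  "multiplier2 g = exp (- (2 * of_real pi * \<i> * ((l + \<nu>) * turns p1 p3 g + (m - \<nu>) * turns p2 p3 g)))"

text \<open>Continuation shifts the two logarithms by \<open>2 pi i\<close> times the winding
  numbers; by \<open>log_germ_coherent\<close> the germs along the loop fit together.\<close>

lemma power_germ_monodromy: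
  assumes g: "is_loop (- D) x g"
  defines "Y \<equiv> power_germ (Ln (ratio p1 p3 x)) (Ln (ratio p2 p3 x)) x"
  obtains F where "germ_family g F" "F 0 = Y" "\<And>q. Y q = F 1 q v* diag2 (multiplier1 g) (multiplier2 g)"
proof -
  have g': "path g" "path_image g \<subseteq> - D" "g 0 = x" "g 1 = x"
    using g by (auto simp: is_loop_def pathstart_def pathfinish_def)
  have gD: "g s \<notin> D" if "s \<in> {0..1}" for s using g'(2) that unfolding path_image_def by blast
  obtain k1 where k1: "continuous_on {0..1} k1" "\<And>s. s \<in> {0..1} \<Longrightarrow> ratio p1 p3 (g s) = exp (k1 s)"
    "k1 0 = Ln (ratio p1 p3 x)" "k1 1 = Ln (ratio p1 p3 x) + 2 * of_real pi * \<i> * turns p1 p3 g"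
    using log_along_loop[OF g, of p1 p3] by blast
  obtain k2 where k2: "continuous_on {0..1} k2" "\<And>s. s \<in> {0..1} \<Longrightarrow> ratio p2 p3 (g s) = exp (k2 s)"
    "k2 0 = Ln (ratio p2 p3 x)" "k2 1 = Ln (ratio p2 p3 x) + 2 * of_real pi * \<i> * turns p2 p3 g"
    using log_along_loop[OF g, of p2 p3] by blast
  define F where "F = (\<lambda>s. power_germ (k1 s) (k2 s) (g s))"
  show ?thesis
  proof (rule that[of F])
    show "F 0 = Y" by (simp add: F_def Y_def k1 k2 g')
    show "germ_family g F"
      unfolding germ_family_def
    proof (intro ballI conjI allI)
      fix s :: real assume s: "s \<in> {0..1}"
      show "analytic_at_cp1 (\<lambda>q. F s q $ j) (g s)" for j
        unfolding F_def by (rule analytic_power_germ[OF gD[OF s]])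
      have "\<forall>\<^sub>F u in at s within {0..1}. \<forall>\<^sub>F q in nhds (g u). log_germ p1 p3 (k1 u) (g u) q = log_germ p1 p3 (k1 s) (g s) q"
        by (rule log_germ_coherent[OF g'(1) k1(1,2) _ s]) (use gD in auto)
      moreover have "\<forall>\<^sub>F u in at s within {0..1}. \<forall>\<^sub>F q in nhds (g u). log_germ p2 p3 (k2 u) (g u) q = log_germ p2 p3 (k2 s) (g s) q"
        by (rule log_germ_coherent[OF g'(1) k2(1,2) _ s]) (use gD in auto)
      ultimately show "\<forall>\<^sub>F u in at s within {0..1}. \<forall>\<^sub>F q in nhds (g u). F u q = F s q"
      proof eventually_elim
        case (elim u)
        then show ?case by eventually_elim (simp add: F_def power_germ_def)
      qed
    qed
    fix q
    have lg: "log_germ p1 p3 (k1 1) x q = log_germ p1 p3 (Ln (ratio p1 p3 x)) x q + 2 * of_real pi * \<i> * turns p1 p3 g"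
      "log_germ p2 p3 (k2 1) x q = log_germ p2 p3 (Ln (ratio p2 p3 x)) x q + 2 * of_real pi * \<i> * turns p2 p3 g"
      by (simp_all add: log_germ_def k1 k2)
    show "Y q = F 1 q v* diag2 (multiplier1 g) (multiplier2 g)"
      unfolding vec_eq_iff forall_2 vector_diag2
      by (simp add: F_def Y_def g' power_germ_def lg multiplier1_def multiplier2_def exp_add[symmetric])
        (simp add: algebra_simps)
  qed
qed

text \<open>Passing to the basis \<open>?Y v* matrix_inv S\<close> conjugates the diagonal matrix of
  multipliers by \<open>S\<close>.\<close>

lemma power_realizes:
  assumes S: "invertible S" and x: "x \<notin> D"
    and \<rho>: "\<And>g. is_loop (- D) x g \<Longrightarrow> \<rho> (path_class (- D) g) = conj_diag S (multiplier1 g) (multiplier2 g)"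
  shows "realizes D x b1 b2 \<rho>"
proof -
  let ?T = "matrix_inv S"
  let ?Y = "power_germ (Ln (ratio p1 p3 x)) (Ln (ratio p2 p3 x)) x"
  have T: "invertible ?T" unfolding invertible_def using matrix_inv_both[OF S] by blast
  have basis: "solution_basis b1 b2 x (\<lambda>q. ?Y q v* ?T)"
    by (rule solution_basis_matrix[OF power_germ_basis[OF x] T])
  have cont: "\<exists>Y'. continuation_along g (\<lambda>q. ?Y q v* ?T) Y' \<and>
      (\<forall>\<^sub>F q in nhds x. ?Y q v* ?T = Y' q v* \<rho> (path_class (- D) g))"
    if g: "is_loop (- D) x g" for g
  proof -
    obtain F where F: "germ_family g F" "F 0 = ?Y" "\<And>q. ?Y q = F 1 q v* diag2 (multiplier1 g) (multiplier2 g)"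
      using power_germ_monodromy[OF g] by blast
    show ?thesis
    proof (intro exI[of _ "\<lambda>q. F 1 q v* ?T"] conjI)
      show "continuation_along g (\<lambda>q. ?Y q v* ?T) (\<lambda>q. F 1 q v* ?T)"
        unfolding continuation_along_iff
        by (intro exI[of _ "\<lambda>s q. F s q v* ?T"] conjI germ_family_matrix F(1)) (simp_all add: F(2))
      have "?Y q v* ?T = (F 1 q v* ?T) v* \<rho> (path_class (- D) g)" for q
      proof -
        have "?T ** \<rho> (path_class (- D) g) = diag2 (multiplier1 g) (multiplier2 g) ** ?T"
          unfolding \<rho>[OF g] conj_diag_def by (simp add: matrix_mul_assoc matrix_inv_both[OF S])
        then have "(F 1 q v* ?T) v* \<rho> (path_class (- D) g) = F 1 q v* (diag2 (multiplier1 g) (multiplier2 g) ** ?T)"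
          by (simp add: vector_matrix_mul_assoc)
        also have "\<dots> = ?Y q v* ?T" unfolding F(3) by (simp only: vector_matrix_mul_assoc)
        finally show ?thesis by simp
      qed
      then show "\<forall>\<^sub>F q in nhds x. ?Y q v* ?T = F 1 q v* ?T v* \<rho> (path_class (- D) g)" by simp
    qed
  qed
  show ?thesis
    unfolding realizes_def
    by (rule exI[of _ "\<lambda>q. ?Y q v* ?T"], rule conjI[OF basis]) (use cont in blast)
qed

lemma multiplier_nonzero: "multiplier1 g \<noteq> 0" "multiplier2 g \<noteq> 0"
  by (simp_all add: multiplier1_def multiplier2_def)

lemma multiplier_homotopic:
  assumes "homotopic_paths (- D) g h"
  shows "multiplier1 g = multiplier1 h" "multiplier2 g = multiplier2 h"
  using turns_homotopic[OF assms] by (auto simp: multiplier1_def multiplier2_def)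

lemma multiplier_join:
  assumes "is_loop (- D) x g" "is_loop (- D) x h"
  shows "multiplier1 (g +++ h) = multiplier1 g * multiplier1 h"
    "multiplier2 (g +++ h) = multiplier2 g * multiplier2 h"
proof -
  have t: "turns a b (g +++ h) = turns a b g + turns a b h" if "a \<in> D" "b \<in> D" for a b
    using assms that by (intro turns_join) (auto simp: is_loop_def)
  show "multiplier1 (g +++ h) = multiplier1 g * multiplier1 h"
    "multiplier2 (g +++ h) = multiplier2 g * multiplier2 h"
    unfolding multiplier1_def multiplier2_def t[of p1 p3, simplified] t[of p2 p3, simplified]
      exp_add[symmetric]
    by (rule arg_cong[of _ _ exp], simp add: algebra_simps)+
qed

lemma multiplier_reversepath:
  assumes "is_loop (- D) x g"
  shows "multiplier1 (reversepath g) = 1 / multiplier1 g" "multiplier2 (reversepath g) = 1 / multiplier2 g"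
proof -
  have t: "turns a b (reversepath g) = - turns a b g" if "a \<in> D" "b \<in> D" for a b
  proof -
    have "path g" "path_image g \<subseteq> - D" using assms by (simp_all add: is_loop_def)
    then show ?thesis using that by (rule turns_reversepath)
  qed
  have inv: "1 / exp (- z) = exp z" for z :: complex by (simp add: exp_minus divide_inverse)
  show "multiplier1 (reversepath g) = 1 / multiplier1 g" "multiplier2 (reversepath g) = 1 / multiplier2 g"
    unfolding multiplier1_def multiplier2_def t[of p1 p3, simplified] t[of p2 p3, simplified] inv
    by (rule arg_cong[of _ _ exp], simp add: algebra_simps)+
qed

lemma multiplier_const:
  assumes "x \<notin> D"
  shows "multiplier1 (\<lambda>_. x) = 1" "multiplier2 (\<lambda>_. x) = 1"
proof -
  have t: "turns a b (\<lambda>_. x) = 0" if "a \<in> D" "b \<in> D" for a b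
  proof -
    have "ratio a b x \<noteq> 0" using that assms by (intro ratio_nonzero) auto
    then show ?thesis using winding_number_trivial[of 0 "ratio a b x"]
      by (simp add: turns_def o_def linepath_refl)
  qed
  show "multiplier1 (\<lambda>_. x) = 1" "multiplier2 (\<lambda>_. x) = 1"
    by (simp_all add: multiplier1_def multiplier2_def t)
qed

text \<open>Two homomorphisms agree if they agree on generators. The multipliers are defined on
  loops and not on classes, so the induction leaves the representative \<open>g\<close> arbitrary
  and uses invariance under homotopy.\<close>

lemma hom_eq_multipliers:
  assumes S: "invertible S" and x: "x \<notin> D"
    and \<rho>: "\<rho> \<in> hom (fundamental_group (- D) x) GL2"
    and gen: "generate (fundamental_group (- D) x) (range (\<lambda>i. path_class (- D) (\<gamma> i))) =
              carrier (fundamental_group (- D) x)"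
    and \<gamma>: "\<And>i. is_loop (- D) x (\<gamma> i)"
      "\<And>i. \<rho> (path_class (- D) (\<gamma> i)) = conj_diag S (multiplier1 (\<gamma> i)) (multiplier2 (\<gamma> i))"
    and g: "is_loop (- D) x g"
  shows "\<rho> (path_class (- D) g) = conj_diag S (multiplier1 g) (multiplier2 g)"
proof -
  let ?P = "fundamental_group (- D) x"
  have P: "group ?P" using x by (intro group_fundamental_group) simp
  interpret group_hom ?P GL2 \<rho>
    using P \<rho> group_GL2 by (simp add: group_hom_def group_hom_axioms_def)
  let ?M = "\<lambda>g. conj_diag S (multiplier1 g) (multiplier2 g)"
  have hom: "?M g = ?M h" if "is_loop (- D) x h" "path_class (- D) g = path_class (- D) h" for g h
  proof -
    have "h \<in> path_class (- D) h" using that(1) by (simp add: path_class_def is_loop_def)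
    then have "homotopic_paths (- D) g h" using that(2) by (auto simp: path_class_def)
    then show ?thesis using multiplier_homotopic by simp
  qed
  have "\<rho> A = ?M g" if "A \<in> generate ?P (range (\<lambda>i. path_class (- D) (\<gamma> i)))"
    "A = path_class (- D) g" for A g
    using that
  proof (induction A arbitrary: g rule: generate.induct)
    case one
    have "?M g = ?M (\<lambda>_. x)"
      using one x by (intro hom is_loop_const) (auto simp: one_fundamental_group)
    then show ?case
      using hom_one multiplier_const[OF x] conj_diag_scalar[OF S, of 1] by (simp add: GL2_def)
  next
    case (incl A)
    then obtain i where i: "A = path_class (- D) (\<gamma> i)" by blast
    then have "?M g = ?M (\<gamma> i)" using incl by (intro hom \<gamma>(1)) simp
    then show ?case using \<gamma>(2) i by simp
  next
    case (inv A)
    then obtain i where i: "A = path_class (- D) (\<gamma> i)" by blast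
    have car: "path_class (- D) (\<gamma> i) \<in> carrier ?P" "path_class (- D) (reversepath (\<gamma> i)) \<in> carrier ?P"
      using \<gamma>(1)[of i] by (auto simp: carrier_fundamental_group intro: is_loop_reversepath)
    have "path_class (- D) (reversepath (\<gamma> i)) \<otimes>\<^bsub>?P\<^esub> path_class (- D) (\<gamma> i) = \<one>\<^bsub>?P\<^esub>"
      using \<gamma>(1)[of i] by (simp add: mult_path_class is_loop_reversepath one_fundamental_group
          path_class_eqI homotopic_paths_reversepath_left)
    then have "inv\<^bsub>?P\<^esub> A = path_class (- D) (reversepath (\<gamma> i))"
      unfolding i using car by (intro group.inv_equality[OF P])
    then have "?M g = ?M (reversepath (\<gamma> i))"
      using inv \<gamma>(1) by (intro hom is_loop_reversepath) auto
    also have "\<dots> = inv\<^bsub>GL2\<^esub> (?M (\<gamma> i))"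
      by (subst GL2_inv_conj_diag(2)[OF S])
        (simp_all add: multiplier_reversepath[OF \<gamma>(1)] multiplier_nonzero)
    also have "\<dots> = \<rho> (inv\<^bsub>?P\<^esub> A)" using car i \<gamma>(2) by simp
    finally show ?case by simp
  next
    case (eng A B)
    have "A \<in> carrier ?P" "B \<in> carrier ?P" using eng gen by auto
    then obtain h k where h: "A = path_class (- D) h" "is_loop (- D) x h"
      and k: "B = path_class (- D) k" "is_loop (- D) x k"
      by (auto simp: carrier_fundamental_group)
    have "A \<otimes>\<^bsub>?P\<^esub> B = path_class (- D) (h +++ k)" using h k by (simp add: mult_path_class)
    then have "?M g = ?M (h +++ k)" using eng(5) h k by (intro hom is_loop_join) auto
    also have "\<dots> = ?M h ** ?M k"
      using multiplier_join[OF h(2) k(2)] conj_diag_mult[OF S] by simp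
    also have "\<dots> = \<rho> A ** \<rho> B" using eng(3)[OF h(1)] eng(4)[OF k(1)] by simp
    also have "\<dots> = \<rho> (A \<otimes>\<^bsub>?P\<^esub> B)"
      using \<open>A \<in> carrier ?P\<close> \<open>B \<in> carrier ?P\<close> by (simp add: GL2_def)
    finally show ?case by simp
  qed
  moreover have "path_class (- D) g \<in> carrier ?P" using g by (auto simp: carrier_fundamental_group)
  ultimately show ?thesis using gen by blast
qed

end

section \<open>Realizing a diagonal representation with a scalar matrix\<close>

lemma loop_around_is_loop:
  assumes "loop_around D x p g"
  shows "is_loop (- D) x g"
proof -
  obtain d r where d: "pathstart d = x"
    and hom: "homotopic_paths (- D) g (d +++ (chart p \<circ> circlepath 0 r) +++ reversepath d)"
    using assms unfolding loop_around_def by blast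
  show ?thesis
    using homotopic_paths_imp_path[OF hom] homotopic_paths_imp_subset[OF hom]
      homotopic_paths_imp_pathstart[OF hom] homotopic_paths_imp_pathfinish[OF hom] d
    by (simp add: is_loop_def)
qed

lemma exists_log_2pi:
  assumes "z \<noteq> 0"
  obtains c where "exp (- (2 * of_real pi * \<i> * c)) = z"
proof (rule that[of "- Ln z / (2 * of_real pi * \<i>)"])
  have "2 * of_real pi * \<i> * (- Ln z / (2 * of_real pi * \<i>)) = - Ln z" by simp
  then show "exp (- (2 * of_real pi * \<i> * (- Ln z / (2 * of_real pi * \<i>)))) = z"
    using assms by (simp only: minus_minus) simp
qed

text \<open>The point with scalar matrix takes the role of \<open>p3\<close>. Then \<open>l\<close>
  and \<open>m\<close> come from logarithms of \<open>\<alpha>\<close> at the other two points and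
  \<open>\<nu>\<close> from one of \<open>\<beta> i / \<alpha> i\<close>; the remaining entries are
  forced by the product relation and \<open>\<alpha> k = \<beta> k\<close>.\<close>

lemma scalar_imp_realized:
  fixes a :: "3 \<Rightarrow> cp1"
  assumes a: "inj a" "x \<notin> range a" and loops: "standard_loops a x \<gamma>"
    and \<rho>: "\<rho> \<in> hom (fundamental_group (- range a) x) GL2"
    and S: "invertible S" "\<And>i. \<rho> (path_class (- range a) (\<gamma> i)) = conj_diag S (\<alpha> i) (\<beta> i)"
    and k: "\<alpha> k = \<beta> k"
  shows "\<exists>b1 b2. riemann_equation (range a) b1 b2 \<and> realizes (range a) x b1 b2 \<rho>"
proof -
  let ?P = "fundamental_group (- range a) x"
  let ?c = "\<lambda>i. path_class (- range a) (\<gamma> i)"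
  have gen: "generate ?P (range ?c) = carrier ?P" and around: "\<And>i. loop_around (range a) x (a i) (\<gamma> i)"
    and prod: "?c 1 \<otimes>\<^bsub>?P\<^esub> ?c 2 \<otimes>\<^bsub>?P\<^esub> ?c 3 = \<one>\<^bsub>?P\<^esub>"
    using loops by (auto simp: standard_loops_def Let_def)
  note is_loop = around[THEN loop_around_is_loop]
  have grp: "group ?P" using a by (intro group_fundamental_group) simp
  interpret group_hom ?P GL2 \<rho>
    using grp \<rho> group_GL2 by (simp add: group_hom_def group_hom_axioms_def)
  have car: "?c i \<in> carrier ?P" for i using is_loop by (auto simp: carrier_fundamental_group)
  have nz: "\<alpha> i \<noteq> 0" "\<beta> i \<noteq> 0" for i
  proof -
    have "invertible (conj_diag S (\<alpha> i) (\<beta> i))"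
      using hom_closed[OF car[of i]] unfolding S(2) by (simp add: GL2_def)
    then show "\<alpha> i \<noteq> 0" "\<beta> i \<noteq> 0" using conj_diag_invertible_nonzero[OF S(1)] by blast+
  qed
  have "\<rho> (?c 1 \<otimes>\<^bsub>?P\<^esub> ?c 2 \<otimes>\<^bsub>?P\<^esub> ?c 3) = \<rho> (?c 1) ** \<rho> (?c 2) ** \<rho> (?c 3)"
    using car by (simp add: GL2_def)
  then have "conj_diag S (\<alpha> 1 * \<alpha> 2 * \<alpha> 3) (\<beta> 1 * \<beta> 2 * \<beta> 3) = conj_diag S 1 1"
    unfolding prod hom_one S(2) by (simp add: GL2_def conj_diag_mult[OF S(1)] conj_diag_scalar[OF S(1)])
  then have "\<alpha> 1 * \<alpha> 2 * \<alpha> 3 = 1" "\<beta> 1 * \<beta> 2 * \<beta> 3 = 1"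
    by (simp_all only: conj_diag_eq_iff[OF S(1)])
  \<comment> \<open>As \<open>k\<close> is arbitrary, the relation is rewritten as a product over
    \<open>UNIV\<close>, which is symmetric in the indices.\<close>
  moreover have "(\<Prod>i\<in>UNIV. f i) = f 1 * f 2 * f 3" for f :: "3 \<Rightarrow> complex"
    unfolding UNIV_3 by (simp add: mult.assoc)
  ultimately have P1: "(\<Prod>i\<in>UNIV. \<alpha> i) = 1" "(\<Prod>i\<in>UNIV. \<beta> i) = 1"
    by simp_all
  have "card (UNIV - {k} :: 3 set) = 2" by (simp add: card_Diff_singleton)
  then obtain i j where *: "UNIV - {k} = {i, j}" "i \<noteq> j" unfolding card_2_iff by blast
  have ij: "i \<noteq> j" "i \<noteq> k" "j \<noteq> k" using * by auto
  have univ: "UNIV = {i, j, k}" using *(1) by auto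
  have prods: "\<alpha> i * \<alpha> j * \<alpha> k = 1" "\<beta> i * \<beta> j * \<beta> k = 1"
    using P1 ij unfolding univ by (simp_all add: mult.assoc)
  obtain l where l: "exp (- (2 * of_real pi * \<i> * l)) = \<alpha> i" using exists_log_2pi nz by blast
  obtain m where m: "exp (- (2 * of_real pi * \<i> * m)) = \<alpha> j" using exists_log_2pi nz by blast
  obtain \<nu> where exp_nu: "exp (- (2 * of_real pi * \<i> * \<nu>)) = \<beta> i / \<alpha> i" and nu_nonzero: "\<nu> \<noteq> 0"
  proof -
    obtain n where n: "exp (- (2 * of_real pi * \<i> * n)) = \<beta> i / \<alpha> i"
      using exists_log_2pi[of "\<beta> i / \<alpha> i"] nz by auto
    \<comment> \<open>If \<open>n = 0\<close> the quotient is 1, and 1 serves as well, being a full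
      period.\<close>
    have "exp (- (2 * of_real pi * \<i> * (if n = 0 then 1 else n))) = \<beta> i / \<alpha> i"
      using n by (auto simp: exp_minus)
    then show ?thesis using that[of "if n = 0 then 1 else n"] by simp
  qed
  interpret power_solutions "a i" "a j" "a k" l m \<nu>
    by standard (use a(1) ij nu_nonzero in \<open>auto dest: injD\<close>)
  have D: "range a = {a i, a j, a k}" using univ by auto
  have mult: "\<rho> (?c n) = conj_diag S (multiplier1 (\<gamma> n)) (multiplier2 (\<gamma> n))" for n
  proof -
    have turns: "turns (a i) (a k) (\<gamma> n) = of_bool (n = i) - of_bool (n = k)"
      "turns (a j) (a k) (\<gamma> n) = of_bool (n = j) - of_bool (n = k)"
      using turns_loop_around[OF around[of n, unfolded D]] injD[OF a(1)] by (auto simp: of_bool_def)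
    have "n = i \<or> n = j \<or> n = k" using univ by auto
    then have "\<alpha> n = multiplier1 (\<gamma> n) \<and> \<beta> n = multiplier2 (\<gamma> n)"
    proof (elim disjE)
      assume n: "n = i"
      have "multiplier2 (\<gamma> n) = exp (- (2 * of_real pi * \<i> * l)) * exp (- (2 * of_real pi * \<i> * \<nu>))"
        unfolding multiplier2_def turns exp_add[symmetric]
        by (rule arg_cong[of _ _ exp]) (use n ij in \<open>simp add: algebra_simps\<close>)
      also have "\<dots> = \<beta> i" unfolding l exp_nu using nz by simp
      finally show ?thesis using turns n ij l by (simp add: multiplier1_def)
    next
      assume n: "n = j"
      have "multiplier2 (\<gamma> n) = exp (- (2 * of_real pi * \<i> * m)) / exp (- (2 * of_real pi * \<i> * \<nu>))"
        unfolding multiplier2_def turns exp_diff[symmetric]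
        by (rule arg_cong[of _ _ exp]) (use n ij in \<open>simp add: algebra_simps\<close>)
      also have "\<dots> = \<alpha> j * \<alpha> i / \<beta> i" using m exp_nu by simp
      \<comment> \<open>\<open>\<alpha> i * \<alpha> j = \<beta> i * \<beta> j\<close>, since both
        are inverse to \<open>\<alpha> k = \<beta> k\<close>.\<close>
      also have "\<dots> = \<beta> j" using prods k nz by (simp add: field_simps) (metis mult.commute mult_right_cancel mult.assoc)
      finally show ?thesis using turns n ij m by (simp add: multiplier1_def)
    next
      assume n: "n = k"
      have "exp (2 * of_real pi * \<i> * (l + m)) = inverse (exp (- (2 * of_real pi * \<i> * l)) * exp (- (2 * of_real pi * \<i> * m)))"
        unfolding exp_add[symmetric] exp_minus[symmetric]
        by (rule arg_cong[of _ _ exp]) (simp add: algebra_simps)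
      also have "\<dots> = \<alpha> k" unfolding l m using prods(1) nz by (simp add: field_simps)
      finally have "exp (2 * of_real pi * \<i> * (l + m)) = \<alpha> k" .
      moreover have "multiplier1 (\<gamma> n) = exp (2 * of_real pi * \<i> * (l + m))"
        "multiplier2 (\<gamma> n) = exp (2 * of_real pi * \<i> * (l + m))"
        unfolding multiplier1_def multiplier2_def turns
        by (rule arg_cong[of _ _ exp], use n ij in \<open>simp add: algebra_simps\<close>)+
      ultimately show ?thesis using n k by simp
    qed
    then show ?thesis using S(2)[of n] by simp
  qed
  have "realizes {a i, a j, a k} x b1 b2 \<rho>"
  proof (rule power_realizes[OF S(1)])
    show "x \<notin> {a i, a j, a k}" using a(2) D by simp
    show "\<rho> (path_class (- {a i, a j, a k}) g) = conj_diag S (multiplier1 g) (multiplier2 g)"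
      if "is_loop (- {a i, a j, a k}) x g" for g
      by (rule hom_eq_multipliers[where \<gamma> = \<gamma>, OF S(1)]) (use a(2) \<rho> gen is_loop mult that in \<open>simp_all add: D\<close>)
  qed
  then show ?thesis using riemann_equation_power unfolding D by blast
qed

theorem theorem1p2:
  fixes a :: "3 \<Rightarrow> cp1" and x :: cp1
    and \<gamma> :: "3 \<Rightarrow> real \<Rightarrow> cp1"
    and \<rho> :: "(real \<Rightarrow> cp1) set \<Rightarrow> complex^2^2"
    and G :: "3 \<Rightarrow> complex^2^2"
  assumes "inj a"
    and "x \<notin> range a"
    and "standard_loops a x \<gamma>"
    and "\<rho> \<in> hom (fundamental_group (- range a) x) GL2"
    and "\<And>i. G i = \<rho> (path_class (- range a) (\<gamma> i))"
    and "\<exists>S \<alpha> \<beta>. invertible S \<and> (\<forall>i. matrix_inv S ** G i ** S = diag2 (\<alpha> i) (\<beta> i))"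
  shows "(\<exists>b1 b2. riemann_equation (range a) b1 b2 \<and> realizes (range a) x b1 b2 \<rho>) \<longleftrightarrow>
         (\<exists>i. scalar_matrix (G i))"
proof -
  obtain S \<alpha> \<beta> where S: "invertible S" and diag: "\<And>i. matrix_inv S ** G i ** S = diag2 (\<alpha> i) (\<beta> i)"
    using assms(6) by blast
  have G: "G i = conj_diag S (\<alpha> i) (\<beta> i)" for i by (rule conj_diag_eqI[OF S diag])
  have \<rho>: "\<rho> (path_class (- range a) (\<gamma> i)) = conj_diag S (\<alpha> i) (\<beta> i)" for i
    using G assms(5) by simp
  have "scalar_matrix (G i) \<longleftrightarrow> \<alpha> i = \<beta> i" for i unfolding G by (rule scalar_conj_diag[OF S])
  then show ?thesis
    using realized_diagonal_imp_scalar[OF assms(1-4) S \<rho>] scalar_imp_realized[OF assms(1-4) S \<rho>] by blast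
qed

end
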